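(* Let $\alpha>-1/2$. Suppose that $E\subset\mathbb{R}^+$ is a measurable set that is relatively dense with respect to $\mu_\alpha$, meaning that there is $\gamma>0$ such that $$\mu_\alpha(E\cap[r,r+1])\ge\gamma\,\mu_\alpha([r,r+1])\qquad\text{for all } r\ge 0.$$ Then there exists a constant $C>0$, depending on $\alpha$ and $\gamma$ but not on $R$, such that for all sufficiently large $R>0$ the following holds: if $f\in L^2_\alpha(\mathbb{R}^+)$ satisfies $\operatorname{supp}\mathcal{F}_\alpha(f)\subset[R,R+1]$, then $$\|f\|_{L^2_\alpha(\mathbb{R}^+)}\le C\,\|f\|_{L^2_\alpha(E)}.$$
   Context: $\mathbb{R}^+=[0,\infty)$. For $\alpha>-1/2$, the measure $\mu_\alpha$ on $\mathbb{R}^+$ is $d\mu_\alpha(x)=\frac{2\pi^{\alpha+1}}{\Gamma(\alpha+1)}\,x^{2\alpha+1}\,dx$. The space $L^p_\alpha(\mathbb{R}^+)$, $1\le p<\infty$, consists of the measurable functions $f:\mathbb{R}^+\to\mathbb{R}$ with $\|f\|_{L^p_\alpha}=\left(\int_0^\infty|f(x)|^p\,d\mu_\alpha(x)\right)^{1/p}<\infty$; for measurable $E\subset\mathbb{R}^+$, $\|f\|_{L^2_\alpha(E)}=\left(\int_E|f|^2\,d\mu_\alpha\right)^{1/2}$. The modified Bessel function is $j_\alpha(x)=\Gamma(\alpha+1)\sum_{n=0}^\infty\frac{(-1)^n}{n!\,\Gamma(n+\alpha+1)}\left(\frac{x}{2}\right)^{2n}$. The Fourier–Bessel transform is $\mathcal{F}_\alpha(f)(y)=\int_0^\infty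 f(x)\,j_\alpha(2\pi xy)\,d\mu_\alpha(x)$ for $f \in L^1_\alpha(\mathbb{R}^+)\cap L^2_\alpha(\mathbb{R}^+)$, and it extends to an isometry of $L^2_\alpha(\mathbb{R}^+)$; for $f\in L^2_\alpha(\mathbb{R}^+)$, $\mathcal{F}_\alpha(f)$ denotes this extension. *)

theory Defs
  imports "HOL-Analysis.Analysis"
begin

text \<open>
  The half-line is the space of the measure, so \<open>sets (bessel_measure \<alpha>)\<close> consists of the
  Lebesgue measurable subsets of \<open>{0..}\<close>, and the values of a function on negative reals
  are irrelevant.
\<close>

definition bessel_measure :: "real \<Rightarrow> real measure" where
  "bessel_measure \<alpha> = density (lebesgue_on {0..})
     (\<lambda>x. ennreal (2 * pi powr (\<alpha> + 1) / Gamma (\<alpha> + 1) * x powr (2 * \<alpha> + 1)))"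

definition Lp_space :: "real \<Rightarrow> real \<Rightarrow> (real \<Rightarrow> real) set" where
  "Lp_space p \<alpha> = {f \<in> borel_measurable (bessel_measure \<alpha>).
     integrable (bessel_measure \<alpha>) (\<lambda>x. \<bar>f x\<bar> powr p)}"

definition Lp_norm_on :: "real \<Rightarrow> real \<Rightarrow> real set \<Rightarrow> (real \<Rightarrow> real) \<Rightarrow> real" where
  "Lp_norm_on p \<alpha> E f = (LINT x:E|bessel_measure \<alpha>. \<bar>f x\<bar> powr p) powr (1 / p)"

abbreviation Lp_norm :: "real \<Rightarrow> real \<Rightarrow> (real \<Rightarrow> real) \<Rightarrow> real" where
  "Lp_norm p \<alpha> \<equiv> Lp_norm_on p \<alpha> {0..}"

definition bessel_j :: "real \<Rightarrow> real \<Rightarrow> real" where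
  "bessel_j \<alpha> x = Gamma (\<alpha> + 1) *
     (\<Sum>n. (-1) ^ n / (fact n * Gamma (real n + \<alpha> + 1)) * (x / 2) ^ (2 * n))"

definition fourier_bessel_integral :: "real \<Rightarrow> (real \<Rightarrow> real) \<Rightarrow> real \<Rightarrow> real" where
  "fourier_bessel_integral \<alpha> f y = (LINT x|bessel_measure \<alpha>. f x * bessel_j \<alpha> (2 * pi * x * y))"

text \<open>
  The continuous extension of the transform from \<open>L\<^sup>1 \<inter> L\<^sup>2\<close> to \<open>L\<^sup>2\<close>. Its values are classes of
  functions modulo null sets, so it is given as a relation: \<open>g\<close> is a representative of the
  transform of \<open>f\<close>. By Plancherel, every \<open>f\<close> in \<open>L\<^sup>2\<close> has such a \<open>g\<close>, unique up to null sets, and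
  the condition that the transforms of the \<open>h n\<close> lie in \<open>L\<^sup>2\<close> always holds; it is listed
  because \<open>Lp_norm\<close> is meaningful on \<open>Lp_space\<close> only (the integral of a non-integrable function
  is 0).
\<close>

definition has_fourier_bessel :: "real \<Rightarrow> (real \<Rightarrow> real) \<Rightarrow> (real \<Rightarrow> real) \<Rightarrow> bool" where
  "has_fourier_bessel \<alpha> f g \<longleftrightarrow>
     f \<in> Lp_space 2 \<alpha> \<and> g \<in> Lp_space 2 \<alpha> \<and>
     (\<exists>h :: nat \<Rightarrow> real \<Rightarrow> real.
        (\<forall>n. h n \<in> Lp_space 1 \<alpha> \<inter> Lp_space 2 \<alpha> \<and>
             fourier_bessel_integral \<alpha> (h n) \<in> Lp_space 2 \<alpha>) \<and>
        (\<lambda>n. Lp_norm 2 \<alpha> (\<lambda>x. h n x - f x)) \<longlonglongrightarrow> 0 \<and>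
        (\<lambda>n. Lp_norm 2 \<alpha> (\<lambda>y. fourier_bessel_integral \<alpha> (h n) y - g y)) \<longlonglongrightarrow> 0)"

text \<open>Essential support: the complement of the largest open set on which \<open>g\<close> vanishes almost
  everywhere. It does not depend on the representative.\<close>

definition ess_support :: "real \<Rightarrow> (real \<Rightarrow> real) \<Rightarrow> real set" where
  "ess_support \<alpha> g =
     {0..} - \<Union>{U. open U \<and> (AE x in bessel_measure \<alpha>. x \<in> U \<longrightarrow> g x = 0)}"

definition relatively_dense :: "real \<Rightarrow> real \<Rightarrow> real set \<Rightarrow> bool" where
  "relatively_dense \<alpha> \<gamma> E \<longleftrightarrow>
     (\<forall>r\<ge>0. measure (bessel_measure \<alpha>) (E \<inter> {r..r+1}) \<ge> \<gamma> * measure (bessel_measure \<alpha>) {r..r+1})"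

end

theory Submission
  imports Defs "HOL-Probability.Characteristic_Functions"
begin

text \<open>
  Multiplication by the square root of the density \<open>w\<close> turns \<open>L\<^sup>2\<close> of the Bessel measure into \<open>L\<^sup>2\<close> of
  the half-line with Lebesgue measure. The symmetrised kernel \<open>sqrt (w x) * sqrt (w y) * j (2 \<pi> x y)\<close>
  is a cosine wave \<open>Re (W exp (2 \<pi> i x y))\<close> up to an error of order \<open>1 / (1 + x y)\<close>. If the transform
  \<open>g\<close> of \<open>f\<close> lives on \<open>[R, R + 1]\<close>, then \<open>F = sqrt w * f\<close> is therefore \<open>Re (A(x) exp (2 \<pi> i R x))\<close>,
  where \<open>A\<close> has its spectrum in \<open>[0, 1]\<close>, up to an error whose \<open>L\<^sup>2\<close> norm is of order \<open>R\<close> to the power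
  \<open>-1/2\<close> times the norm of \<open>g\<close> (\<open>weighted_fourier_bessel_near_band\<close>). As \<open>f\<close> and \<open>g\<close> have the same
  norm, the error is harmless for large \<open>R\<close>.

  What remains is an inequality of Logvinenko-Sereda type for such modulated signals, with constants
  independent of \<open>R\<close> (\<open>logvinenko_sereda_modulated\<close>). On a window \<open>[n, n + 1]\<close>, \<open>A\<close> is a polynomial
  of degree \<open>k\<close> plus a Taylor remainder, and Bessel's inequality in \<open>n\<close> shows that all remainders
  together have an \<open>L\<^sup>2\<close> norm of order \<open>(2 \<pi>)^(k+1) / (k+1)!\<close> times the norm of \<open>g\<close>. A polynomial of degree
  \<open>k\<close> is controlled on the window by its values on a set of given measure, with a constant
  that grows only exponentially in \<open>k\<close> (\<open>remez\<close>), so a large \<open>k\<close> makes the remainders negligible.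
  Only the real part of the modulated polynomial is observed; but most points of \<open>E\<close> have a
  partner in \<open>E\<close> at a distance comparable to \<open>1 / R\<close>. There the phase has turned by a definite angle
  while the polynomial has hardly changed, and two such observations recover its
  modulus (\<open>remez_modulated\<close>).

  The transform of an \<open>L\<^sup>2\<close> function is defined by approximation. The multiplication formula passes
  to the limit, Gaussians are mapped to Gaussians, and they are total; hence \<open>f\<close> is almost everywhere
  the integral transform of \<open>g\<close>, and testing the multiplication formula with \<open>g\<close> itself gives
  Plancherel's identity.
\<close>

section \<open>Remez's inequality on sets of positive measure\<close>

text \<open>
  Greedy choice: a point of \<open>S\<close> close to the infimum of \<open>S\<close> uses up little more than \<open>s\<close> of
  the measure before the next point may be taken.
\<close>

lemma separated_points:
  fixes S :: "real set"
  assumes "S \<in> lmeasurable" "bdd_below S" "real k * s < measure lebesgue S" "s > 0"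
  shows "\<exists>x. (\<forall>i\<le>k. x i \<in> S) \<and> (\<forall>i<k. x i + s \<le> x (Suc i))"
  using assms
proof (induction k arbitrary: S)
  case 0
  then have "S \<noteq> {}" by auto
  then show ?case by auto
next
  case (Suc k)
  define \<epsilon> where "\<epsilon> = measure lebesgue S - real (Suc k) * s"
  have \<epsilon>: "\<epsilon> > 0" using Suc by (simp add: \<epsilon>_def)
  have "S \<noteq> {}" using Suc.prems(3) \<open>s > 0\<close>
    by (metis measure_empty mult_nonneg_nonneg not_le of_nat_0_le_iff less_imp_le)
  then obtain x0 where x0: "x0 \<in> S" "x0 < Inf S + \<epsilon> / 2"
    using cInf_lessD[of S "Inf S + \<epsilon>/2"] \<epsilon> by auto
  define S' where "S' = S \<inter> {x0 + s..}"
  have S': "S' \<in> lmeasurable" unfolding S'_def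
    using Suc.prems(1) by (intro fmeasurable_Int_fmeasurable) auto
  have low: "Inf S \<le> x" if "x \<in> S" for x
    using cInf_lower[OF that Suc.prems(2)] .
  have "S \<subseteq> {Inf S..x0 + s} \<union> S'" using low by (auto simp: S'_def)
  then have "measure lebesgue S \<le> measure lebesgue ({Inf S..x0 + s} \<union> S')"
    by (intro measure_mono_fmeasurable) (use Suc.prems S' in auto)
  also have "\<dots> \<le> measure lebesgue {Inf S..x0 + s} + measure lebesgue S'"
    by (intro measure_Un_le) (use S' in auto)
  also have "measure lebesgue {Inf S..x0 + s} = x0 + s - Inf S"
    using low[OF x0(1)] \<open>s > 0\<close> by simp
  finally have "measure lebesgue S \<le> x0 + s - Inf S + measure lebesgue S'" .
  moreover have "measure lebesgue S = \<epsilon> + s + real k * s" by (simp add: \<epsilon>_def algebra_simps)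
  ultimately have "real k * s < measure lebesgue S'"
    using x0(2) \<epsilon> by linarith
  moreover have "bdd_below S'" using Suc.prems(2) by (auto simp: S'_def intro: bdd_below_mono)
  ultimately obtain x where x: "\<forall>i\<le>k. x i \<in> S'" "\<forall>i<k. x i + s \<le> x (Suc i)"
    using Suc.IH[of S'] S' \<open>s > 0\<close> by auto
  define y where "y i = (case i of 0 \<Rightarrow> x0 | Suc j \<Rightarrow> x j)" for i
  have "\<forall>i\<le>Suc k. y i \<in> S"
    using x x0 by (auto simp: y_def S'_def split: nat.splits)
  moreover have "\<forall>i<Suc k. y i + s \<le> y (Suc i)"
    using x by (auto simp: y_def S'_def split: nat.splits)
  ultimately show ?case by blast
qed

lemma separated_points_dist:
  fixes x :: "nat \<Rightarrow> real"
  assumes "\<forall>i<k. x i + s \<le> x (Suc i)" "i \<le> j" "j \<le> k"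
  shows "real (j - i) * s \<le> x j - x i"
  using assms(2,3)
proof (induction j rule: dec_induct)
  case base then show ?case by simp
next
  case (step n)
  have "x n + s \<le> x (Suc n)" using assms(1) step by auto
  then show ?case using step by (auto simp: algebra_simps Suc_diff_le)
qed

text \<open>
  The gaps add up: the points number \<open>i\<close> and \<open>j\<close> are at least \<open>\<bar>i - j\<bar> s\<close> apart. Keeping the
  factorials, instead of bounding every factor by \<open>s\<close>, is what lets the constant in Remez's inequality
  grow only exponentially with the degree.
\<close>

lemma prod_separated_points_ge:
  fixes x :: "nat \<Rightarrow> real"
  assumes "\<forall>i<k. x i + s \<le> x (Suc i)" "j \<le> k" "s > 0"
  shows "s ^ k * (fact j * fact (k - j)) \<le> (\<Prod>i\<in>{..k} - {j}. \<bar>x j - x i\<bar>)"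
proof -
  have split: "{..k} - {j} = {..<j} \<union> {j<..k}" "{..<j} \<inter> {j<..k} = {}"
    using assms(2) by auto
  have 1: "(\<Prod>i\<in>{..<j}. real (j - i) * s) = fact j * s ^ j"
  proof -
    have "(\<Prod>i\<in>{..<j}. real (j - i)) = fact j"
      unfolding fact_prod_rev of_nat_prod by (simp add: atLeast0LessThan)
    then show ?thesis by (simp add: prod.distrib)
  qed
  have 2: "(\<Prod>i\<in>{j<..k}. real (i - j) * s) = fact (k - j) * s ^ (k - j)"
  proof -
    have "(\<Prod>i\<in>{j<..k}. real (i - j)) = (\<Prod>i\<in>{1..k-j}. real i)"
      by (rule prod.reindex_bij_witness[of _ "\<lambda>i. i + j" "\<lambda>i. i - j"]) (use assms(2) in auto)
    also have "\<dots> = fact (k - j)" unfolding fact_prod by simp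
    finally show ?thesis by (simp add: prod.distrib)
  qed
  have "s ^ k * (fact j * fact (k - j)) = (fact j * s ^ j) * (fact (k - j) * s ^ (k - j))"
    using assms(2) by (simp add: power_add[symmetric] algebra_simps)
  also have "\<dots> = (\<Prod>i\<in>{..<j}. real (j - i) * s) * (\<Prod>i\<in>{j<..k}. real (i - j) * s)"
    by (simp only: 1 2)
  also have "\<dots> \<le> (\<Prod>i\<in>{..<j}. \<bar>x j - x i\<bar>) * (\<Prod>i\<in>{j<..k}. \<bar>x j - x i\<bar>)"
  proof (intro mult_mono prod_mono prod_nonneg conjI)
    fix i assume i: "i \<in> {..<j}"
    show "real (j - i) * s \<le> \<bar>x j - x i\<bar>"
      using separated_points_dist[OF assms(1), of i j] i assms by auto
  next
    fix i assume i: "i \<in> {j<..k}"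
    show "real (i - j) * s \<le> \<bar>x j - x i\<bar>"
      using separated_points_dist[OF assms(1), of j i] i assms by auto
  qed (use assms in auto)
  also have "\<dots> = (\<Prod>i\<in>{..k} - {j}. \<bar>x j - x i\<bar>)"
    unfolding split by (subst prod.union_disjoint) auto
  finally show ?thesis .
qed

lemma lagrange_interpolation:
  fixes p :: "'a::field poly"
  assumes "inj_on x {..k}" "degree p \<le> k"
  shows "poly p z = (\<Sum>j\<le>k. poly p (x j) * (\<Prod>i\<in>{..k}-{j}. (z - x i) / (x j - x i)))"
proof -
  define b where "b j = (\<Prod>i\<in>{..k}-{j}. smult (1 / (x j - x i)) [:- x i, 1:])" for j
  define q where "q = (\<Sum>j\<le>k. smult (poly p (x j)) (b j))"
  have poly_b: "poly (b j) z = (\<Prod>i\<in>{..k}-{j}. (z - x i) / (x j - x i))" for j z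
    unfolding b_def poly_prod by (intro prod.cong) (auto simp: field_simps diff_divide_distrib)
  have deg_b: "degree (b j) \<le> k" if "j \<le> k" for j
  proof -
    have "degree (b j) \<le> sum (degree \<circ> (\<lambda>i. smult (1 / (x j - x i)) [:- x i, 1:])) ({..k}-{j})"
      unfolding b_def by (intro degree_prod_sum_le) auto
    also have "\<dots> \<le> sum (\<lambda>_. 1) ({..k}-{j})"
      by (intro sum_mono) (auto intro: order_trans[OF degree_smult_le])
    also have "\<dots> = k" using that by simp
    finally show ?thesis .
  qed
  have deg_q: "degree q \<le> k" unfolding q_def
    by (intro degree_sum_le) (auto intro: order_trans[OF degree_smult_le] deg_b)
  have eq: "poly p y = poly q y" if "y \<in> x ` {..k}" for y
  proof -
    from that obtain m where m: "m \<le> k" "y = x m" by auto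
    have bm: "poly (b j) (x m) = (if j = m then 1 else 0)" if "j \<le> k" for j
    proof (cases "j = m")
      case True
      have "x m \<noteq> x i" if "i \<in> {..k} - {m}" for i
        using assms(1) that m by (auto simp: inj_on_def)
      then show ?thesis unfolding poly_b using True by (auto intro!: prod.neutral)
    next
      case False
      then show ?thesis unfolding poly_b using m by (auto intro!: prod_zero)
    qed
    have "poly q y = (\<Sum>j\<le>k. poly p (x j) * poly (b j) (x m))"
      unfolding q_def m by (simp add: poly_sum)
    also have "\<dots> = (\<Sum>j\<le>k. if j = m then poly p (x j) else 0)"
      by (intro sum.cong) (auto simp: bm)
    also have "\<dots> = poly p y" using m by simp
    finally show ?thesis by simp
  qed
  have "card (x ` {..k}) = Suc k" using assms(1) by (simp add: card_image)
  then have "p = q" using eq deg_q assms(2)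
    by (intro poly_eqI_degree[of "x ` {..k}"]) auto
  then have "poly p z = poly q z" by simp
  also have "\<dots> = (\<Sum>j\<le>k. poly p (x j) * (\<Prod>i\<in>{..k}-{j}. (z - x i) / (x j - x i)))"
    unfolding q_def by (simp add: poly_sum poly_b)
  finally show ?thesis .
qed

lemma power_div_fact_le_exp: "(x::real) ^ k / fact k \<le> exp x" if "x \<ge> 0"
proof -
  have "(\<Sum>n\<in>{k}. x ^ n /\<^sub>R fact n) \<le> (\<Sum>n. x ^ n /\<^sub>R fact n)"
    by (rule sum_le_suminf) (use that summable_exp_generic[of x] in auto)
  then show ?thesis by (simp add: exp_def field_simps)
qed

text \<open>
  Lagrange interpolation at \<open>k + 1\<close> nodes in \<open>S\<close> with gaps \<open>\<sigma> / (k + 1)\<close>. The factorials in the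
  denominators sum up to \<open>2^k / k!\<close>, and \<open>(k + 1)^k / k! \<le> exp (k + 1)\<close> leaves a constant that is
  exponential in \<open>k\<close>; the factorial in a Taylor remainder will beat it.
\<close>

lemma remez:
  fixes p :: "complex poly" and S :: "real set"
  assumes S: "S \<in> lmeasurable" "S \<subseteq> {a..a+1}" "measure lebesgue S \<ge> \<sigma>" "\<sigma> > 0"
    and deg: "degree p \<le> k"
    and bound: "\<And>x. x \<in> S \<Longrightarrow> norm (poly p (of_real x)) \<le> m"
    and z: "z \<in> {a..a+1}"
  shows "norm (poly p (of_real z)) \<le> exp 1 * (2 * exp 1 / \<sigma>) ^ k * m"
proof -
  define s where "s = \<sigma> / real (Suc k)"
  have s: "s > 0" using \<open>\<sigma> > 0\<close> by (simp add: s_def)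
  have "real k * s < \<sigma>" using \<open>\<sigma> > 0\<close> by (simp add: s_def field_simps)
  moreover have "bdd_below S" using S(2) by (meson bdd_below_Icc bdd_below_mono)
  ultimately obtain x where x: "\<forall>i\<le>k. x i \<in> S" "\<forall>i<k. x i + s \<le> x (Suc i)"
    using separated_points[of S k s] S s by fastforce
  have xne: "x i < x j" if "i < j" "j \<le> k" for i j
  proof -
    have "0 < real (j - i) * s" using that s by simp
    then show ?thesis using separated_points_dist[OF x(2), of i j] that by linarith
  qed
  have inj: "inj_on (\<lambda>i. complex_of_real (x i)) {..k}"
    by (rule inj_onI) (use xne in \<open>metis atMost_iff less_irrefl nat_neq_iff of_real_eq_iff\<close>)
  have m0: "0 \<le> m" using bound[of "x 0"] x(1) norm_ge_zero order_trans by blast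
  have in1: "x i \<in> {a..a+1}" if "i \<le> k" for i using x(1) S(2) that by blast
  have "norm (poly p (of_real z)) = norm (\<Sum>j\<le>k. poly p (of_real (x j)) *
      (\<Prod>i\<in>{..k}-{j}. (of_real z - of_real (x i)) / (of_real (x j) - of_real (x i))))"
    by (subst lagrange_interpolation[OF inj deg]) simp
  also have "\<dots> \<le> (\<Sum>j\<le>k. m * (1 / (s ^ k * (fact j * fact (k - j)))))"
  proof (rule sum_norm_le)
    fix j assume j: "j \<in> {..k}"
    have "norm (\<Prod>i\<in>{..k}-{j}. (complex_of_real z - of_real (x i)) / (of_real (x j) - of_real (x i)))
       = (\<Prod>i\<in>{..k}-{j}. \<bar>z - x i\<bar>) / (\<Prod>i\<in>{..k}-{j}. \<bar>x j - x i\<bar>)"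
      by (simp add: prod_norm[symmetric] norm_divide prod_dividef
           flip: of_real_diff)
    also have "\<dots> \<le> 1 / (s ^ k * (fact j * fact (k - j)))"
    proof (intro frac_le)
      show "(\<Prod>i\<in>{..k} - {j}. \<bar>z - x i\<bar>) \<le> 1"
      proof (rule prod_le_1)
        fix i assume "i \<in> {..k} - {j}"
        then have "x i \<in> {a..a+1}" using in1 by auto
        then show "0 \<le> \<bar>z - x i\<bar> \<and> \<bar>z - x i\<bar> \<le> 1" using z by (auto simp: abs_if)
      qed
    qed (use prod_separated_points_ge[OF x(2) _ s, of j] j s in auto)
    finally show "norm (poly p (of_real (x j)) *
      (\<Prod>i\<in>{..k}-{j}. (complex_of_real z - of_real (x i)) / (of_real (x j) - of_real (x i))))
      \<le> m * (1 / (s ^ k * (fact j * fact (k - j))))"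
      unfolding norm_mult using bound[of "x j"] x(1) j m0
      by (intro mult_mono) auto
  qed
  also have "\<dots> = m / (s ^ k * fact k) * (\<Sum>j\<le>k. real (k choose j))"
    unfolding sum_distrib_left
    by (intro sum.cong) (auto simp: binomial_fact field_simps)
  also have "(\<Sum>j\<le>k. real (k choose j)) = 2 ^ k"
    using choose_row_sum[of k] by (metis of_nat_numeral of_nat_power of_nat_sum)
  also have "m / (s ^ k * fact k) * 2 ^ k = m * (2 / \<sigma>) ^ k * (real (Suc k) ^ k / fact k)"
    using \<open>\<sigma> > 0\<close> by (simp add: s_def field_simps power_divide)
  also have "\<dots> \<le> m * (2 / \<sigma>) ^ k * exp (real (Suc k))"
    using power_div_fact_le_exp[of "real (Suc k)" k] m0 \<open>\<sigma> > 0\<close>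
    by (intro mult_left_mono) auto
  also have "exp (real (Suc k)) = exp 1 * exp 1 ^ k"
    by (simp add: exp_add exp_of_nat_mult[symmetric] algebra_simps flip: exp_of_nat_mult)
  finally show ?thesis by (simp add: field_simps power_mult_distrib power_divide)
qed

section \<open>Remez's inequality for modulated polynomials\<close>

text \<open>
  Cut the interval into \<open>M\<close> cells of length \<open>1 / M\<close>. Two points of the same cell that have no
  partner are less than \<open>\<beta> / M\<close> apart, so the points of a cell without partner lie in an interval of
  length \<open>\<beta> / M\<close>; these intervals are removed from \<open>S\<close>. Removing intervals, and not the set of unpaired
  points itself, keeps the remaining set measurable without further argument.
\<close>

lemma measure_unpaired_points:
  fixes S :: "real set"
  assumes S: "S \<in> lmeasurable" "S \<subseteq> {a..a+1}" and M: "M > (0::nat)" and \<beta>: "\<beta> > 0"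
  obtains S' where "S' \<in> lmeasurable" "S' \<subseteq> S" "measure lebesgue S' \<ge> measure lebesgue S - \<beta>"
    "\<And>x. x \<in> S' \<Longrightarrow> \<exists>x'\<in>S. \<beta> / real M \<le> \<bar>x' - x\<bar> \<and> \<bar>x' - x\<bar> \<le> 1 / real M"
proof -
  define \<delta> where "\<delta> = \<beta> / real M"
  define B where "B = {x \<in> S. \<forall>x'\<in>S. \<not> (\<delta> \<le> \<bar>x' - x\<bar> \<and> \<bar>x' - x\<bar> \<le> 1 / real M)}"
  define J where "J j = {a + real j / real M..a + real (Suc j) / real M}" for j
  define C where "C j = {Inf (B \<inter> J j)..Inf (B \<inter> J j) + \<delta>}" for j
  define S' where "S' = S - (\<Union>j<M. C j)"
  have cover: "B \<subseteq> (\<Union>j<M. C j)"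
  proof
    fix x assume x: "x \<in> B"
    then have xS: "x \<in> S" "a \<le> x" "x \<le> a + 1" using S(2) by (auto simp: B_def)
    \<comment> \<open>The right end point \<open>a + 1\<close> belongs to the last cell.\<close>
    define j where "j = (if x = a + 1 then M - 1 else nat \<lfloor>(x - a) * M\<rfloor>)"
    have j: "j < M" "x \<in> J j"
    proof -
      have "j < M \<and> real j \<le> (x - a) * M \<and> (x - a) * M \<le> real (Suc j)"
      proof (cases "x = a + 1")
        case True then show ?thesis using M by (auto simp: j_def)
      next
        case False
        then have lt: "(x - a) * M < M" using xS M by (simp add: mult_less_cancel_right1)
        have nn: "(x - a) * M \<ge> 0" using xS by simp
        have "real j = of_int \<lfloor>(x - a) * M\<rfloor>" using False nn by (simp add: j_def)
        then have "real j \<le> (x - a) * M" "(x - a) * M < real j + 1"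
          by linarith+
        then show ?thesis using lt by auto
      qed
      then show "j < M" "x \<in> J j" using M by (auto simp: J_def field_simps)
    qed
    have bdd: "bdd_below (B \<inter> J j)" unfolding J_def by (auto intro: bdd_below_mono)
    have "Inf (B \<inter> J j) \<le> x" using x j bdd by (intro cInf_lower) auto
    moreover have "x - \<delta> \<le> Inf (B \<inter> J j)"
    proof (rule cInf_greatest)
      show "B \<inter> J j \<noteq> {}" using x j by auto
      fix y assume y: "y \<in> B \<inter> J j"
      have "\<bar>y - x\<bar> \<le> 1 / real M" using y j(2) M by (auto simp: J_def field_simps abs_if)
      moreover have "y \<in> S" using y by (auto simp: B_def)
      ultimately have "\<bar>y - x\<bar> < \<delta>" using x by (auto simp: B_def)
      then show "x - \<delta> \<le> y" by linarith
    qed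
    ultimately have "x \<in> C j" by (auto simp: C_def)
    then show "x \<in> (\<Union>j<M. C j)" using j by auto
  qed
  have Cm: "(\<Union>j<M. C j) \<in> lmeasurable" by (intro fmeasurable.finite_UN) (auto simp: C_def)
  have "measure lebesgue (\<Union>j<M. C j) \<le> (\<Sum>j<M. measure lebesgue (C j))"
    by (intro measure_UNION_le) (auto simp: C_def)
  also have "\<dots> = (\<Sum>j<M. \<delta>)" using \<beta> M by (intro sum.cong) (auto simp: C_def \<delta>_def)
  also have "\<dots> = \<beta>" using M by (simp add: \<delta>_def)
  finally have mC: "measure lebesgue (\<Union>j<M. C j) \<le> \<beta>" .
  have S'm: "S' \<in> lmeasurable" unfolding S'_def using S(1) Cm by (intro fmeasurable_Diff) auto
  have "measure lebesgue S \<le> measure lebesgue (S' \<union> (\<Union>j<M. C j))"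
    by (rule measure_mono_fmeasurable) (use S Cm S'm in \<open>auto simp: S'_def\<close>)
  also have "\<dots> \<le> measure lebesgue S' + measure lebesgue (\<Union>j<M. C j)"
    using S'm Cm by (intro measure_Un_le) auto
  finally have "measure lebesgue S' \<ge> measure lebesgue S - \<beta>" using mC by linarith
  moreover have "\<exists>x'\<in>S. \<beta> / real M \<le> \<bar>x' - x\<bar> \<and> \<bar>x' - x\<bar> \<le> 1 / real M" if "x \<in> S'" for x
  proof -
    have "x \<in> S" "x \<notin> B" using that cover by (auto simp: S'_def)
    then show ?thesis by (auto simp: B_def \<delta>_def)
  qed
  ultimately show ?thesis using that[of S'] S'm by (auto simp: S'_def)
qed

text \<open>
  The real parts of \<open>z\<close> and of \<open>z\<close> rotated by \<open>\<tau>\<close> determine \<open>z\<close>, at the price of the factor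
  \<open>1 / \<bar>sin \<tau>\<bar>\<close>.
\<close>

lemma norm_le_two_phases:
  fixes z :: complex
  assumes "\<bar>Re z\<bar> \<le> m" "\<bar>Re (z * cis \<tau>)\<bar> \<le> m'" "\<epsilon> \<le> \<bar>sin \<tau>\<bar>" "0 < \<epsilon>" "\<epsilon> \<le> 1"
  shows "norm z \<le> (2 * m + m') / \<epsilon>"
proof -
  have "\<bar>Im z\<bar> * \<epsilon> \<le> \<bar>Im z\<bar> * \<bar>sin \<tau>\<bar>" using assms by (intro mult_left_mono) auto
  also have "\<dots> = \<bar>Re z * cos \<tau> - Re (z * cis \<tau>)\<bar>" by (simp add: abs_mult)
  also have "\<dots> \<le> \<bar>Re z\<bar> * \<bar>cos \<tau>\<bar> + m'" using assms(2) by (simp add: abs_mult[symmetric])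
  also have "\<bar>Re z\<bar> * \<bar>cos \<tau>\<bar> \<le> \<bar>Re z\<bar> * 1" by (intro mult_left_mono) auto
  finally have 1: "\<bar>Im z\<bar> * \<epsilon> \<le> m + m'" using assms(1) by linarith
  have "\<bar>Re z\<bar> * \<epsilon> \<le> \<bar>Re z\<bar> * 1" using assms by (intro mult_left_mono) auto
  then have "(\<bar>Re z\<bar> + \<bar>Im z\<bar>) * \<epsilon> \<le> 2 * m + m'" using 1 assms(1) by (simp add: algebra_simps)
  moreover have "norm z * \<epsilon> \<le> (\<bar>Re z\<bar> + \<bar>Im z\<bar>) * \<epsilon>"
    using cmod_le[of z] assms by (intro mult_right_mono) auto
  ultimately show ?thesis using assms by (simp add: field_simps)
qed

lemma sin_ge_linear: "2 / pi * x \<le> sin x" if "0 \<le> x" "x \<le> pi / 2" for x :: real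
proof -
  have "concave_on {0..pi} sin"
    by (rule f''_le0_imp_concave[where f' = cos and f'' = "\<lambda>x. - sin x"])
       (auto intro!: derivative_eq_intros sin_ge_zero)
  then have "sin ((1 - 2 / pi * x) *\<^sub>R 0 + (2 / pi * x) *\<^sub>R (pi / 2)) \<ge>
     (1 - 2 / pi * x) * sin 0 + (2 / pi * x) * sin (pi / 2)"
    using that by (intro concave_onD) (auto simp: field_simps)
  then show ?thesis by simp
qed

text \<open>
  With \<open>M\<close> cells, where \<open>M\<close> lies between \<open>4 R\<close> and \<open>5 R\<close>, the phase turns by at most a quarter of a
  full turn from a point to its partner, and the sine of the angle is at least \<open>2 \<sigma> / 5\<close>, while the
  polynomial changes by at most \<open>D / (4 R)\<close>. So the polynomial itself is bounded on all points that have
  a partner. They fill half of \<open>S\<close>, and Remez's inequality applies to that half.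
\<close>

lemma remez_modulated:
  fixes p :: "complex poly" and S :: "real set"
  assumes S: "S \<in> lmeasurable" "S \<subseteq> {a..a+1}" "measure lebesgue S \<ge> \<sigma>" "0 < \<sigma>" "\<sigma> \<le> 1"
    and deg: "degree p \<le> k" and R: "R \<ge> 1" and D: "D \<ge> 0"
    and lip: "\<And>x y. x \<in> {a..a+1} \<Longrightarrow> y \<in> {a..a+1} \<Longrightarrow>
        norm (poly p (of_real x) - poly p (of_real y)) \<le> D * \<bar>x - y\<bar>"
    and bound: "\<And>x. x \<in> S \<Longrightarrow> \<bar>Re (poly p (of_real x) * cis (2 * pi * R * x))\<bar> \<le> m"
    and x: "x \<in> {a..a+1}"
  shows "norm (poly p (of_real x)) \<le> exp 1 * (4 * exp 1 / \<sigma>) ^ k * (8 / \<sigma> * (m + D / R))"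
proof -
  define M where "M = nat \<lceil>4 * R\<rceil>"
  have M: "4 * R \<le> real M" "real M \<le> 5 * R" "M > 0" using R unfolding M_def by linarith+
  obtain S' where S': "S' \<in> lmeasurable" "S' \<subseteq> S" "measure lebesgue S' \<ge> measure lebesgue S - \<sigma> / 2"
    "\<And>x. x \<in> S' \<Longrightarrow> \<exists>x'\<in>S. \<sigma> / 2 / real M \<le> \<bar>x' - x\<bar> \<and> \<bar>x' - x\<bar> \<le> 1 / real M"
    using measure_unpaired_points[OF S(1,2) M(3), of "\<sigma> / 2"] S by auto
  have *: "norm (poly p (of_real y)) \<le> 8 / \<sigma> * (m + D / R)" if y: "y \<in> S'" for y
  proof -
    obtain y' where y': "y' \<in> S" "\<sigma> / 2 / real M \<le> \<bar>y' - y\<bar>" "\<bar>y' - y\<bar> \<le> 1 / real M"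
      using S'(4)[OF y] by auto
    have yS: "y \<in> S" using y S' by auto
    have m: "m \<ge> 0" using bound[OF yS] by linarith
    define \<tau> where "\<tau> = 2 * pi * R * (y' - y)"
    define z where "z = poly p (of_real y) * cis (2 * pi * R * y)"
    have abs\<tau>: "\<bar>\<tau>\<bar> = 2 * pi * R * \<bar>y' - y\<bar>" using R by (simp add: \<tau>_def abs_mult)
    have "2 * \<sigma> / 5 \<le> 2 / pi * (2 * pi * R * (\<sigma> / 2 / real M))"
      using M S R by (simp add: field_simps)
    also have "\<dots> \<le> 2 / pi * \<bar>\<tau>\<bar>" unfolding abs\<tau>
      using y' R by (intro mult_left_mono) auto
    also have "\<dots> \<le> sin \<bar>\<tau>\<bar>"
    proof (rule sin_ge_linear)
      have "\<bar>\<tau>\<bar> \<le> 2 * pi * R * (1 / real M)" unfolding abs\<tau> using y' R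
        by (intro mult_left_mono) auto
      also have "\<dots> \<le> pi / 2" using M by (simp add: field_simps)
      finally show "\<bar>\<tau>\<bar> \<le> pi / 2" .
    qed simp
    also have "sin \<bar>\<tau>\<bar> \<le> \<bar>sin \<tau>\<bar>" by (cases "\<tau> \<ge> 0") auto
    finally have sin: "2 * \<sigma> / 5 \<le> \<bar>sin \<tau>\<bar>" .
    have "\<bar>Re (z * cis \<tau>)\<bar> \<le> m + D / (4 * R)"
    proof -
      have zeq: "z * cis \<tau> = poly p (of_real y') * cis (2 * pi * R * y')
          + (poly p (of_real y) - poly p (of_real y')) * cis (2 * pi * R * y')"
        by (simp add: z_def \<tau>_def mult.assoc cis_mult algebra_simps)
      have "norm ((poly p (of_real y) - poly p (of_real y')) * cis (2 * pi * R * y')) \<le> D * \<bar>y - y'\<bar>"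
        using lip[of y y'] subsetD[OF S(2) yS] subsetD[OF S(2) y'(1)] by (simp add: norm_mult)
      also have "\<dots> \<le> D * (1 / real M)" using y' D by (intro mult_left_mono) (auto simp: abs_minus_commute)
      also have "\<dots> \<le> D / (4 * R)" using M R D by (simp add: frac_le)
      finally have "\<bar>Re ((poly p (of_real y) - poly p (of_real y')) * cis (2 * pi * R * y'))\<bar> \<le> D / (4 * R)"
        using abs_Re_le_cmod order_trans by blast
      then show ?thesis unfolding zeq plus_complex.sel using bound[OF y'(1)] by linarith
    qed
    then have "norm z \<le> (2 * m + (m + D / (4 * R))) / (2 * \<sigma> / 5)"
      using bound[OF yS] S sin by (intro norm_le_two_phases) (auto simp: z_def)
    also have "\<dots> = (15 * m / 2 + 5 * (D / R) / 8) / \<sigma>" using S R by (simp add: field_simps)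
    also have "\<dots> \<le> (8 * m + 8 * (D / R)) / \<sigma>"
    proof (intro divide_right_mono add_mono)
      have "D / R \<ge> 0" using D R by simp
      then show "5 * (D / R) / 8 \<le> 8 * (D / R)"
        using mult_right_mono[of "5/8" 8 "D / R"] by simp
    qed (use m S in auto)
    also have "\<dots> = 8 / \<sigma> * (m + D / R)" by (simp add: field_simps)
    finally show ?thesis by (simp add: z_def norm_mult)
  qed
  have "norm (poly p (of_real x)) \<le> exp 1 * (2 * exp 1 / (\<sigma> / 2)) ^ k * (8 / \<sigma> * (m + D / R))"
    by (rule remez[OF S'(1) _ _ _ deg *]) (use S S' x in auto)
  then show ?thesis by simp
qed

section \<open>Bessel's inequality on an interval of length one\<close>

lemma bessel_inequality:
  fixes h :: "'a \<Rightarrow> complex" and e :: "nat \<Rightarrow> 'a \<Rightarrow> complex"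
  assumes h: "integrable M (\<lambda>y. h y * cnj (h y))"
    and he: "\<And>n. integrable M (\<lambda>y. h y * cnj (e n y))"
    and ee: "\<And>n m. integrable M (\<lambda>y. e n y * cnj (e m y))"
    and orth: "\<And>n m. (LINT y|M. e n y * cnj (e m y)) = (if n = m then 1 else 0)"
  shows "(\<Sum>n<L. (norm (LINT y|M. h y * cnj (e n y)))\<^sup>2) \<le> (LINT y|M. (norm (h y))\<^sup>2)"
proof -
  define c where "c n = (LINT y|M. h y * cnj (e n y))" for n
  define q where "q y = (\<Sum>n<L. c n * e n y)" for y
  have eh: "integrable M (\<lambda>y. e n y * cnj (h y))" for n
    using Bochner_Integration.integrable_cnj[of M "\<lambda>y. h y * cnj (e n y)"] he[of n] by (simp add: mult.commute)
  have hq: "h y * cnj (q y) = (\<Sum>n<L. cnj (c n) * (h y * cnj (e n y)))"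
       and qh: "q y * cnj (h y) = (\<Sum>n<L. c n * (e n y * cnj (h y)))"
       and qq: "q y * cnj (q y) = (\<Sum>n<L. \<Sum>m<L. c n * cnj (c m) * (e n y * cnj (e m y)))" for y
    unfolding q_def cnj_sum sum_product
    by (auto simp: sum_distrib_left sum_distrib_right algebra_simps intro!: sum.cong)
  have c_eh: "(LINT y|M. e n y * cnj (h y)) = cnj (c n)" for n
    using Bochner_Integration.integral_cnj[of M "\<lambda>y. h y * cnj (e n y)"] by (simp add: c_def mult.commute)
  have I: "integrable M (\<lambda>y. h y * cnj (q y))" "integrable M (\<lambda>y. q y * cnj (h y))"
      "integrable M (\<lambda>y. q y * cnj (q y))"
    unfolding hq qh qq using he eh ee by (auto intro!: Bochner_Integration.integrable_sum)
  have nsq: "cnj (c n) * c n = of_real ((norm (c n))\<^sup>2)" "c n * cnj (c n) = of_real ((norm (c n))\<^sup>2)" for n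
    using complex_norm_square[of "c n"] by (simp_all add: mult.commute)
  have v1: "(LINT y|M. h y * cnj (q y)) = (\<Sum>n<L. of_real ((norm (c n))\<^sup>2))"
    unfolding hq using he
    by (subst Bochner_Integration.integral_sum) (auto simp: c_def[symmetric] nsq intro!: sum.cong)
  have v2: "(LINT y|M. q y * cnj (h y)) = (\<Sum>n<L. of_real ((norm (c n))\<^sup>2))"
    unfolding qh using eh
    by (subst Bochner_Integration.integral_sum) (auto simp: c_eh nsq intro!: sum.cong)
  have v3: "(LINT y|M. q y * cnj (q y)) = (\<Sum>n<L. of_real ((norm (c n))\<^sup>2))"
  proof -
    have "(LINT y|M. q y * cnj (q y)) = (\<Sum>n<L. \<Sum>m<L. c n * cnj (c m) * (if n = m then 1 else 0))"
      unfolding qq using ee by (simp add: Bochner_Integration.integral_sum orth)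
    also have "\<dots> = (\<Sum>n<L. c n * cnj (c n))"
      by (intro sum.cong refl) (simp add: if_distrib cong: if_cong)
    finally show ?thesis by (simp add: nsq)
  qed
  have "(LINT y|M. complex_of_real ((norm (h y - q y))\<^sup>2)) =
     (LINT y|M. h y * cnj (h y) - h y * cnj (q y) - q y * cnj (h y) + q y * cnj (q y))"
    unfolding complex_norm_square by (simp add: algebra_simps)
  also have "\<dots> = (LINT y|M. h y * cnj (h y)) - (\<Sum>n<L. of_real ((norm (c n))\<^sup>2))"
    using h I by (simp add: v1 v2 v3)
  also have "(LINT y|M. h y * cnj (h y)) = (LINT y|M. complex_of_real ((norm (h y))\<^sup>2))"
    unfolding complex_norm_square ..
  finally have "complex_of_real (LINT y|M. (norm (h y - q y))\<^sup>2) =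
     of_real ((LINT y|M. (norm (h y))\<^sup>2) - (\<Sum>n<L. (norm (c n))\<^sup>2))"
    unfolding integral_complex_of_real by simp
  then have "(LINT y|M. (norm (h y - q y))\<^sup>2) = (LINT y|M. (norm (h y))\<^sup>2) - (\<Sum>n<L. (norm (c n))\<^sup>2)"
    using of_real_eq_iff by blast
  moreover have "0 \<le> (LINT y|M. (norm (h y - q y))\<^sup>2)" by simp
  ultimately show ?thesis by (simp add: c_def)
qed

lemma integral_cis_period:
  "(LINT y|lebesgue_on {R..R+1}. cis (2 * pi * of_int j * (y - R))) = (if j = 0 then 1 else 0)"
proof (cases "j = 0")
  case True
  then show ?thesis by (simp add: measure_restrict_space)
next
  case False
  define c where "c = 2 * pi * of_int j * \<i>"
  define F where "F y = exp (c * (of_real y - of_real R)) / c" for y :: real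
  have c: "c \<noteq> 0" using False by (simp add: c_def)
  have cis: "cis (2 * pi * of_int j * (y - R)) = exp (c * (of_real y - of_real R))" for y
    by (simp add: cis_conv_exp c_def algebra_simps)
  have "((\<lambda>y. cis (2 * pi * of_int j * (y - R))) has_integral (F (R+1) - F R)) {R..R+1}"
  proof (rule fundamental_theorem_of_calculus)
    fix y
    have "((\<lambda>z. exp (c * (z - of_real R)) / c) has_field_derivative exp (c * (of_real y - of_real R)))
        (at (of_real y))"
      using c by (auto intro!: derivative_eq_intros)
    then show "(F has_vector_derivative cis (2 * pi * of_int j * (y - R))) (at y within {R..R+1})"
      unfolding F_def cis by (rule has_vector_derivative_real_field)
  qed simp
  moreover have "F (R+1) = F R"
    using cis[of "R + 1"] cis_multiple_2pi[of "of_int j"] by (simp add: F_def)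
  ultimately have "integral {R..R+1} (\<lambda>y. cis (2 * pi * of_int j * (y - R))) = 0"
    by (simp add: integral_unique)
  moreover have "integrable (lebesgue_on {R..R+1}) (\<lambda>y. cis (2 * pi * of_int j * (y - R)))"
    by (intro continuous_imp_integrable_real continuous_intros)
  ultimately show ?thesis using False by (simp add: lebesgue_integral_eq_integral)
qed

lemma finite_measure_lebesgue_on_Icc: "finite_measure (lebesgue_on {a..b::real})"
  by (rule finite_measureI) (simp add: emeasure_restrict_space emeasure_lborel_Icc_eq)

lemma integrable_mult_bounded:
  fixes h :: "'a \<Rightarrow> real" and v :: "'a \<Rightarrow> complex"
  assumes "integrable M h" "v \<in> borel_measurable M" "\<And>y. y \<in> space M \<Longrightarrow> norm (v y) \<le> B"
  shows "integrable M (\<lambda>y. of_real (h y) * v y)"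
proof (rule Bochner_Integration.integrable_bound[of M "\<lambda>y. B * h y"])
  show "AE y in M. norm (complex_of_real (h y) * v y) \<le> norm (B * h y)"
  proof (rule AE_I2)
    fix y assume "y \<in> space M"
    then have "norm (v y) \<le> \<bar>B\<bar>" using assms(3) by force
    then have "\<bar>h y\<bar> * norm (v y) \<le> \<bar>h y\<bar> * \<bar>B\<bar>" by (intro mult_left_mono) auto
    then show "norm (complex_of_real (h y) * v y) \<le> norm (B * h y)"
      by (simp add: norm_mult abs_mult mult.commute)
  qed
next
  show "(\<lambda>y. complex_of_real (h y) * v y) \<in> borel_measurable M"
    using assms by (intro borel_measurable_times borel_measurable_of_real) (auto dest: borel_measurable_integrable)
qed (use assms(1) in simp)

lemma continuous_imp_measurable_lebesgue_on:
  fixes f :: "real \<Rightarrow> 'b::euclidean_space"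
  assumes "continuous_on UNIV f"
  shows "f \<in> borel_measurable (lebesgue_on A)"
proof -
  have "f \<in> borel_measurable lebesgue"
    using borel_measurable_continuous_onI[OF assms] by (simp add: measurable_completion)
  then show ?thesis by (rule measurable_restrict_space1)
qed

text \<open>
  The bounded multiplier \<open>v\<close> lets the same inequality serve for the Taylor coefficients and for the
  Taylor remainders of a band-limited function.
\<close>

lemma bessel_inequality_interval:
  fixes h :: "real \<Rightarrow> real" and v :: "real \<Rightarrow> complex" and R :: real
  defines "N \<equiv> lebesgue_on {R..R+1}"
  assumes h: "h \<in> borel_measurable N" "integrable N (\<lambda>y. (h y)\<^sup>2)"
    and v: "v \<in> borel_measurable N" "\<And>y. y \<in> {R..R+1} \<Longrightarrow> norm (v y) \<le> B"
  shows "(\<Sum>n<L. (norm (LINT y|N. of_real (h y) * v y * cis (2 * pi * real n * (y - R))))\<^sup>2)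
     \<le> B\<^sup>2 * (LINT y|N. (h y)\<^sup>2)"
proof -
  interpret finite_measure N unfolding N_def by (rule finite_measure_lebesgue_on_Icc)
  define e where "e n y = cis (- (2 * pi * real n * (y - R)))" for n y
  have spN: "space N = {R..R+1}" by (simp add: N_def)
  have cnj_e: "cnj (e n y) = cis (2 * pi * real n * (y - R))" for n y
    by (simp add: e_def cis_cnj)
  have ee: "e n y * cnj (e m y) = cis (2 * pi * of_int (int m - int n) * (y - R))" for n m y
    unfolding cnj_e unfolding e_def cis_mult by (simp add: algebra_simps)
  have cis_meas: "(\<lambda>y. cis (c * (y - R))) \<in> borel_measurable N" for c
    unfolding N_def by (intro continuous_imp_measurable_lebesgue_on continuous_intros)
  have h1: "integrable N h" by (rule square_integrable_imp_integrable[OF h])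
  have hv: "integrable N (\<lambda>y. of_real (h y) * v y)"
    using v by (intro integrable_mult_bounded[where B = B] h1) (auto simp: spN)
  have le: "(norm (of_real (h y) * v y))\<^sup>2 \<le> B\<^sup>2 * (h y)\<^sup>2" if "y \<in> space N" for y
  proof -
    have "(norm (of_real (h y) * v y))\<^sup>2 = (h y)\<^sup>2 * (norm (v y))\<^sup>2"
      by (simp add: norm_mult power_mult_distrib)
    also have "\<dots> \<le> (h y)\<^sup>2 * B\<^sup>2"
      using v(2)[of y] that by (intro mult_left_mono power_mono) (simp_all add: spN)
    finally show ?thesis by (simp add: mult.commute)
  qed
  have sq: "integrable N (\<lambda>y. (norm (of_real (h y) * v y))\<^sup>2)"
  proof (rule Bochner_Integration.integrable_bound)
    show "integrable N (\<lambda>y. B\<^sup>2 * (h y)\<^sup>2)" using h by simp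
    show "AE y in N. norm ((norm (of_real (h y) * v y))\<^sup>2) \<le> norm (B\<^sup>2 * (h y)\<^sup>2)"
      using le by (intro AE_I2) simp
  qed (use h v in auto)
  have "(\<Sum>n<L. (norm (LINT y|N. of_real (h y) * v y * cnj (e n y)))\<^sup>2)
     \<le> (LINT y|N. (norm (of_real (h y) * v y))\<^sup>2)"
  proof (rule bessel_inequality)
    show "integrable N (\<lambda>y. of_real (h y) * v y * cnj (of_real (h y) * v y))"
      using integrable_of_real[OF sq, where 'a = complex] unfolding complex_norm_square .
    show "integrable N (\<lambda>y. of_real (h y) * v y * cnj (e n y))" for n
      unfolding cnj_e
      by (rule Bochner_Integration.integrable_bound[OF hv])
         (use h(1) v(1) in \<open>simp_all add: norm_mult borel_measurable_of_real borel_measurable_times cis_meas\<close>)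
    show "integrable N (\<lambda>y. e n y * cnj (e m y))" for n m
      unfolding ee by (intro integrable_const_bound[of _ 1] cis_meas) simp_all
    show "(LINT y|N. e n y * cnj (e m y)) = (if n = m then 1 else 0)" for n m
      unfolding ee N_def by (subst integral_cis_period) simp
  qed
  also have "\<dots> \<le> (LINT y|N. B\<^sup>2 * (h y)\<^sup>2)"
    using sq h le by (intro integral_mono) auto
  finally show ?thesis by (simp add: cnj_e)
qed

section \<open>Band-limited functions on unit windows\<close>

lemma norm_cis_diff_le: "norm (cis a - cis b) \<le> \<bar>a - b\<bar>"
proof -
  have "cis a - cis b = cis b * (exp (\<i> * of_real (a - b)) - 1)"
    by (simp add: cis_conv_exp exp_add[symmetric] algebra_simps flip: exp_add)
  then have "norm (cis a - cis b) = norm (exp (\<i> * of_real (a - b)) - 1)"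
    by (simp add: norm_mult)
  also have "\<dots> \<le> \<bar>a - b\<bar>" using iexp_approx1[of "a - b" 0] by simp
  finally show ?thesis .
qed

lemma continuous_on_band_limited:
  fixes h :: "real \<Rightarrow> real" and R :: real
  defines "N \<equiv> lebesgue_on {R..R+1}"
  assumes h: "integrable N h"
  shows "continuous_on UNIV (\<lambda>x. LINT y|N. of_real (h y) * cis (2 * pi * x * (y - R)))"
proof -
  have meas: "(\<lambda>y. cis (2 * pi * x * (y - R))) \<in> borel_measurable N" for x
    unfolding N_def by (intro continuous_imp_measurable_lebesgue_on continuous_intros)
  have int: "integrable N (\<lambda>y. of_real (h y) * cis (2 * pi * x * (y - R)))" for x
    by (rule integrable_mult_bounded[where B = 1]) (use h meas in auto)
  have intabs: "integrable N (\<lambda>y. \<bar>h y\<bar>)" using h by (rule integrable_abs)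
  define I where "I = (LINT y|N. \<bar>h y\<bar>)"
  have "dist (LINT y|N. of_real (h y) * cis (2 * pi * x * (y - R)))
             (LINT y|N. of_real (h y) * cis (2 * pi * x' * (y - R))) \<le> (2 * pi * I) * dist x x'" for x x'
  proof -
    have "dist (LINT y|N. of_real (h y) * cis (2 * pi * x * (y - R)))
             (LINT y|N. of_real (h y) * cis (2 * pi * x' * (y - R)))
       = norm (LINT y|N. of_real (h y) * cis (2 * pi * x * (y - R)) - of_real (h y) * cis (2 * pi * x' * (y - R)))"
      using int by (simp add: dist_norm)
    also have "\<dots> \<le> (LINT y|N. norm (of_real (h y) * cis (2 * pi * x * (y - R)) - of_real (h y) * cis (2 * pi * x' * (y - R))))"
      by (rule integral_norm_bound)
    also have "\<dots> \<le> (LINT y|N. \<bar>h y\<bar> * (2 * pi * dist x x'))"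
    proof (rule integral_mono)
      fix y assume "y \<in> space N"
      then have y: "\<bar>y - R\<bar> \<le> 1" by (auto simp: N_def)
      have "norm (cis (2 * pi * x * (y - R)) - cis (2 * pi * x' * (y - R)))
          \<le> \<bar>2 * pi * x * (y - R) - 2 * pi * x' * (y - R)\<bar>" by (rule norm_cis_diff_le)
      also have "\<dots> = 2 * pi * dist x x' * \<bar>y - R\<bar>"
        unfolding left_diff_distrib[symmetric] right_diff_distrib[symmetric]
        by (simp add: abs_mult dist_real_def)
      also have "\<dots> \<le> 2 * pi * dist x x' * 1" using y by (intro mult_left_mono) auto
      finally show "norm (of_real (h y) * cis (2 * pi * x * (y - R)) - of_real (h y) * cis (2 * pi * x' * (y - R)))
        \<le> \<bar>h y\<bar> * (2 * pi * dist x x')"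
        unfolding right_diff_distrib[symmetric] norm_mult by (simp add: mult_left_mono)
    qed (use int intabs in auto)
    also have "\<dots> = (2 * pi * I) * dist x x'" by (simp add: I_def)
    finally show ?thesis .
  qed
  then have "(2 * pi * I)-lipschitz_on UNIV (\<lambda>x. LINT y|N. of_real (h y) * cis (2 * pi * x * (y - R)))"
    by (intro lipschitz_onI) (auto simp: I_def)
  then show ?thesis by (rule lipschitz_on_continuous_on)
qed

text \<open>
  For \<open>x = n + \<theta>\<close> the exponential in the integral for \<open>A x\<close> is the product of one at the integer
  \<open>n\<close> and of one in \<open>\<theta>\<close>, and the latter is expanded in a Taylor series of degree \<open>k\<close>. For fixed \<open>\<theta>\<close>
  the coefficients and the remainder are, as functions of \<open>n\<close>, the Fourier coefficients of \<open>h\<close> times a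
  bounded multiplier, so Bessel's inequality bounds their sums of squares over all
  windows by the norm of \<open>h\<close>.
\<close>

lemma band_limited_window_approximation:
  fixes h :: "real \<Rightarrow> real" and R :: real and k :: nat
  defines "N \<equiv> lebesgue_on {R..R+1}"
  defines "A \<equiv> \<lambda>x. LINT y|N. of_real (h y) * cis (2 * pi * x * (y - R))"
  defines "T \<equiv> LINT y|N. (h y)\<^sup>2"
  assumes h: "h \<in> borel_measurable N" "integrable N (\<lambda>y. (h y)\<^sup>2)"
  obtains p :: "nat \<Rightarrow> complex poly" and D :: "nat \<Rightarrow> real" where
    "\<And>n. degree (p n) \<le> k" "\<And>n. D n \<ge> 0"
    "\<And>n x y. x \<in> {real n..real n+1} \<Longrightarrow> y \<in> {real n..real n+1} \<Longrightarrow>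
        norm (poly (p n) (of_real x) - poly (p n) (of_real y)) \<le> D n * \<bar>x - y\<bar>"
    "\<And>L. (\<Sum>n<L. (D n)\<^sup>2) \<le> real (k + 1) * (\<Sum>j\<le>k. (real j * ((2 * pi) ^ j / fact j))\<^sup>2) * T"
    "\<And>L. (\<Sum>n<L. LINT x|lebesgue_on {real n..real n+1}. (norm (A x - poly (p n) (of_real x)))\<^sup>2)
        \<le> ((2 * pi) ^ (k + 1) / fact (k + 1))\<^sup>2 * T"
proof -
  interpret finite_measure N unfolding N_def by (rule finite_measure_lebesgue_on_Icc)
  have spN: "space N = {R..R+1}" by (simp add: N_def)
  have h1: "integrable N h" by (rule square_integrable_imp_integrable[OF h])
  define v where "v j y = (\<i> * of_real (2 * pi * (y - R))) ^ j / fact j" for j :: nat and y :: real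
  define a where "a n j = (LINT y|N. of_real (h y) * v j y * cis (2 * pi * real n * (y - R)))" for n j
  define r where "r \<theta> y = cis (2 * pi * \<theta> * (y - R)) - (\<Sum>j\<le>k. of_real (\<theta> ^ j) * v j y)" for \<theta> y
  define q where "q n = (\<Sum>j\<le>k. monom (a n j) j)" for n
  define p where "p n = pcompose (q n) [:- of_nat n, 1:]" for n
  define D where "D n = (\<Sum>j\<le>k. real j * norm (a n j))" for n
  have poly_p: "poly (p n) (of_real x) = (\<Sum>j\<le>k. a n j * of_real ((x - real n) ^ j))" for n x
    by (simp add: p_def q_def poly_pcompose poly_sum poly_monom)
  have v_meas: "v j \<in> borel_measurable N" for j
    unfolding N_def v_def by (intro continuous_imp_measurable_lebesgue_on continuous_intros) auto
  have v_bound: "norm (v j y) \<le> (2 * pi) ^ j / fact j" if "y \<in> {R..R+1}" for j y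
  proof -
    have "norm (v j y) = (2 * pi * \<bar>y - R\<bar>) ^ j / fact j"
      by (simp add: v_def norm_divide norm_power norm_mult abs_mult del: of_real_diff)
    also have "\<dots> \<le> (2 * pi * 1) ^ j / fact j"
      using that by (intro divide_right_mono power_mono mult_left_mono) auto
    finally show ?thesis by simp
  qed
  have a_bound: "(\<Sum>n<L. (norm (a n j))\<^sup>2) \<le> ((2 * pi) ^ j / fact j)\<^sup>2 * T" for L j
    unfolding a_def T_def N_def
    by (rule bessel_inequality_interval) (use h v_meas v_bound in \<open>auto simp: N_def\<close>)
  have r_meas: "r \<theta> \<in> borel_measurable N" for \<theta>
    unfolding N_def r_def v_def by (intro continuous_imp_measurable_lebesgue_on continuous_intros) auto
  have r_bound: "norm (r \<theta> y) \<le> (2 * pi) ^ (k + 1) / fact (k + 1)" if "y \<in> {R..R+1}" "\<theta> \<in> {0..1}" for \<theta> y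
  proof -
    have "r \<theta> y = iexp (2 * pi * \<theta> * (y - R)) - (\<Sum>j\<le>k. (\<i> * of_real (2 * pi * \<theta> * (y - R))) ^ j / fact j)"
    proof -
      have "of_real (\<theta> ^ j) * v j y = (\<i> * of_real (2 * pi * \<theta> * (y - R))) ^ j / fact j" for j
      proof -
        have "of_real (\<theta> ^ j) * v j y = (of_real \<theta> * (\<i> * of_real (2 * pi * (y - R)))) ^ j / fact j"
          by (simp add: v_def power_mult_distrib)
        also have "of_real \<theta> * (\<i> * of_real (2 * pi * (y - R))) = \<i> * of_real (2 * pi * \<theta> * (y - R))"
          by (simp add: mult_ac)
        finally show ?thesis .
      qed
      then show ?thesis by (simp only: r_def cis_conv_exp)
    qed
    then have "norm (r \<theta> y) \<le> \<bar>2 * pi * \<theta> * (y - R)\<bar> ^ Suc k / fact (Suc k)"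
      using iexp_approx1 by presburger
    also have "\<dots> \<le> (2 * pi) ^ Suc k / fact (Suc k)"
    proof (intro divide_right_mono power_mono)
      have "\<theta> * \<bar>y - R\<bar> \<le> 1 * 1" using that by (intro mult_mono) auto
      then show "\<bar>2 * pi * \<theta> * (y - R)\<bar> \<le> 2 * pi"
        using that by (simp add: abs_mult mult.assoc)
    qed auto
    finally show ?thesis by simp
  qed
  have v_int: "integrable N (\<lambda>y. of_real (h y) * v j y * cis (2 * pi * real n * (y - R)))" for n j
  proof -
    have "integrable N (\<lambda>y. of_real (h y) * (v j y * cis (2 * pi * real n * (y - R))))"
    proof (rule integrable_mult_bounded[where B = "(2 * pi) ^ j / fact j", OF h1])
      show "(\<lambda>y. v j y * cis (2 * pi * real n * (y - R))) \<in> borel_measurable N"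
        unfolding N_def v_def by (intro continuous_imp_measurable_lebesgue_on continuous_intros) auto
    qed (use v_bound in \<open>auto simp: spN norm_mult\<close>)
    then show ?thesis by (simp add: mult.assoc)
  qed
  have A_int: "integrable N (\<lambda>y. of_real (h y) * cis (2 * pi * x * (y - R)))" for x
    by (rule integrable_mult_bounded[where B = 1, OF h1])
       (auto simp: N_def intro!: continuous_imp_measurable_lebesgue_on continuous_intros)
  have rem: "A (real n + \<theta>) - poly (p n) (of_real (real n + \<theta>)) =
      (LINT y|N. of_real (h y) * r \<theta> y * cis (2 * pi * real n * (y - R)))" for n \<theta>
  proof -
    have "(LINT y|N. of_real (h y) * r \<theta> y * cis (2 * pi * real n * (y - R))) =
       (LINT y|N. of_real (h y) * cis (2 * pi * (real n + \<theta>) * (y - R)) -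
         (\<Sum>j\<le>k. of_real (\<theta> ^ j) * (of_real (h y) * v j y * cis (2 * pi * real n * (y - R)))))"
    proof (intro Bochner_Integration.integral_cong refl)
      fix y
      have "cis (2 * pi * (real n + \<theta>) * (y - R)) = cis (2 * pi * \<theta> * (y - R)) * cis (2 * pi * real n * (y - R))"
        by (simp add: cis_mult algebra_simps)
      then show "of_real (h y) * r \<theta> y * cis (2 * pi * real n * (y - R)) =
         of_real (h y) * cis (2 * pi * (real n + \<theta>) * (y - R)) -
         (\<Sum>j\<le>k. of_real (\<theta> ^ j) * (of_real (h y) * v j y * cis (2 * pi * real n * (y - R))))"
        by (simp add: r_def left_diff_distrib right_diff_distrib sum_distrib_left sum_distrib_right mult_ac
            del: of_real_power)
    qed
    also have "\<dots> = A (real n + \<theta>) - (\<Sum>j\<le>k. of_real (\<theta> ^ j) * a n j)"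
      using A_int v_int by (simp add: A_def a_def Bochner_Integration.integral_sum)
    finally show ?thesis
      using poly_p[of n "real n + \<theta>"] by (simp add: mult.commute)
  qed
  have A_cont: "continuous_on UNIV A" unfolding A_def N_def
    by (rule continuous_on_band_limited) (use h1 in \<open>simp add: N_def\<close>)
  define \<phi> where "\<phi> n x = (norm (A x - poly (p n) (of_real x)))\<^sup>2" for n x
  have \<phi>_cont: "continuous_on S (\<phi> n)" for n S unfolding \<phi>_def
    by (intro continuous_intros continuous_on_subset[OF A_cont]) auto
  have \<phi>_int: "(LINT x|lebesgue_on {real n..real n+1}. \<phi> n x) = integral {0..1} (\<lambda>\<theta>. \<phi> n (real n + \<theta>))" for n
  proof -
    have "(LINT x|lebesgue_on {real n..real n+1}. \<phi> n x) = integral {real n..real n+1} (\<phi> n)"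
      by (intro lebesgue_integral_eq_integral continuous_imp_integrable_real \<phi>_cont) auto
    also have "\<dots> = integral {0..1} (\<lambda>\<theta>. \<phi> n (real n + \<theta>))"
      using integral_shift_Icc_real[of 0 1 "\<phi> n" "real n"] by (simp add: o_def add.commute)
    finally show ?thesis .
  qed
  show ?thesis
  proof (rule that[of p D])
    show "degree (p n) \<le> k" for n
    proof -
      have "degree (p n) \<le> degree (q n) * 1"
        unfolding p_def by (rule order_trans[OF degree_pcompose_le]) simp
      also have "degree (q n) \<le> k" unfolding q_def
        by (intro degree_sum_le) (auto intro: order_trans[OF degree_monom_le])
      finally show ?thesis by simp
    qed
    show "D n \<ge> 0" for n by (simp add: D_def sum_nonneg)
    show "norm (poly (p n) (of_real x) - poly (p n) (of_real y)) \<le> D n * \<bar>x - y\<bar>"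
      if "x \<in> {real n..real n+1}" "y \<in> {real n..real n+1}" for n x y
    proof -
      have "norm (poly (p n) (of_real x) - poly (p n) (of_real y)) =
        norm (\<Sum>j\<le>k. a n j * of_real ((x - real n) ^ j - (y - real n) ^ j))"
        by (simp add: poly_p sum_subtractf[symmetric] algebra_simps)
      also have "\<dots> \<le> (\<Sum>j\<le>k. real j * norm (a n j) * \<bar>x - y\<bar>)"
      proof (rule sum_norm_le)
        fix j
        have "\<bar>(x - real n) ^ j - (y - real n) ^ j\<bar> \<le> real j * \<bar>(x - real n) - (y - real n)\<bar>"
          using norm_power_diff[of "x - real n" "y - real n" j] that by auto
        then have "norm (a n j) * \<bar>(x - real n) ^ j - (y - real n) ^ j\<bar> \<le> norm (a n j) * (real j * \<bar>x - y\<bar>)"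
          by (intro mult_left_mono) auto
        then show "norm (a n j * of_real ((x - real n) ^ j - (y - real n) ^ j)) \<le> real j * norm (a n j) * \<bar>x - y\<bar>"
          by (simp only: norm_mult norm_of_real) (simp add: mult_ac)
      qed
      finally show ?thesis by (simp add: D_def sum_distrib_right)
    qed
    show "(\<Sum>n<L. (D n)\<^sup>2) \<le> real (k + 1) * (\<Sum>j\<le>k. (real j * ((2 * pi) ^ j / fact j))\<^sup>2) * T" for L
    proof -
      have "(\<Sum>n<L. (D n)\<^sup>2) \<le> (\<Sum>n<L. real (k + 1) * (\<Sum>j\<le>k. (real j * norm (a n j))\<^sup>2))"
      proof (rule sum_mono)
        fix n show "(D n)\<^sup>2 \<le> real (k + 1) * (\<Sum>j\<le>k. (real j * norm (a n j))\<^sup>2)"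
          using sum_squared_le_sum_of_squares[of "\<lambda>j. real j * norm (a n j)" "{..k}"]
          by (simp add: D_def mult.commute)
      qed
      also have "\<dots> = real (k + 1) * (\<Sum>j\<le>k. (real j)\<^sup>2 * (\<Sum>n<L. (norm (a n j))\<^sup>2))"
        unfolding sum_distrib_left[symmetric]
        by (subst sum.swap) (simp add: sum_distrib_left power_mult_distrib)
      also have "\<dots> \<le> real (k + 1) * (\<Sum>j\<le>k. (real j)\<^sup>2 * (((2 * pi) ^ j / fact j)\<^sup>2 * T))"
        by (intro mult_left_mono sum_mono a_bound) auto
      also have "\<dots> = real (k + 1) * (\<Sum>j\<le>k. (real j * ((2 * pi) ^ j / fact j))\<^sup>2) * T"
        unfolding power_mult_distrib[of "real _"] mult.assoc sum_distrib_right ..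
      finally show ?thesis .
    qed
    show "(\<Sum>n<L. LINT x|lebesgue_on {real n..real n+1}. (norm (A x - poly (p n) (of_real x)))\<^sup>2)
        \<le> ((2 * pi) ^ (k + 1) / fact (k + 1))\<^sup>2 * T" for L
    proof -
      have c: "continuous_on {0..1} (\<lambda>\<theta>. \<phi> n (real n + \<theta>))" for n
        by (rule continuous_on_compose2[OF \<phi>_cont[of UNIV]]) (auto intro!: continuous_intros)
      have "(\<Sum>n<L. LINT x|lebesgue_on {real n..real n+1}. \<phi> n x)
          = integral {0..1} (\<lambda>\<theta>. \<Sum>n<L. \<phi> n (real n + \<theta>))"
        unfolding \<phi>_int
        by (rule Henstock_Kurzweil_Integration.integral_sum[symmetric])
           (use c integrable_continuous_real in auto)
      also have "\<dots> \<le> integral {0..1} (\<lambda>\<theta>::real. ((2 * pi) ^ (k + 1) / fact (k + 1))\<^sup>2 * T)"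
      proof (rule integral_le)
        show "(\<lambda>\<theta>. \<Sum>n<L. \<phi> n (real n + \<theta>)) integrable_on {0..1}"
          by (intro integrable_continuous_real continuous_on_sum c)
        fix \<theta> :: real assume \<theta>: "\<theta> \<in> {0..1}"
        show "(\<Sum>n<L. \<phi> n (real n + \<theta>)) \<le> ((2 * pi) ^ (k + 1) / fact (k + 1))\<^sup>2 * T"
          unfolding \<phi>_def rem unfolding T_def N_def
          by (rule bessel_inequality_interval)
             (use h r_meas r_bound[OF _ \<theta>] in \<open>auto simp: N_def\<close>)
      qed auto
      finally show ?thesis by (simp add: \<phi>_def)
    qed
  qed
qed

section \<open>Propagation from a set of positive measure to a window\<close>

text \<open>
  The square of the constant of \<open>remez_modulated\<close> for half of the given measure, times the factor
  lost in passing from the mean square to a pointwise bound on that half.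
\<close>

definition window_const :: "real \<Rightarrow> nat \<Rightarrow> real" where
  "window_const \<sigma> k = 4 / \<sigma> * (exp 1 * (8 * exp 1 / \<sigma>) ^ k * (16 / \<sigma>))\<^sup>2"

text \<open>
  On at least half of \<open>S\<close> the modulated polynomial is bounded by a multiple of its root mean square
  over \<open>S\<close> (Chebyshev), and \<open>remez_modulated\<close> extends the bound to the whole window.
\<close>

lemma window_estimate:
  fixes p :: "complex poly" and S :: "real set" and R a :: real
  defines "G \<equiv> \<lambda>x. Re (poly p (of_real x) * cis (2 * pi * R * x))"
  assumes S: "S \<in> sets lebesgue" "S \<subseteq> {a..a+1}" "measure lebesgue S \<ge> \<sigma>" "0 < \<sigma>" "\<sigma> \<le> 1"
    and deg: "degree p \<le> k" and R: "R \<ge> 1" and D: "D \<ge> 0"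
    and lip: "\<And>x y. x \<in> {a..a+1} \<Longrightarrow> y \<in> {a..a+1} \<Longrightarrow>
        norm (poly p (of_real x) - poly p (of_real y)) \<le> D * \<bar>x - y\<bar>"
    and x: "x \<in> {a..a+1}"
  shows "(norm (poly p (of_real x)))\<^sup>2 \<le>
     window_const \<sigma> k * ((LINT x|lebesgue_on S. (G x)\<^sup>2) + (D / R)\<^sup>2)"
proof -
  define B where "B = exp 1 * (8 * exp 1 / \<sigma>) ^ k * (16 / \<sigma>)"
  define I where "I = (LINT x|lebesgue_on S. (G x)\<^sup>2)"
  have B: "B > 0" using S by (simp add: B_def)
  have I: "I \<ge> 0" by (simp add: I_def)
  have Sl: "S \<in> lmeasurable"
    by (rule fmeasurableI2[of "{a..a+1}"]) (use S in auto)
  interpret finite_measure "lebesgue_on S"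
    by (rule finite_measureI) (use fmeasurableD2[OF Sl] S in \<open>simp add: emeasure_restrict_space\<close>)
  have contG: "continuous_on UNIV G" unfolding G_def by (intro continuous_intros)
  have int: "integrable (lebesgue_on S) (\<lambda>x. (G x)\<^sup>2)"
  proof -
    have "integrable (lebesgue_on {a..a+1}) (\<lambda>x. (G x)\<^sup>2)"
      by (intro continuous_imp_integrable_real continuous_intros continuous_on_subset[OF contG]) auto
    then have "set_integrable lebesgue {a..a+1} (\<lambda>x. (G x)\<^sup>2)"
      by (simp add: set_integrable_def integrable_restrict_space)
    then have "set_integrable lebesgue S (\<lambda>x. (G x)\<^sup>2)"
      by (rule set_integrable_subset) (use S in auto)
    then show ?thesis using S by (simp add: set_integrable_def integrable_restrict_space)
  qed
  have *: "norm (poly p (of_real x)) \<le> B * (m + D / R)" if m: "m > sqrt (2 / \<sigma> * I)" for m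
  proof -
    have m0: "m > 0" using m I S by (smt (verit) divide_nonneg_pos mult_nonneg_nonneg real_sqrt_ge_zero)
    have m2: "2 / \<sigma> * I \<le> m\<^sup>2"
      using m I S by (smt (verit) real_sqrt_le_iff real_sqrt_abs m0)
    define Z where "Z = {x \<in> S. \<bar>G x\<bar> \<le> m}"
    have Z: "Z \<in> lmeasurable"
    proof -
      have "{x. \<bar>G x\<bar> \<le> m} \<in> sets borel"
        using contG by (intro borel_closed closed_Collect_le continuous_intros)
      then have "{x. \<bar>G x\<bar> \<le> m} \<in> sets lebesgue" by simp
      then have "S \<inter> {x. \<bar>G x\<bar> \<le> m} \<in> lmeasurable"
        using Sl by (intro fmeasurable_Int_fmeasurable) auto
      then show ?thesis by (simp add: Z_def Int_def)
    qed
    have "measure (lebesgue_on S) {x \<in> space (lebesgue_on S). (G x)\<^sup>2 \<ge> m\<^sup>2} \<le> I / m\<^sup>2"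
      unfolding I_def by (rule integral_Markov_inequality_measure[OF int, of "{}"]) (use m0 in auto)
    also have "\<dots> \<le> \<sigma> / 2" using m2 m0 S by (simp add: field_simps)
    finally have le: "measure (lebesgue_on S) {x \<in> space (lebesgue_on S). (G x)\<^sup>2 \<ge> m\<^sup>2} \<le> \<sigma> / 2" .
    have Zc: "S - Z \<subseteq> {x \<in> space (lebesgue_on S). (G x)\<^sup>2 \<ge> m\<^sup>2}"
    proof
      fix x assume "x \<in> S - Z"
      then have "x \<in> S" "m < \<bar>G x\<bar>" by (auto simp: Z_def)
      then have "m\<^sup>2 \<le> \<bar>G x\<bar>\<^sup>2" using m0 by (intro power_mono) auto
      then show "x \<in> {x \<in> space (lebesgue_on S). (G x)\<^sup>2 \<ge> m\<^sup>2}" using \<open>x \<in> S\<close> by simp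
    qed
    have "measure (lebesgue_on S) (S - Z) \<le> measure (lebesgue_on S) {x \<in> space (lebesgue_on S). (G x)\<^sup>2 \<ge> m\<^sup>2}"
      by (intro finite_measure_mono Zc) (use int in measurable)
    with le have "measure (lebesgue_on S) (S - Z) \<le> \<sigma> / 2" by linarith
    also have "measure (lebesgue_on S) (S - Z) = measure lebesgue (S - Z)"
      using S by (intro measure_restrict_space) auto
    also have "\<dots> = measure lebesgue S - measure lebesgue Z"
      using Sl Z by (intro measurable_measure_Diff) (auto simp: Z_def)
    finally have ZM: "measure lebesgue Z \<ge> \<sigma> / 2" using S by linarith
    have "norm (poly p (of_real x)) \<le> exp 1 * (4 * exp 1 / (\<sigma> / 2)) ^ k * (8 / (\<sigma> / 2) * (m + D / R))"
      by (rule remez_modulated[OF Z _ ZM _ _ deg R D lip _ x])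
         (use S(2,4,5) in \<open>auto simp: Z_def G_def\<close>)
    then show ?thesis by (simp add: B_def field_simps)
  qed
  \<comment> \<open>Thresholds above \<open>sqrt (2 / \<sigma> * I)\<close> are positive, as Chebyshev's inequality requires; now let
    them decrease to it.\<close>
  have "norm (poly p (of_real x)) \<le> B * (sqrt (2 / \<sigma> * I) + D / R)"
  proof (rule field_le_epsilon)
    fix e :: real assume "e > 0"
    then have "norm (poly p (of_real x)) \<le> B * ((sqrt (2 / \<sigma> * I) + e / B) + D / R)"
      using B by (intro *) auto
    also have "\<dots> = B * (sqrt (2 / \<sigma> * I) + D / R) + e" using B by (simp add: field_simps)
    finally show "norm (poly p (of_real x)) \<le> B * (sqrt (2 / \<sigma> * I) + D / R) + e" .
  qed
  then have "(norm (poly p (of_real x)))\<^sup>2 \<le> (B * (sqrt (2 / \<sigma> * I) + D / R))\<^sup>2"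
    by (intro power_mono) auto
  also have "\<dots> \<le> B\<^sup>2 * (2 * ((sqrt (2 / \<sigma> * I))\<^sup>2 + (D / R)\<^sup>2))"
    unfolding power_mult_distrib
    by (intro mult_left_mono) (use sum_squares_bound[of "sqrt (2 / \<sigma> * I)" "D / R"] in \<open>auto simp: power2_sum\<close>)
  also have "(sqrt (2 / \<sigma> * I))\<^sup>2 = 2 / \<sigma> * I" using S I by simp
  also have "B\<^sup>2 * (2 * (2 / \<sigma> * I + (D / R)\<^sup>2)) \<le> B\<^sup>2 * (4 / \<sigma> * (I + (D / R)\<^sup>2))"
  proof (intro mult_left_mono)
    have "2 * (D / R)\<^sup>2 \<le> 4 / \<sigma> * (D / R)\<^sup>2" using S by (intro mult_right_mono) (auto simp: field_simps)
    then show "2 * (2 / \<sigma> * I + (D / R)\<^sup>2) \<le> 4 / \<sigma> * (I + (D / R)\<^sup>2)"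
      by (simp add: ring_distribs)
  qed auto
  finally show ?thesis
    unfolding window_const_def B_def[symmetric] I_def[symmetric] by (simp only: mult_ac)
qed

lemma window_const_ge_1: "0 < \<sigma> \<Longrightarrow> \<sigma> \<le> 1 \<Longrightarrow> 1 \<le> window_const \<sigma> k"
proof -
  assume \<sigma>: "0 < \<sigma>" "\<sigma> \<le> 1"
  have e: "(1::real) \<le> exp 1" by simp
  have "\<sigma> \<le> 8 * exp 1" using \<sigma> e by linarith
  then have "1 \<le> (8 * exp 1 / \<sigma>) ^ k"
    using \<sigma> by (intro one_le_power) simp
  moreover have "1 \<le> 16 / \<sigma>" "1 \<le> 4 / \<sigma>" using \<sigma> by (auto simp: field_simps)
  ultimately show ?thesis unfolding window_const_def using e
    by (smt (verit) mult_le_cancel_left1 mult_less_cancel_right2 one_le_power)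
qed

text \<open>
  The function \<open>F\<close> is only close in mean square to a modulated polynomial \<open>G\<close>: bound \<open>F\<close> on the
  window by \<open>G\<close>, go from the window to \<open>E\<close> with \<open>G\<close>, and return to \<open>F\<close> on \<open>E\<close>.
\<close>

lemma window_estimate_perturbed:
  fixes p :: "complex poly" and E :: "real set" and F \<delta> :: "real \<Rightarrow> real" and R a :: real
  defines "G \<equiv> \<lambda>x. Re (poly p (of_real x) * cis (2 * pi * R * x))"
  defines "J \<equiv> {a..a+1::real}"
  assumes E: "E \<in> sets lebesgue" "measure lebesgue (E \<inter> J) \<ge> \<sigma>" "0 < \<sigma>" "\<sigma> \<le> 1"
    and deg: "degree p \<le> k" and R: "R \<ge> 1" and D: "D \<ge> 0"
    and lip: "\<And>x y. x \<in> J \<Longrightarrow> y \<in> J \<Longrightarrow>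
        norm (poly p (of_real x) - poly p (of_real y)) \<le> D * \<bar>x - y\<bar>"
    and F: "integrable (lebesgue_on J) (\<lambda>x. (F x)\<^sup>2)"
    and \<delta>: "integrable (lebesgue_on J) \<delta>" "AE x in lebesgue_on J. (F x - G x)\<^sup>2 \<le> \<delta> x"
  shows "(LINT x|lebesgue_on J. (F x)\<^sup>2) \<le>
     4 * window_const \<sigma> k * (LINT x|lebesgue_on J. indicator E x * (F x)\<^sup>2) +
     6 * window_const \<sigma> k * (LINT x|lebesgue_on J. \<delta> x) +
     2 * window_const \<sigma> k * (D / R)\<^sup>2"
proof -
  define \<kappa> where "\<kappa> = window_const \<sigma> k"
  have \<kappa>: "1 \<le> \<kappa>" using window_const_ge_1 E by (simp add: \<kappa>_def)
  have Jm: "J \<in> sets lebesgue" by (simp add: J_def)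
  have contG: "continuous_on UNIV G" unfolding G_def by (intro continuous_intros)
  have intG: "integrable (lebesgue_on J) (\<lambda>x. (G x)\<^sup>2)" unfolding J_def
    by (intro continuous_imp_integrable_real continuous_intros continuous_on_subset[OF contG]) auto
  have indE: "indicator E \<in> borel_measurable (lebesgue_on J)"
    using E by (intro measurable_restrict_space1) auto
  have int_ind: "integrable (lebesgue_on J) (\<lambda>x. indicator E x * u x)"
    if "integrable (lebesgue_on J) u" for u :: "real \<Rightarrow> real"
    by (rule Bochner_Integration.integrable_bound[OF that
          borel_measurable_times[OF indE borel_measurable_integrable[OF that]]])
       (simp split: split_indicator)
  have EJ: "(LINT x|lebesgue_on (E \<inter> J). u x) = (LINT x|lebesgue_on J. indicator E x * u x)" for u :: "real \<Rightarrow> real"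
  proof -
    have "(LINT x|lebesgue_on (E \<inter> J). u x) = (LINT x|lebesgue. indicator (E \<inter> J) x * u x)"
      using E Jm by (subst integral_restrict_space) auto
    also have "\<dots> = (LINT x|lebesgue. indicator J x *\<^sub>R (indicator E x * u x))"
      by (intro Bochner_Integration.integral_cong) (auto simp: indicator_def)
    also have "\<dots> = (LINT x|lebesgue_on J. indicator E x * u x)"
      using Jm by (subst integral_restrict_space) auto
    finally show ?thesis .
  qed
  define IG where "IG = (LINT x|lebesgue_on J. indicator E x * (G x)\<^sup>2)"
  define IF where "IF = (LINT x|lebesgue_on J. indicator E x * (F x)\<^sup>2)"
  define I\<delta> where "I\<delta> = (LINT x|lebesgue_on J. \<delta> x)"
  have I\<delta>: "I\<delta> \<ge> 0" unfolding I\<delta>_def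
    using \<delta>(2) by (intro integral_nonneg_AE) (auto elim!: eventually_mono intro: order_trans[OF zero_le_power2])
  have sq: "(u + v)\<^sup>2 \<le> 2 * u\<^sup>2 + 2 * v\<^sup>2" for u v :: real
    using sum_squares_bound[of u v] by (simp add: power2_sum)
  have pw: "(G x)\<^sup>2 \<le> \<kappa> * (IG + (D / R)\<^sup>2)" if "x \<in> J" for x
  proof -
    have "(G x)\<^sup>2 \<le> (norm (poly p (of_real x) * cis (2 * pi * R * x)))\<^sup>2"
      unfolding G_def using abs_Re_le_cmod by (metis abs_ge_zero power2_abs power_mono)
    also have "\<dots> = (norm (poly p (of_real x)))\<^sup>2" by (simp add: norm_mult)
    also have "\<dots> \<le> window_const \<sigma> k * ((LINT x|lebesgue_on (E \<inter> J). (G x)\<^sup>2) + (D / R)\<^sup>2)"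
      unfolding G_def
      by (rule window_estimate[OF _ _ E(2-4) deg R D lip that[unfolded J_def]]) (use E Jm in \<open>simp_all add: J_def sets.Int\<close>)
    finally show ?thesis unfolding EJ by (simp add: \<kappa>_def IG_def)
  qed
  have "(LINT x|lebesgue_on J. (F x)\<^sup>2) \<le> (LINT x|lebesgue_on J. 2 * (\<kappa> * (IG + (D / R)\<^sup>2)) + 2 * \<delta> x)"
  proof (rule integral_mono_AE[OF F])
    show "integrable (lebesgue_on J) (\<lambda>x. 2 * (\<kappa> * (IG + (D / R)\<^sup>2)) + 2 * \<delta> x)"
      using \<delta> by (intro Bochner_Integration.integrable_add) (auto simp: J_def)
    show "AE x in lebesgue_on J. (F x)\<^sup>2 \<le> 2 * (\<kappa> * (IG + (D / R)\<^sup>2)) + 2 * \<delta> x"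
      using \<delta>(2) AE_space
    proof eventually_elim
      case (elim x)
      have "(F x)\<^sup>2 \<le> 2 * (G x)\<^sup>2 + 2 * (F x - G x)\<^sup>2" using sq[of "G x" "F x - G x"] by simp
      moreover have "x \<in> J" using elim by simp
      ultimately show ?case using pw[of x] elim(1) by linarith
    qed
  qed
  also have "\<dots> = 2 * (\<kappa> * (IG + (D / R)\<^sup>2)) + 2 * I\<delta>"
  proof -
    have "integrable (lebesgue_on J) (\<lambda>x. 2 * (\<kappa> * (IG + (D / R)\<^sup>2)))" by (simp add: J_def)
    then show ?thesis using \<delta> unfolding I\<delta>_def
      by (subst Bochner_Integration.integral_add) (auto simp: measure_restrict_space J_def)
  qed
  also have "IG \<le> 2 * IF + 2 * I\<delta>"
  proof -
    have "IG \<le> (LINT x|lebesgue_on J. 2 * (indicator E x * (F x)\<^sup>2) + 2 * \<delta> x)"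
      unfolding IG_def
    proof (rule integral_mono_AE[OF int_ind[OF intG]])
      show "integrable (lebesgue_on J) (\<lambda>x. 2 * (indicator E x * (F x)\<^sup>2) + 2 * \<delta> x)"
        using \<delta> int_ind[OF F] by auto
      show "AE x in lebesgue_on J. indicator E x * (G x)\<^sup>2 \<le> 2 * (indicator E x * (F x)\<^sup>2) + 2 * \<delta> x"
        using \<delta>(2)
      proof eventually_elim
        case (elim x)
        have "(G x)\<^sup>2 \<le> 2 * (F x)\<^sup>2 + 2 * (F x - G x)\<^sup>2"
          using sq[of "F x" "G x - F x"] by (simp add: power2_commute)
        moreover have "0 \<le> \<delta> x" using elim by (rule order_trans[OF zero_le_power2])
        ultimately show ?case using elim by (auto simp: indicator_def)
      qed
    qed
    also have "\<dots> = 2 * IF + 2 * I\<delta>"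
      using \<delta> int_ind[OF F] by (simp add: IF_def I\<delta>_def)
    finally show ?thesis .
  qed
  also have "2 * (\<kappa> * (2 * IF + 2 * I\<delta> + (D / R)\<^sup>2)) + 2 * I\<delta> \<le>
      4 * \<kappa> * IF + 6 * \<kappa> * I\<delta> + 2 * \<kappa> * (D / R)\<^sup>2"
    using mult_right_mono[OF \<kappa> I\<delta>] by (simp add: algebra_simps)
  finally show ?thesis using \<kappa> by (simp add: \<kappa>_def IF_def I\<delta>_def)
qed

section \<open>A Logvinenko-Sereda inequality for modulated signals\<close>

lemma sum_integral_unit_windows:
  fixes f :: "real \<Rightarrow> real"
  assumes "integrable (lebesgue_on {0..real L}) f"
  shows "(\<Sum>n<L. LINT x|lebesgue_on {real n..real n+1}. f x) = (LINT x|lebesgue_on {0..real L}. f x)"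
  using assms
proof (induction L)
  case 0
  have "(LINT x|lebesgue_on {0..0}. f x) = 0"
    by (intro integral_eq_zero_null_sets) (auto simp: null_sets_restrict_space)
  then show ?case by simp
next
  case (Suc L)
  have "integrable (lebesgue_on {0..real L}) f"
    by (rule integrable_subinterval[OF Suc.prems]) auto
  moreover have "(LINT x|lebesgue_on {0..real (Suc L)}. f x) =
      (LINT x|lebesgue_on {0..real L}. f x) + (LINT x|lebesgue_on {real L..real (Suc L)}. f x)"
    by (rule Equivalence_Measurable_On_Borel.integral_combine[OF Suc.prems]) auto
  ultimately show ?case using Suc.IH by (simp add: add.commute)
qed

lemma integral_inverse_square_le:
  assumes R: "R > 0"
  shows "(LINT x|lebesgue_on {0..real L}. (1 / (1 + x * R))\<^sup>2) \<le> 1 / R"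
proof -
  have pos: "1 + x * R > 0" if "x \<ge> 0" for x using that R by (simp add: add_pos_nonneg)
  have "integrable (lebesgue_on {0..real L}) (\<lambda>x. (1 / (1 + x * R))\<^sup>2)"
  proof (rule continuous_imp_integrable_real)
    have "1 + x * R \<noteq> 0" if "x \<in> {0..real L}" for x using pos[of x] that by auto
    then show "continuous_on {0..real L} (\<lambda>x. (1 / (1 + x * R))\<^sup>2)" by (intro continuous_intros) auto
  qed
  then have "(LINT x|lebesgue_on {0..real L}. (1 / (1 + x * R))\<^sup>2) = integral {0..real L} (\<lambda>x. (1 / (1 + x * R))\<^sup>2)"
    by (intro lebesgue_integral_eq_integral) auto
  moreover have "((\<lambda>x. (1 / (1 + x * R))\<^sup>2) has_integral
      (- (1 / R) * inverse (1 + real L * R) - (- (1 / R) * inverse (1 + 0 * R)))) {0..real L}"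
  proof (rule fundamental_theorem_of_calculus)
    fix x assume "x \<in> {0..real L}"
    then have x: "1 + x * R \<noteq> 0" using pos[of x] by auto
    have "((\<lambda>x. 1 + x * R) has_real_derivative R) (at x within {0..real L})"
      by (auto intro!: derivative_eq_intros)
    then have "((\<lambda>x. - (1 / R) * inverse (1 + x * R)) has_real_derivative
        - (1 / R) * (- (inverse (1 + x * R) * R * inverse (1 + x * R)))) (at x within {0..real L})"
      using x by (intro DERIV_cmult DERIV_inverse') auto
    moreover have "- (1 / R) * (- (inverse (1 + x * R) * R * inverse (1 + x * R))) = (1 / (1 + x * R))\<^sup>2"
      using R by (simp add: power2_eq_square divide_inverse)
    ultimately show "((\<lambda>x. - (1 / R) * inverse (1 + x * R)) has_vector_derivative (1 / (1 + x * R))\<^sup>2) (at x within {0..real L})"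
      by (simp add: has_real_derivative_iff_has_vector_derivative)
  qed simp
  then have "integral {0..real L} (\<lambda>x. (1 / (1 + x * R))\<^sup>2) = 1 / R - (1 / R) * inverse (1 + real L * R)"
    by (simp add: integral_unique)
  moreover have "(1 / R) * inverse (1 + real L * R) \<ge> 0" using R by simp
  ultimately show ?thesis by linarith
qed

lemma integral_Ici_le_of_Icc_le:
  fixes f :: "real \<Rightarrow> real"
  assumes f: "integrable (lebesgue_on {0..}) f" and le: "\<And>L::nat. (LINT x|lebesgue_on {0..real L}. f x) \<le> B"
  shows "(LINT x|lebesgue_on {0..}. f x) \<le> B"
proof -
  have "(\<lambda>L. LINT x|lebesgue_on {0..}. indicator {..real L} x * f x) \<longlonglongrightarrow> (LINT x|lebesgue_on {0..}. f x)"
  proof (rule integral_dominated_convergence[where w = "\<lambda>x. \<bar>f x\<bar>"])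
    show "AE x in lebesgue_on {0..}. (\<lambda>L. indicator {..real L} x * f x) \<longlonglongrightarrow> f x"
    proof (rule AE_I2)
      fix x :: real
      have "eventually (\<lambda>L. indicator {..real L} x * f x = f x) sequentially"
        using eventually_ge_at_top[of "nat \<lceil>x\<rceil>"] by eventually_elim (simp add: indicator_def nat_ceiling_le_eq)
      then show "(\<lambda>L. indicator {..real L} x * f x) \<longlonglongrightarrow> f x" by (rule tendsto_eventually)
    qed
    show "(\<lambda>x. indicator {..real L} x * f x) \<in> borel_measurable (lebesgue_on {0..})" for L
    proof (rule borel_measurable_times)
      have "{..real L} \<in> sets lebesgue" by simp
      then show "indicator {..real L} \<in> borel_measurable (lebesgue_on {0..})"
        by (intro measurable_restrict_space1 borel_measurable_indicator)
    qed (use f in simp)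
  qed (use f in \<open>auto split: split_indicator\<close>)
  moreover have "(LINT x|lebesgue_on {0..}. indicator {..real L} x * f x) = (LINT x|lebesgue_on {0..real L}. f x)" for L
  proof -
    have "(LINT x|lebesgue_on {0..}. indicator {..real L} x * f x) = (LINT x|lebesgue. indicator {0..} x *\<^sub>R (indicator {..real L} x * f x))"
      by (subst integral_restrict_space) auto
    also have "\<dots> = (LINT x|lebesgue. indicator {0..real L} x *\<^sub>R f x)"
      by (intro Bochner_Integration.integral_cong) (auto split: split_indicator)
    also have "\<dots> = (LINT x|lebesgue_on {0..real L}. f x)"
      by (subst integral_restrict_space) auto
    finally show ?thesis .
  qed
  ultimately show ?thesis using le by (intro LIMSEQ_le_const2[where a = B]) auto
qed

text \<open>
  The exponential growth of Remez's constant loses against the factorial in the Taylor remainder.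
\<close>

lemma window_const_taylor_tendsto_0:
  assumes "\<sigma> > 0"
  shows "(\<lambda>k. window_const \<sigma> k * ((2 * pi) ^ (k + 1) / fact (k + 1))\<^sup>2) \<longlonglongrightarrow> 0"
proof -
  define q where "q = 8 * exp 1 / \<sigma> * (2 * pi)"
  define c where "c = 4 / \<sigma> * (exp 1 * (16 / \<sigma>))\<^sup>2 * (2 * pi)\<^sup>2"
  have "(\<lambda>k. q ^ k / fact k) \<longlonglongrightarrow> 0"
    using summable_exp_generic[of q] by (intro summable_LIMSEQ_zero) (simp add: field_simps)
  then have lim: "(\<lambda>k. c * (q ^ k / fact k)\<^sup>2) \<longlonglongrightarrow> 0"
    by (intro tendsto_mult_right_zero tendsto_null_power) auto
  have "window_const \<sigma> k * ((2 * pi) ^ (k + 1) / fact (k + 1))\<^sup>2 \<le> c * (q ^ k / fact k)\<^sup>2" for k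
  proof -
    have "(2 * pi) ^ (k + 1) / fact (k + 1) \<le> (2 * pi) ^ (k + 1) / fact k"
      by (intro divide_left_mono) (auto intro!: fact_mono)
    then have "((2 * pi) ^ (k + 1) / fact (k + 1))\<^sup>2 \<le> ((2 * pi) ^ (k + 1) / fact k)\<^sup>2"
      by (intro power_mono) auto
    then have "window_const \<sigma> k * ((2 * pi) ^ (k + 1) / fact (k + 1))\<^sup>2 \<le>
      window_const \<sigma> k * ((2 * pi) ^ (k + 1) / fact k)\<^sup>2"
      using assms by (intro mult_left_mono) (auto simp: window_const_def)
    also have "\<dots> = c * (q ^ k / fact k)\<^sup>2"
      unfolding window_const_def c_def q_def
      by (simp only: power_mult_distrib power_divide power_add power_one_right) (simp add: field_simps)
    finally show ?thesis .
  qed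
  moreover have "0 \<le> window_const \<sigma> k * ((2 * pi) ^ (k + 1) / fact (k + 1))\<^sup>2" for k
    using assms by (simp add: window_const_def)
  ultimately show ?thesis
    by (intro tendsto_sandwich[OF _ _ tendsto_const lim]) (auto intro: always_eventually)
qed

definition band_synthesis :: "real \<Rightarrow> (real \<Rightarrow> real) \<Rightarrow> real \<Rightarrow> complex" where
  "band_synthesis R h x = (LINT y|lebesgue_on {R..R+1}. of_real (h y) * cis (2 * pi * x * y))"

text \<open>
  The relation between \<open>F = sqrt w * f\<close> and \<open>h = sqrt w * g\<close>, where \<open>g\<close> is the transform of \<open>f\<close> and
  vanishes outside \<open>[R, R + 1]\<close>. The pointwise error bound is square integrable in \<open>x\<close> with integral of
  order \<open>1 / R\<close>, and the comparison of the norms allows errors measured by \<open>h\<close> to be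
  absorbed into the norm of \<open>F\<close>.
\<close>

definition near_band :: "complex \<Rightarrow> real \<Rightarrow> real \<Rightarrow> (real \<Rightarrow> real) \<Rightarrow> (real \<Rightarrow> real) \<Rightarrow> bool" where
  "near_band W C0 R F h \<longleftrightarrow>
     integrable (lebesgue_on {0..}) (\<lambda>x. (F x)\<^sup>2) \<and>
     h \<in> borel_measurable (lebesgue_on {R..R+1}) \<and> integrable (lebesgue_on {R..R+1}) (\<lambda>y. (h y)\<^sup>2) \<and>
     (LINT y|lebesgue_on {R..R+1}. (h y)\<^sup>2) \<le> (LINT x|lebesgue_on {0..}. (F x)\<^sup>2) \<and>
     (AE x in lebesgue_on {0..}. (F x - Re (W * band_synthesis R h x))\<^sup>2
        \<le> (C0 / (1 + x * R))\<^sup>2 * (LINT y|lebesgue_on {R..R+1}. (h y)\<^sup>2))"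

text \<open>
  The sum of the window estimates. The second term on the right contains the Taylor remainders, which
  do not depend on \<open>R\<close>, and the distance of \<open>F\<close> to the band; the third term contains the Lipschitz constants.
  For fixed \<open>k\<close> only the integral over \<open>E\<close> and the remainders persist as \<open>R\<close> grows.
\<close>

lemma modulated_estimate:
  fixes W :: complex and C0 \<sigma> R :: real and k :: nat and F h :: "real \<Rightarrow> real"
  defines "N \<equiv> lebesgue_on {R..R+1}"
  defines "T \<equiv> LINT y|N. (h y)\<^sup>2"
  defines "\<kappa> \<equiv> window_const \<sigma> k"
  assumes \<sigma>: "0 < \<sigma>" "\<sigma> \<le> 1" and R: "R \<ge> 1"
    and E: "E \<in> sets lebesgue" "\<And>n. measure lebesgue (E \<inter> {real n..real n+1}) \<ge> \<sigma>"
    and near: "near_band W C0 R F h"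
  shows "(LINT x|lebesgue_on {0..}. (F x)\<^sup>2) \<le>
     4 * \<kappa> * (LINT x|lebesgue_on {0..}. indicator E x * (F x)\<^sup>2) +
     6 * \<kappa> * (2 * (norm W)\<^sup>2 * (((2 * pi) ^ (k + 1) / fact (k + 1))\<^sup>2 * T) + 2 * C0\<^sup>2 * T / R) +
     2 * \<kappa> * ((norm W)\<^sup>2 * (real (k + 1) * (\<Sum>j\<le>k. (real j * ((2 * pi) ^ j / fact j))\<^sup>2) * T) / R\<^sup>2)"
    (is "_ \<le> 4 * \<kappa> * ?IE + 6 * \<kappa> * ?X + 2 * \<kappa> * ?Y")
proof -
  have F: "integrable (lebesgue_on {0..}) (\<lambda>x. (F x)\<^sup>2)"
    and h: "h \<in> borel_measurable N" "integrable N (\<lambda>y. (h y)\<^sup>2)"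
    and FA: "AE x in lebesgue_on {0..}. (F x - Re (W * band_synthesis R h x))\<^sup>2 \<le> (C0 / (1 + x * R))\<^sup>2 * T"
    using near by (auto simp: near_band_def N_def T_def)
  interpret finite_measure N unfolding N_def by (rule finite_measure_lebesgue_on_Icc)
  have \<kappa>: "1 \<le> \<kappa>" using window_const_ge_1 \<sigma> by (simp add: \<kappa>_def)
  have T: "T \<ge> 0" by (simp add: T_def)
  have h1: "integrable N h" by (rule square_integrable_imp_integrable[OF h])
  define A where "A x = (LINT y|N. of_real (h y) * cis (2 * pi * x * (y - R)))" for x
  have Acont: "continuous_on UNIV A"
    unfolding A_def N_def by (rule continuous_on_band_limited) (use h1 in \<open>simp add: N_def\<close>)
  have mod: "band_synthesis R h x = A x * cis (2 * pi * R * x)" for x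
  proof -
    have "band_synthesis R h x = (LINT y|N. (of_real (h y) * cis (2 * pi * x * (y - R))) * cis (2 * pi * R * x))"
      unfolding band_synthesis_def N_def mult.assoc cis_mult
      by (intro Bochner_Integration.integral_cong) (auto simp: algebra_simps)
    then show ?thesis by (simp add: A_def)
  qed
  obtain p :: "nat \<Rightarrow> complex poly" and D :: "nat \<Rightarrow> real" where
    deg: "\<And>n. degree (p n) \<le> k" and D: "\<And>n. D n \<ge> 0"
    and lip: "\<And>n x y. x \<in> {real n..real n+1} \<Longrightarrow> y \<in> {real n..real n+1} \<Longrightarrow>
        norm (poly (p n) (of_real x) - poly (p n) (of_real y)) \<le> D n * \<bar>x - y\<bar>"
    and Dsum: "\<And>L. (\<Sum>n<L. (D n)\<^sup>2) \<le> real (k + 1) * (\<Sum>j\<le>k. (real j * ((2 * pi) ^ j / fact j))\<^sup>2) * T"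
    and rem: "\<And>L. (\<Sum>n<L. LINT x|lebesgue_on {real n..real n+1}. (norm (A x - poly (p n) (of_real x)))\<^sup>2)
        \<le> ((2 * pi) ^ (k + 1) / fact (k + 1))\<^sup>2 * T"
  proof (rule band_limited_window_approximation[OF h[unfolded N_def], of k], goal_cases)
    case (1 p D)
    show ?case
      by (rule that[of p D]; (unfold A_def T_def N_def)?; fact 1)
  qed
  define e where "e n x = (norm (A x - poly (p n) (of_real x)))\<^sup>2" for n x
  define b where "b x = (1 / (1 + x * R))\<^sup>2" for x
  define \<delta> where "\<delta> n x = 2 * (norm W)\<^sup>2 * e n x + 2 * C0\<^sup>2 * T * b x" for n x
  have e_int: "integrable (lebesgue_on {real n..real n+1}) (e n)" for n
  proof -
    have "continuous_on {real n..real n+1} (e n)" unfolding e_def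
      by (intro continuous_intros continuous_on_subset[OF Acont]) auto
    then show ?thesis by (rule continuous_imp_integrable_real)
  qed
  have bpos: "1 + x * R > 0" if "x \<ge> 0" for x using that R by (simp add: add_pos_nonneg)
  have b_int: "integrable (lebesgue_on {u..v}) b" if "0 \<le> u" for u v
  proof -
    have "1 + x * R \<noteq> 0" if "x \<in> {u..v}" for x using bpos[of x] that \<open>0 \<le> u\<close> by auto
    then have "continuous_on {u..v} b" unfolding b_def by (intro continuous_intros) auto
    then show ?thesis by (rule continuous_imp_integrable_real)
  qed
  have F_int: "integrable (lebesgue_on {u..v}) f" if f: "integrable (lebesgue_on {0..}) f" "0 \<le> u" for u v and f :: "real \<Rightarrow> real"
  proof -
    have "set_integrable lebesgue {0..} f" using f by (simp add: set_integrable_def integrable_restrict_space)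
    then have "set_integrable lebesgue {u..v} f" by (rule set_integrable_subset) (use f in auto)
    then show ?thesis by (simp add: set_integrable_def integrable_restrict_space)
  qed
  have EF_int: "integrable (lebesgue_on {0..}) (\<lambda>x. indicator E x * (F x)\<^sup>2)"
  proof -
    have "indicator E \<in> borel_measurable (lebesgue_on {0..})"
      using E by (intro measurable_restrict_space1) auto
    then show ?thesis
      by (intro Bochner_Integration.integrable_bound[OF F
          borel_measurable_times[OF _ borel_measurable_integrable[OF F]]])
       (simp_all split: split_indicator)
  qed
  have window: "(LINT x|lebesgue_on {real n..real n+1}. (F x)\<^sup>2) \<le>
     4 * \<kappa> * (LINT x|lebesgue_on {real n..real n+1}. indicator E x * (F x)\<^sup>2) +
     6 * \<kappa> * (LINT x|lebesgue_on {real n..real n+1}. \<delta> n x) +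
     2 * \<kappa> * (norm W * D n / R)\<^sup>2" for n
    unfolding \<kappa>_def
  proof (rule window_estimate_perturbed[where p = "smult W (p n)"])
    show "norm (poly (smult W (p n)) (of_real x) - poly (smult W (p n)) (of_real y)) \<le> norm W * D n * \<bar>x - y\<bar>"
      if "x \<in> {real n..real n+1}" "y \<in> {real n..real n+1}" for x y
      using mult_left_mono[OF lip[OF that], of "norm W"]
      by (simp add: right_diff_distrib[symmetric] norm_mult mult.assoc)
    show "integrable (lebesgue_on {real n..real n+1}) (\<delta> n)"
      unfolding \<delta>_def using e_int b_int by auto
    have "AE x in lebesgue_on {real n..real n+1}. (F x - Re (W * band_synthesis R h x))\<^sup>2
        \<le> (C0 / (1 + x * R))\<^sup>2 * T"
      using FA by (auto simp: AE_restrict_space_iff elim!: eventually_mono)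
    then show "AE x in lebesgue_on {real n..real n+1}.
       (F x - Re (poly (smult W (p n)) (of_real x) * cis (2 * pi * R * x)))\<^sup>2 \<le> \<delta> n x"
    proof eventually_elim
      case (elim x)
      define z where "z = W * (A x - poly (p n) (of_real x)) * cis (2 * pi * R * x)"
      have "(Re z)\<^sup>2 \<le> (norm z)\<^sup>2" using abs_Re_le_cmod by (metis abs_ge_zero power2_abs power_mono)
      also have "\<dots> = (norm W)\<^sup>2 * e n x" by (simp add: z_def e_def norm_mult power_mult_distrib)
      finally have z: "(Re z)\<^sup>2 \<le> (norm W)\<^sup>2 * e n x" .
      have "F x - Re (poly (smult W (p n)) (of_real x) * cis (2 * pi * R * x)) =
         (F x - Re (W * (A x * cis (2 * pi * R * x)))) + Re z"
        by (simp add: z_def algebra_simps)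
      then have "(F x - Re (poly (smult W (p n)) (of_real x) * cis (2 * pi * R * x)))\<^sup>2 \<le>
         2 * (F x - Re (W * (A x * cis (2 * pi * R * x))))\<^sup>2 + 2 * (Re z)\<^sup>2"
        using sum_squares_bound[of "F x - Re (W * (A x * cis (2 * pi * R * x)))" "Re z"] by (simp only: power2_sum)
      also have "\<dots> \<le> 2 * ((C0 / (1 + x * R))\<^sup>2 * T) + 2 * ((norm W)\<^sup>2 * e n x)"
        using elim z by (simp only: mod)
      finally show ?case by (simp add: \<delta>_def b_def power_divide)
    qed
  qed (use E \<sigma> R D F_int[OF F] degree_smult_le[of W "p n"] deg[of n] in auto)
  show ?thesis
  proof (rule integral_Ici_le_of_Icc_le[OF F])
    fix L :: nat
    have "(LINT x|lebesgue_on {0..real L}. (F x)\<^sup>2) = (\<Sum>n<L. LINT x|lebesgue_on {real n..real n+1}. (F x)\<^sup>2)"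
      by (rule sum_integral_unit_windows[symmetric]) (use F_int[OF F] in simp)
    also have "\<dots> \<le> (\<Sum>n<L. 4 * \<kappa> * (LINT x|lebesgue_on {real n..real n+1}. indicator E x * (F x)\<^sup>2) +
       6 * \<kappa> * (LINT x|lebesgue_on {real n..real n+1}. \<delta> n x) + 2 * \<kappa> * (norm W * D n / R)\<^sup>2)"
      by (intro sum_mono window)
    also have "\<dots> = 4 * \<kappa> * (\<Sum>n<L. LINT x|lebesgue_on {real n..real n+1}. indicator E x * (F x)\<^sup>2) +
       6 * \<kappa> * (\<Sum>n<L. LINT x|lebesgue_on {real n..real n+1}. \<delta> n x) + 2 * \<kappa> * (\<Sum>n<L. (norm W * D n / R)\<^sup>2)"
      by (simp only: sum.distrib sum_distrib_left)
    also have "\<dots> \<le> 4 * \<kappa> * ?IE + 6 * \<kappa> * ?X + 2 * \<kappa> * ?Y"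
    proof (intro add_mono mult_left_mono)
      have "(\<Sum>n<L. LINT x|lebesgue_on {real n..real n+1}. indicator E x * (F x)\<^sup>2) =
          (LINT x|lebesgue_on {0..real L}. indicator E x * (F x)\<^sup>2)"
        by (rule sum_integral_unit_windows) (use F_int[OF EF_int] in simp)
      also have "\<dots> \<le> ?IE"
        by (rule integral_mono_lebesgue_on_AE[OF EF_int]) auto
      finally show "(\<Sum>n<L. LINT x|lebesgue_on {real n..real n+1}. indicator E x * (F x)\<^sup>2) \<le> ?IE" .
      have "(\<Sum>n<L. LINT x|lebesgue_on {real n..real n+1}. \<delta> n x) =
          (\<Sum>n<L. 2 * (norm W)\<^sup>2 * (LINT x|lebesgue_on {real n..real n+1}. e n x)
            + 2 * C0\<^sup>2 * T * (LINT x|lebesgue_on {real n..real n+1}. b x))"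
        unfolding \<delta>_def using e_int b_int by (intro sum.cong refl) simp
      also have "\<dots> = 2 * (norm W)\<^sup>2 * (\<Sum>n<L. LINT x|lebesgue_on {real n..real n+1}. e n x)
         + 2 * C0\<^sup>2 * T * (LINT x|lebesgue_on {0..real L}. b x)"
        using sum_integral_unit_windows[OF b_int[of 0 "real L", OF order_refl]]
        by (simp only: sum.distrib sum_distrib_left[symmetric])
      also have "\<dots> \<le> 2 * (norm W)\<^sup>2 * (((2 * pi) ^ (k + 1) / fact (k + 1))\<^sup>2 * T) + 2 * C0\<^sup>2 * T * (1 / R)"
        unfolding e_def b_def
        by (intro add_mono mult_left_mono rem integral_inverse_square_le) (use R T in auto)
      finally show "(\<Sum>n<L. LINT x|lebesgue_on {real n..real n+1}. \<delta> n x) \<le> ?X" by simp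
      have "(\<Sum>n<L. (norm W * D n / R)\<^sup>2) = (norm W)\<^sup>2 * (\<Sum>n<L. (D n)\<^sup>2) / R\<^sup>2"
        by (simp add: power_mult_distrib power_divide sum_distrib_left sum_divide_distrib)
      also have "\<dots> \<le> ?Y" by (intro divide_right_mono mult_left_mono Dsum) auto
      finally show "(\<Sum>n<L. (norm W * D n / R)\<^sup>2) \<le> ?Y" .
    qed (use \<kappa> in auto)
    finally show "(LINT x|lebesgue_on {0..real L}. (F x)\<^sup>2) \<le> 4 * \<kappa> * ?IE + 6 * \<kappa> * ?X + 2 * \<kappa> * ?Y" .
  qed
qed

text \<open>
  First \<open>k\<close> is chosen such that the Taylor remainders contribute at most a quarter of the squared
  norm of \<open>h\<close>, then \<open>R0\<close> such that the terms with \<open>R\<close> contribute at most another quarter; both are absorbed on the left.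
\<close>

theorem logvinenko_sereda_modulated:
  fixes W :: complex and C0 \<sigma> :: real
  assumes \<sigma>: "0 < \<sigma>" "\<sigma> \<le> 1"
  obtains K R0 where "K > 0" "R0 \<ge> 1"
    "\<And>R E F h. R \<ge> R0 \<Longrightarrow> E \<in> sets lebesgue \<Longrightarrow>
       (\<And>n. measure lebesgue (E \<inter> {real n..real n+1}) \<ge> \<sigma>) \<Longrightarrow> near_band W C0 R F h \<Longrightarrow>
       (LINT x|lebesgue_on {0..}. (F x)\<^sup>2) \<le> K * (LINT x|lebesgue_on {0..}. indicator E x * (F x)\<^sup>2)"
proof -
  have "(\<lambda>k. 12 * (norm W)\<^sup>2 * (window_const \<sigma> k * ((2 * pi) ^ (k + 1) / fact (k + 1))\<^sup>2)) \<longlonglongrightarrow> 0"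
    using window_const_taylor_tendsto_0[OF \<sigma>(1)] by (rule tendsto_mult_right_zero)
  then have "eventually (\<lambda>k. 12 * (norm W)\<^sup>2 * (window_const \<sigma> k * ((2 * pi) ^ (k + 1) / fact (k + 1))\<^sup>2) < 1 / 4) sequentially"
    by (rule order_tendstoD) simp
  then obtain k where k: "12 * (norm W)\<^sup>2 * (window_const \<sigma> k * ((2 * pi) ^ (k + 1) / fact (k + 1))\<^sup>2) < 1 / 4"
    by (auto simp: eventually_sequentially)
  define \<kappa> where "\<kappa> = window_const \<sigma> k"
  have \<kappa>: "1 \<le> \<kappa>" using window_const_ge_1 \<sigma> by (simp add: \<kappa>_def)
  define Q where "Q = real (k + 1) * (\<Sum>j\<le>k. (real j * ((2 * pi) ^ j / fact j))\<^sup>2)"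
  have Q: "Q \<ge> 0" unfolding Q_def by (intro mult_nonneg_nonneg sum_nonneg) auto
  define a1 where "a1 = 12 * \<kappa> * C0\<^sup>2"
  define a2 where "a2 = 2 * \<kappa> * ((norm W)\<^sup>2 * Q)"
  have a: "a1 \<ge> 0" "a2 \<ge> 0" using \<kappa> Q by (auto simp: a1_def a2_def)
  define R0 where "R0 = 4 * (a1 + a2) + 1"
  show ?thesis
  proof (rule that[of "8 * \<kappa>" R0])
    fix R E F and h :: "real \<Rightarrow> real"
    assume R: "R \<ge> R0" and E: "E \<in> sets lebesgue" "\<And>n. measure lebesgue (E \<inter> {real n..real n+1}) \<ge> \<sigma>"
      and near: "near_band W C0 R F h"
    define T where "T = (LINT y|lebesgue_on {R..R+1}. (h y)\<^sup>2)"
    define IF where "IF = (LINT x|lebesgue_on {0..}. (F x)\<^sup>2)"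
    define IE where "IE = (LINT x|lebesgue_on {0..}. indicator E x * (F x)\<^sup>2)"
    have T: "T \<ge> 0" "T \<le> IF" using near by (auto simp: T_def IF_def near_band_def)
    have R1: "R \<ge> 1" using R a by (simp add: R0_def)
    have "IF \<le> 4 * \<kappa> * IE +
     6 * \<kappa> * (2 * (norm W)\<^sup>2 * (((2 * pi) ^ (k + 1) / fact (k + 1))\<^sup>2 * T) + 2 * C0\<^sup>2 * T / R) +
     2 * \<kappa> * ((norm W)\<^sup>2 * (Q * T) / R\<^sup>2)"
      unfolding IF_def IE_def T_def \<kappa>_def Q_def
      by (rule modulated_estimate[OF \<sigma> R1 E near])
    also have "\<dots> = 4 * \<kappa> * IE + (12 * (norm W)\<^sup>2 * (\<kappa> * ((2 * pi) ^ (k + 1) / fact (k + 1))\<^sup>2)) * T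
        + (a1 / R + a2 / R\<^sup>2) * T"
      by (simp add: a1_def a2_def algebra_simps)
    also have "\<dots> \<le> 4 * \<kappa> * IE + 1 / 4 * T + 1 / 4 * T"
    proof -
      have "12 * (norm W)\<^sup>2 * (\<kappa> * ((2 * pi) ^ (k + 1) / fact (k + 1))\<^sup>2) * T \<le> 1 / 4 * T"
        using k T by (intro mult_right_mono) (auto simp: \<kappa>_def)
      moreover have "(a1 / R + a2 / R\<^sup>2) * T \<le> 1 / 4 * T"
      proof (rule mult_right_mono)
        have "R * 1 \<le> R\<^sup>2" unfolding power2_eq_square using R1 by (intro mult_left_mono) auto
        then have "a2 / R\<^sup>2 \<le> a2 / R" using a R1 by (intro divide_left_mono) auto
        then have "a1 / R + a2 / R\<^sup>2 \<le> (a1 + a2) / R" by (simp add: add_divide_distrib)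
        also have "\<dots> \<le> 1 / 4" using R R1 by (simp add: R0_def field_simps)
        finally show "a1 / R + a2 / R\<^sup>2 \<le> 1 / 4" .
      qed (use T in auto)
      ultimately show ?thesis by linarith
    qed
    also have "\<dots> \<le> 4 * \<kappa> * IE + 1 / 2 * IF" using T by simp
    finally show "(LINT x|lebesgue_on {0..}. (F x)\<^sup>2) \<le> 8 * \<kappa> * (LINT x|lebesgue_on {0..}. indicator E x * (F x)\<^sup>2)"
      by (simp add: IF_def IE_def)
  qed (use \<kappa> a in \<open>auto simp: R0_def\<close>)
qed

section \<open>Asymptotics of the modified Bessel function\<close>

definition bessel_coeff :: "real \<Rightarrow> nat \<Rightarrow> real" where
  "bessel_coeff \<alpha> n = Gamma (\<alpha> + 1) * ((-1) ^ n / (fact n * Gamma (real n + \<alpha> + 1))) / 4 ^ n"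

lemma bessel_coeff_Suc:
  assumes "\<alpha> > -1"
  shows "4 * (real n + 1) * (real n + \<alpha> + 1) * bessel_coeff \<alpha> (Suc n) = - bessel_coeff \<alpha> n"
proof -
  define z where "z = real n + \<alpha> + 1"
  have z: "z > 0" using assms by (simp add: z_def)
  have Gz1: "Gamma (z + 1) = z * Gamma z" using z by (intro Gamma_plus1) auto
  have Gz: "Gamma z > 0" using z by (rule Gamma_real_pos)
  have alg: "4 * m * z * (g * (- s / ((m * f) * (z * y))) / (4 * p)) = - (g * (s / (f * y)) / p)"
    if "m > 0" "f > 0" "y > 0" "p > 0" for m f y p g s :: real
    using that z by (simp add: field_simps)
  have "4 * (real n + 1) * z * (Gamma (\<alpha> + 1) * ((-1) ^ Suc n / (fact (Suc n) * Gamma (z + 1))) / 4 ^ Suc n)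
      = - (Gamma (\<alpha> + 1) * ((-1) ^ n / (fact n * Gamma z)) / 4 ^ n)"
  proof -
    have eqs: "fact (Suc n) = (real n + 1) * fact n" "(-1 :: real) ^ Suc n = - ((-1) ^ n)"
        "(4 :: real) ^ Suc n = 4 * 4 ^ n"
      by (simp_all add: algebra_simps)
    show ?thesis unfolding Gz1 eqs by (rule alg) (use Gz in auto)
  qed
  moreover have "real (Suc n) + \<alpha> + 1 = z + 1" by (simp add: z_def)
  ultimately show ?thesis unfolding bessel_coeff_def by (simp only: z_def[symmetric])
qed

lemma bessel_coeff_0: "\<alpha> > -1 \<Longrightarrow> bessel_coeff \<alpha> 0 = 1"
  using Gamma_real_pos[of "\<alpha> + 1"] by (simp add: bessel_coeff_def less_imp_neq[symmetric])

lemma summable_bessel_coeff: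
  assumes "\<alpha> > -1/2"
  shows "summable (\<lambda>n. bessel_coeff \<alpha> n * t ^ n)"
proof (rule summable_ratio_test[where c = "1/2" and N = "nat \<lceil>\<bar>t\<bar>\<rceil>"])
  fix n assume n: "nat \<lceil>\<bar>t\<bar>\<rceil> \<le> n"
  then have t: "\<bar>t\<bar> \<le> real n" by linarith
  define d where "d = 4 * (real n + 1) * (real n + \<alpha> + 1)"
  have d: "d \<ge> 2 * (real n + 1)"
  proof -
    have "4 * (real n + 1) * (1/2) \<le> 4 * (real n + 1) * (real n + \<alpha> + 1)"
      using assms by (intro mult_left_mono) auto
    then show ?thesis unfolding d_def by linarith
  qed
  have "0 < 2 * (real n + 1)" by simp
  then have dpos: "d > 0" using d by (rule less_le_trans)
  have "d * bessel_coeff \<alpha> (Suc n) = - bessel_coeff \<alpha> n"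
    unfolding d_def using assms by (intro bessel_coeff_Suc) simp
  then have "bessel_coeff \<alpha> (Suc n) = - bessel_coeff \<alpha> n / d"
    using dpos by (simp add: field_simps)
  then have "norm (bessel_coeff \<alpha> (Suc n) * t ^ Suc n) = \<bar>t\<bar> / d * norm (bessel_coeff \<alpha> n * t ^ n)"
    using dpos by (simp add: abs_mult)
  also have "\<dots> \<le> 1 / 2 * norm (bessel_coeff \<alpha> n * t ^ n)"
    using d dpos t by (intro mult_right_mono) (auto simp: field_simps)
  finally show "norm (bessel_coeff \<alpha> (Suc n) * t ^ Suc n) \<le> 1 / 2 * norm (bessel_coeff \<alpha> n * t ^ n)" .
qed simp

lemma bessel_j_power_series: "bessel_j \<alpha> x = (\<Sum>n. bessel_coeff \<alpha> n * (x\<^sup>2) ^ n)" if "\<alpha> > -1/2"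
proof -
  have eq: "bessel_coeff \<alpha> n * (x\<^sup>2) ^ n =
     Gamma (\<alpha> + 1) * ((-1) ^ n / (fact n * Gamma (real n + \<alpha> + 1)) * (x / 2) ^ (2 * n))" for n
  proof -
    have "(x / 2) ^ (2 * n) = (x\<^sup>2) ^ n / 4 ^ n"
      by (simp add: power_mult power_divide)
    then show ?thesis by (simp add: bessel_coeff_def)
  qed
  have "Gamma (\<alpha> + 1) \<noteq> 0" using that Gamma_real_pos[of "\<alpha> + 1"] by (simp add: less_imp_neq[symmetric])
  then have "summable (\<lambda>n. (-1) ^ n / (fact n * Gamma (real n + \<alpha> + 1)) * (x / 2) ^ (2 * n))"
    using summable_bessel_coeff[OF that, of "x\<^sup>2"] unfolding eq by (rule summable_mult_D[rotated])
  then show ?thesis unfolding bessel_j_def eq by (rule suminf_mult[symmetric])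
qed

text \<open>
  As a function of \<open>t = x\<^sup>2\<close> the series solves \<open>4 t \<phi>'' + 4 (\<alpha> + 1) \<phi>' + \<phi> = 0\<close>, which is the
  recursion of its coefficients.
\<close>

lemma bessel_j_ode:
  assumes \<alpha>: "\<alpha> > -1/2"
  obtains J1 J2 where
    "\<And>x. (bessel_j \<alpha> has_real_derivative J1 x) (at x)"
    "\<And>x. (J1 has_real_derivative J2 x) (at x)"
    "\<And>x. x * J2 x + (2 * \<alpha> + 1) * J1 x + x * bessel_j \<alpha> x = 0" "J1 0 = 0"
proof -
  define c where "c = bessel_coeff \<alpha>"
  define \<phi> where "\<phi> t = (\<Sum>n. c n * t ^ n)" for t
  define \<phi>1 where "\<phi>1 t = (\<Sum>n. diffs c n * t ^ n)" for t
  define \<phi>2 where "\<phi>2 t = (\<Sum>n. diffs (diffs c) n * t ^ n)" for t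
  have s0: "summable (\<lambda>n. c n * t ^ n)" for t unfolding c_def by (rule summable_bessel_coeff[OF \<alpha>])
  have s1: "summable (\<lambda>n. diffs c n * t ^ n)" for t by (rule termdiff_converges_all) (rule s0)
  have s2: "summable (\<lambda>n. diffs (diffs c) n * t ^ n)" for t by (rule termdiff_converges_all) (rule s1)
  have d0: "(\<phi> has_real_derivative \<phi>1 t) (at t)" for t
    unfolding \<phi>_def \<phi>1_def by (rule termdiffs_strong_converges_everywhere) (rule s0)
  have d1: "(\<phi>1 has_real_derivative \<phi>2 t) (at t)" for t
    unfolding \<phi>1_def \<phi>2_def by (rule termdiffs_strong_converges_everywhere) (rule s1)
  have ode: "4 * (t * \<phi>2 t) + 4 * (\<alpha> + 1) * \<phi>1 t + \<phi> t = 0" for t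
  proof -
    have "(\<lambda>n. t * (of_nat n * diffs c n * t ^ (n - Suc 0))) sums (t * \<phi>2 t)"
      unfolding \<phi>2_def by (intro sums_mult diffs_equiv s2)
    moreover have "t * (of_nat n * diffs c n * t ^ (n - Suc 0)) = of_nat n * diffs c n * t ^ n" for n
      by (cases n) auto
    ultimately have "(\<lambda>n. of_nat n * diffs c n * t ^ n) sums (t * \<phi>2 t)" by simp
    moreover have "(\<lambda>n. diffs c n * t ^ n) sums \<phi>1 t" unfolding \<phi>1_def using s1 by (rule summable_sums)
    moreover have "(\<lambda>n. c n * t ^ n) sums \<phi> t" unfolding \<phi>_def using s0 by (rule summable_sums)
    ultimately have "(\<lambda>n. 4 * (of_nat n * diffs c n * t ^ n) + 4 * (\<alpha> + 1) * (diffs c n * t ^ n) + c n * t ^ n)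
       sums (4 * (t * \<phi>2 t) + 4 * (\<alpha> + 1) * \<phi>1 t + \<phi> t)"
      by (intro sums_add sums_mult)
    moreover have "4 * (of_nat n * diffs c n * t ^ n) + 4 * (\<alpha> + 1) * (diffs c n * t ^ n) + c n * t ^ n = 0" for n
    proof -
      have "4 * (of_nat n * diffs c n * t ^ n) + 4 * (\<alpha> + 1) * (diffs c n * t ^ n) + c n * t ^ n
        = (4 * (real n + 1) * (real n + \<alpha> + 1) * c (Suc n) + c n) * t ^ n"
        by (simp add: diffs_def algebra_simps)
      then show ?thesis using bessel_coeff_Suc[of \<alpha> n] \<alpha> by (simp add: c_def)
    qed
    ultimately have "(\<lambda>n. 0) sums (4 * (t * \<phi>2 t) + 4 * (\<alpha> + 1) * \<phi>1 t + \<phi> t)" by simp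
    then show ?thesis using sums_zero sums_unique2 by blast
  qed
  have j: "bessel_j \<alpha> = (\<lambda>x. \<phi> (x\<^sup>2))"
    using bessel_j_power_series[OF \<alpha>] by (auto simp: \<phi>_def c_def)
  define J1 where "J1 x = 2 * x * \<phi>1 (x\<^sup>2)" for x
  define J2 where "J2 x = 2 * \<phi>1 (x\<^sup>2) + 4 * x\<^sup>2 * \<phi>2 (x\<^sup>2)" for x
  show ?thesis
  proof (rule that[of J1 J2])
    have sq: "((\<lambda>x. x\<^sup>2) has_real_derivative 2 * x) (at x)" for x :: real
      by (auto intro!: derivative_eq_intros)
    show "(bessel_j \<alpha> has_real_derivative J1 x) (at x)" for x
      unfolding j J1_def using DERIV_chain2[OF d0 sq] by (simp add: mult_ac)
    show "(J1 has_real_derivative J2 x) (at x)" for x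
    proof -
      have "((\<lambda>x. 2 * x) has_real_derivative 2) (at x)" by (auto intro!: derivative_eq_intros)
      from DERIV_mult[OF this DERIV_chain2[OF d1 sq]]
      have "((\<lambda>x. 2 * x * \<phi>1 (x\<^sup>2)) has_real_derivative 2 * \<phi>1 (x\<^sup>2) + \<phi>2 (x\<^sup>2) * (2 * x) * (2 * x)) (at x)" .
      moreover have "2 * \<phi>1 (x\<^sup>2) + \<phi>2 (x\<^sup>2) * (2 * x) * (2 * x) = J2 x"
        by (simp add: J2_def power2_eq_square)
      ultimately show ?thesis by (simp add: J1_def[abs_def])
    qed
    show "x * J2 x + (2 * \<alpha> + 1) * J1 x + x * bessel_j \<alpha> x = 0" for x
    proof -
      have "x * J2 x + (2 * \<alpha> + 1) * J1 x + x * bessel_j \<alpha> x =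
         x * (4 * (x\<^sup>2 * \<phi>2 (x\<^sup>2)) + 4 * (\<alpha> + 1) * \<phi>1 (x\<^sup>2) + \<phi> (x\<^sup>2))"
        unfolding j J1_def J2_def by (simp add: algebra_simps)
      then show ?thesis unfolding ode by simp
    qed
    show "J1 0 = 0" by (simp add: J1_def)
  qed
qed

lemma bessel_j_0: "\<alpha> > -1/2 \<Longrightarrow> bessel_j \<alpha> 0 = 1"
  using bessel_j_power_series[of \<alpha> 0] by (simp add: bessel_coeff_0)

lemma continuous_on_bessel_j:
  assumes "\<alpha> > -1/2" shows "continuous_on A (bessel_j \<alpha>)"
proof -
  obtain J1 where "\<And>x. (bessel_j \<alpha> has_real_derivative J1 x) (at x)"
    using bessel_j_ode[OF assms] by metis
  then show ?thesis by (meson DERIV_isCont continuous_at_imp_continuous_on)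
qed

text \<open>
  The energy \<open>j\<^sup>2 + j'\<^sup>2\<close> decreases on the half-line, since the first-order term of the
  equation is a damping, and it equals 1 at the origin.
\<close>

lemma abs_bessel_j_le_1:
  assumes \<alpha>: "\<alpha> > -1/2" and x: "x \<ge> 0"
  shows "\<bar>bessel_j \<alpha> x\<bar> \<le> 1"
proof -
  obtain J1 J2 where d0: "\<And>x. (bessel_j \<alpha> has_real_derivative J1 x) (at x)"
    and d1: "\<And>x. (J1 has_real_derivative J2 x) (at x)"
    and ode: "\<And>x. x * J2 x + (2 * \<alpha> + 1) * J1 x + x * bessel_j \<alpha> x = 0" and J0: "J1 0 = 0"
    using bessel_j_ode[OF \<alpha>] by metis
  define V where "V x = (bessel_j \<alpha> x)\<^sup>2 + (J1 x)\<^sup>2" for x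
  have dV: "(V has_real_derivative 2 * J1 y * (bessel_j \<alpha> y + J2 y)) (at y)" for y
    unfolding V_def by (auto intro!: derivative_eq_intros d0 d1 simp: algebra_simps)
  have "2 * J1 y * (bessel_j \<alpha> y + J2 y) \<le> 0" if "y \<ge> 0" for y
  proof (cases "y = 0")
    case True then show ?thesis by (simp add: J0)
  next
    case False
    then have eq: "bessel_j \<alpha> y + J2 y = - (2 * \<alpha> + 1) * J1 y / y" using ode[of y] that by (simp add: field_simps)
    have "2 * J1 y * (bessel_j \<alpha> y + J2 y) = - (2 * (2 * \<alpha> + 1) * (J1 y)\<^sup>2 / y)"
      unfolding eq using False by (simp add: power2_eq_square field_simps)
    also have "\<dots> \<le> 0" using that \<alpha> by simp
    finally show ?thesis .
  qed
  then have "V x \<le> V 0" using dV x by (intro DERIV_nonpos_imp_nonincreasing[OF x]) blast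
  also have "V 0 = 1" by (simp add: V_def J0 bessel_j_0[OF \<alpha>])
  finally have "(bessel_j \<alpha> x)\<^sup>2 \<le> 1" unfolding V_def using zero_le_power2[of "J1 x"] by linarith
  then show ?thesis by (simp add: abs_square_le_1)
qed

text \<open>
  The functions \<open>a - C / x\<close> and \<open>a + C / x\<close> are increasing and decreasing, respectively, and the former stays
  below the latter; \<open>l\<close> separates their values.
\<close>

lemma limit_of_inverse_square_derivative:
  fixes a a' :: "real \<Rightarrow> real"
  assumes a: "\<And>x. x \<ge> 1 \<Longrightarrow> (a has_real_derivative a' x) (at x)" "\<And>x. x \<ge> 1 \<Longrightarrow> \<bar>a' x\<bar> \<le> C / x\<^sup>2"
  shows "\<exists>l. \<forall>x\<ge>1. \<bar>a x - l\<bar> \<le> C / x"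
proof -
  have inv: "((\<lambda>x. C / x) has_real_derivative - (C / x\<^sup>2)) (at x)" if "x \<ge> 1" for x
    using that by (auto intro!: derivative_eq_intros simp: power2_eq_square)
  have C: "C \<ge> 0" using a(2)[of 1] by simp
  have dec: "a y + C / y \<le> a x + C / x" if "1 \<le> x" "x \<le> y" for x y
  proof (rule DERIV_nonpos_imp_nonincreasing[OF that(2)])
    fix t assume "x \<le> t" "t \<le> y"
    then have "1 \<le> t" using that by simp
    then have "((\<lambda>x. a x + C / x) has_real_derivative a' t + - (C / t\<^sup>2)) (at t)" "a' t + - (C / t\<^sup>2) \<le> 0"
      using a(2)[of t] DERIV_add[OF a(1) inv, of t] by auto
    then show "\<exists>d. ((\<lambda>x. a x + C / x) has_real_derivative d) (at t) \<and> d \<le> 0" by blast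
  qed
  have inc: "a x - C / x \<le> a y - C / y" if "1 \<le> x" "x \<le> y" for x y
  proof (rule DERIV_nonneg_imp_nondecreasing[OF that(2)])
    fix t assume "x \<le> t" "t \<le> y"
    then have "1 \<le> t" using that by simp
    then have "((\<lambda>x. a x - C / x) has_real_derivative a' t - - (C / t\<^sup>2)) (at t)" "a' t - - (C / t\<^sup>2) \<ge> 0"
      using a(2)[of t] DERIV_diff[OF a(1) inv, of t] by auto
    then show "\<exists>d. ((\<lambda>x. a x - C / x) has_real_derivative d) (at t) \<and> d \<ge> 0" by blast
  qed
  have cross: "a y - C / y \<le> a x + C / x" if "1 \<le> x" "1 \<le> y" for x y
  proof (cases "x \<le> y")
    case True
    have "a y - C / y \<le> a y + C / y" using C that by simp
    then show ?thesis using dec[of x y] True that by linarith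
  next
    case False
    have "a x - C / x \<le> a x + C / x" using C that by simp
    then show ?thesis using inc[of y x] False that by linarith
  qed
  define l where "l = (SUP y\<in>{1..}. a y - C / y)"
  have "\<bar>a x - l\<bar> \<le> C / x" if "x \<ge> 1" for x
  proof -
    have "bdd_above ((\<lambda>y. a y - C / y) ` {1..})"
      using cross[OF that] by (auto intro!: bdd_aboveI)
    then have "a x - C / x \<le> l" unfolding l_def using that by (intro cSUP_upper) auto
    moreover have "l \<le> a x + C / x" unfolding l_def
      using cross[OF that] by (intro cSUP_least) auto
    ultimately show ?thesis by linarith
  qed
  then show ?thesis by blast
qed

text \<open>
  The function \<open>u = x powr (\<alpha> + 1/2) * j\<close> solves \<open>u'' = (q / x\<^sup>2 - 1) u\<close>, a harmonic oscillator
  perturbed by an integrable potential, so its energy stays bounded on \<open>[1, \<infinity>)\<close>. Rotating the phase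
  vector \<open>(u, u')\<close> back by the angle \<open>x\<close> gives \<open>(a, b)\<close>, whose derivative is of order \<open>1 / x\<^sup>2\<close>. So it
  converges at the rate \<open>1 / x\<close>, and its limit is the amplitude \<open>W\<close>. On \<open>[0, 1]\<close> both terms are bounded.
\<close>

lemma bessel_j_asymptotics:
  assumes \<alpha>: "\<alpha> > -1/2"
  obtains W :: complex and C where "C > 0"
    "\<And>x. x \<ge> 0 \<Longrightarrow> \<bar>x powr (\<alpha> + 1/2) * bessel_j \<alpha> x - Re (W * cis x)\<bar> \<le> C / (1 + x)"
proof -
  obtain J1 J2 where d0: "\<And>x. (bessel_j \<alpha> has_real_derivative J1 x) (at x)"
    and d1: "\<And>x. (J1 has_real_derivative J2 x) (at x)"
    and ode: "\<And>x. x * J2 x + (2 * \<alpha> + 1) * J1 x + x * bessel_j \<alpha> x = 0"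
    using bessel_j_ode[OF \<alpha>] by metis
  define \<beta> where "\<beta> = \<alpha> + 1/2"
  have \<beta>: "\<beta> > 0" using \<alpha> by (simp add: \<beta>_def)
  define q where "q = \<beta> * (\<beta> - 1)"
  define u where "u x = x powr \<beta> * bessel_j \<alpha> x" for x
  define u1 where "u1 x = \<beta> * x powr (\<beta> - 1) * bessel_j \<alpha> x + x powr \<beta> * J1 x" for x
  have du: "(u has_real_derivative u1 x) (at x)" if "x > 0" for x
    unfolding u_def u1_def
    using DERIV_mult[OF has_real_derivative_powr[OF that, of \<beta>] d0[of x]] by (simp add: mult.commute)
  have du1: "(u1 has_real_derivative (q / x\<^sup>2 - 1) * u x) (at x)" if "x > 0" for x
  proof -
    have "(u1 has_real_derivative \<beta> * (\<beta> - 1) * x powr (\<beta> - 2) * bessel_j \<alpha> x + \<beta> * x powr (\<beta> - 1) * J1 x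
        + (\<beta> * x powr (\<beta> - 1) * J1 x + x powr \<beta> * J2 x)) (at x)"
      unfolding u1_def
      using DERIV_add[OF DERIV_mult[OF DERIV_cmult[OF has_real_derivative_powr[OF that, of "\<beta> - 1"], of \<beta>] d0[of x]]
          DERIV_mult[OF has_real_derivative_powr[OF that, of \<beta>] d1[of x]]]
      by (simp add: mult_ac)
    moreover have "\<beta> * (\<beta> - 1) * x powr (\<beta> - 2) * bessel_j \<alpha> x + \<beta> * x powr (\<beta> - 1) * J1 x
        + (\<beta> * x powr (\<beta> - 1) * J1 x + x powr \<beta> * J2 x) = (q / x\<^sup>2 - 1) * u x"
    proof -
      have p: "x powr (\<beta> - 2) = x powr \<beta> / x\<^sup>2" "x powr (\<beta> - 1) = x powr \<beta> / x"
        using that by (simp_all add: powr_diff)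
      have J2: "J2 x = - (2 * \<beta>) * J1 x / x - bessel_j \<alpha> x"
        using ode[of x] that by (simp add: \<beta>_def field_simps)
      show ?thesis unfolding p J2 u_def q_def using that by (simp add: field_simps)
    qed
    ultimately show ?thesis by simp
  qed
  \<comment> \<open>The factor \<open>exp (\<bar>q\<bar> / x)\<close> compensates the energy that the potential can supply.\<close>
  define V where "V x = ((u x)\<^sup>2 + (u1 x)\<^sup>2) * exp (\<bar>q\<bar> / x)" for x
  have V: "V x \<le> V 1" if "x \<ge> 1" for x
  proof (rule DERIV_nonpos_imp_nonincreasing[OF that])
    fix t :: real assume t: "1 \<le> t" "t \<le> x"
    define d where "d = (2 * u t * u1 t + 2 * u1 t * ((q / t\<^sup>2 - 1) * u t)) * exp (\<bar>q\<bar> / t)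
       + ((u t)\<^sup>2 + (u1 t)\<^sup>2) * (exp (\<bar>q\<bar> / t) * (- (\<bar>q\<bar> / t\<^sup>2)))"
    have i: "((\<lambda>x. \<bar>q\<bar> / x) has_real_derivative - (\<bar>q\<bar> / t\<^sup>2)) (at t)"
      using t by (auto intro!: derivative_eq_intros simp: power2_eq_square)
    have "(V has_real_derivative d) (at t)"
      unfolding V_def d_def using t
      by (auto intro!: derivative_eq_intros du du1 i simp: algebra_simps add_divide_distrib power2_eq_square)
    moreover have "d \<le> 0"
    proof -
      have "2 * (u t * u1 t) * q \<le> ((u t)\<^sup>2 + (u1 t)\<^sup>2) * \<bar>q\<bar>"
      proof -
        have "2 * (u t * u1 t) * q \<le> 2 * (\<bar>u t\<bar> * \<bar>u1 t\<bar>) * \<bar>q\<bar>"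
          by (metis abs_ge_self abs_mult abs_numeral)
        also have "\<dots> \<le> ((u t)\<^sup>2 + (u1 t)\<^sup>2) * \<bar>q\<bar>"
          using sum_squares_bound[of "\<bar>u t\<bar>" "\<bar>u1 t\<bar>"] by (intro mult_right_mono) auto
        finally show ?thesis .
      qed
      then have "2 * (u t * u1 t) * q / t\<^sup>2 - ((u t)\<^sup>2 + (u1 t)\<^sup>2) * \<bar>q\<bar> / t\<^sup>2 \<le> 0"
        by (simp add: divide_right_mono)
      then have "(2 * (u t * u1 t) * q / t\<^sup>2 - ((u t)\<^sup>2 + (u1 t)\<^sup>2) * \<bar>q\<bar> / t\<^sup>2) * exp (\<bar>q\<bar> / t) \<le> 0"
        by (intro mult_nonpos_nonneg) auto
      also have "(2 * (u t * u1 t) * q / t\<^sup>2 - ((u t)\<^sup>2 + (u1 t)\<^sup>2) * \<bar>q\<bar> / t\<^sup>2) * exp (\<bar>q\<bar> / t) = d"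
        by (simp add: d_def algebra_simps)
      finally show ?thesis .
    qed
    ultimately show "\<exists>d. (V has_real_derivative d) (at t) \<and> d \<le> 0" by blast
  qed
  define C1 where "C1 = sqrt (V 1)"
  have u_bound: "\<bar>u x\<bar> \<le> C1" if "x \<ge> 1" for x
  proof -
    have "(u x)\<^sup>2 \<le> ((u x)\<^sup>2 + (u1 x)\<^sup>2) * 1" by simp
    also have "\<dots> \<le> V x" unfolding V_def using that by (intro mult_left_mono) auto
    also have "\<dots> \<le> V 1" by (rule V[OF that])
    finally show ?thesis unfolding C1_def by (rule real_le_rsqrt[of "\<bar>u x\<bar>", simplified])
  qed
  define a where "a x = u x * cos x - u1 x * sin x" for x
  define b where "b x = u x * sin x + u1 x * cos x" for x
  have da: "(a has_real_derivative - (q / x\<^sup>2 * u x * sin x)) (at x)"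
   and db: "(b has_real_derivative q / x\<^sup>2 * u x * cos x) (at x)" if "x \<ge> 1" for x
    unfolding a_def b_def using that
    by (auto intro!: derivative_eq_intros du du1 simp: algebra_simps)
  have bnd: "\<bar>q / x\<^sup>2 * u x * v\<bar> \<le> (\<bar>q\<bar> * C1) / x\<^sup>2" if "x \<ge> 1" "\<bar>v\<bar> \<le> 1" for x v
  proof -
    have "\<bar>u x\<bar> * \<bar>v\<bar> \<le> C1 * 1" using u_bound[OF that(1)] that by (intro mult_mono) auto
    then have "\<bar>q\<bar> / x\<^sup>2 * (\<bar>u x\<bar> * \<bar>v\<bar>) \<le> \<bar>q\<bar> / x\<^sup>2 * (C1 * 1)" by (intro mult_left_mono) auto
    then show ?thesis by (simp add: abs_mult mult.assoc)
  qed
  define C2 where "C2 = \<bar>q\<bar> * C1"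
  have "\<exists>l. \<forall>x\<ge>1. \<bar>a x - l\<bar> \<le> C2 / x"
  proof (rule limit_of_inverse_square_derivative[OF da])
    show "\<bar>- (q / x\<^sup>2 * u x * sin x)\<bar> \<le> C2 / x\<^sup>2" if "x \<ge> 1" for x
      unfolding abs_minus_cancel C2_def by (rule bnd[OF that]) auto
  qed
  then obtain la where la: "\<And>x. x \<ge> 1 \<Longrightarrow> \<bar>a x - la\<bar> \<le> C2 / x" by blast
  have "\<exists>l. \<forall>x\<ge>1. \<bar>b x - l\<bar> \<le> C2 / x"
  proof (rule limit_of_inverse_square_derivative[OF db])
    show "\<bar>q / x\<^sup>2 * u x * cos x\<bar> \<le> C2 / x\<^sup>2" if "x \<ge> 1" for x
      unfolding C2_def by (rule bnd[OF that]) auto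
  qed
  then obtain lb where lb: "\<And>x. x \<ge> 1 \<Longrightarrow> \<bar>b x - lb\<bar> \<le> C2 / x" by blast
  have C2: "C2 \<ge> 0" using la[of 1] by simp
  define W where "W = Complex la (- lb)"
  define C where "C = 2 * (1 + norm W) + 4 * C2"
  have ReW: "Re (W * cis x) = la * cos x + lb * sin x" for x by (simp add: W_def)
  show ?thesis
  proof (rule that[of C W])
    show "C > 0" using C2 unfolding C_def by (simp add: add_pos_nonneg)
    fix x :: real assume x: "x \<ge> 0"
    have "\<bar>u x - Re (W * cis x)\<bar> \<le> C / (1 + x)"
    proof (cases "x \<ge> 1")
      case True
      have "a x * cos x + b x * sin x = u x * ((cos x)\<^sup>2 + (sin x)\<^sup>2)"
        unfolding a_def b_def power2_eq_square by algebra
      then have "u x = a x * cos x + b x * sin x" by simp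
      then have "u x - Re (W * cis x) = (a x - la) * cos x + (b x - lb) * sin x"
        unfolding ReW by (simp add: algebra_simps)
      also have "\<bar>\<dots>\<bar> \<le> \<bar>a x - la\<bar> * \<bar>cos x\<bar> + \<bar>b x - lb\<bar> * \<bar>sin x\<bar>"
        unfolding abs_mult[symmetric] by (rule abs_triangle_ineq)
      also have "\<dots> \<le> C2 / x * 1 + C2 / x * 1"
        using la[OF True] lb[OF True] C2 x by (intro add_mono mult_mono) auto
      also have "\<dots> = 4 * C2 / (x + x)" using True by (simp add: field_simps)
      also have "\<dots> \<le> 4 * C2 / (1 + x)" using True C2 by (intro divide_left_mono) auto
      also have "\<dots> \<le> C / (1 + x)" using x by (intro divide_right_mono) (auto simp: C_def)
      finally show ?thesis .
    next
      case False
      have "\<bar>u x\<bar> = x powr \<beta> * \<bar>bessel_j \<alpha> x\<bar>" by (simp add: u_def abs_mult)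
      also have "\<dots> \<le> 1 * 1" using abs_bessel_j_le_1[OF \<alpha> x] False x \<beta>
        by (intro mult_mono) (auto intro: powr_le1)
      finally have "\<bar>u x\<bar> \<le> 1" by simp
      moreover have "\<bar>Re (W * cis x)\<bar> \<le> norm W" using abs_Re_le_cmod[of "W * cis x"] by (simp add: norm_mult)
      ultimately have "\<bar>u x - Re (W * cis x)\<bar> \<le> 1 + norm W" by linarith
      also have "\<dots> = 2 * (1 + norm W) / 2" by simp
      also have "\<dots> \<le> C / (1 + x)"
        unfolding C_def using False x C2 by (intro frac_le) auto
      finally show ?thesis .
    qed
    then show "\<bar>x powr (\<alpha> + 1/2) * bessel_j \<alpha> x - Re (W * cis x)\<bar> \<le> C / (1 + x)"
      by (simp add: u_def \<beta>_def)
  qed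
qed

section \<open>Square-integrable functions on the half-line\<close>

lemma sigma_finite_lebesgue: "sigma_finite_measure (lebesgue :: real measure)"
proof -
  obtain A :: "real set set" where A: "countable A" "A \<subseteq> sets lborel" "\<Union>A = space lborel" "\<forall>a\<in>A. emeasure lborel a \<noteq> \<infinity>"
    using lborel.sigma_finite_countable by blast
  then show ?thesis
    by (intro sigma_finite_measure.intro exI[of _ A]) (auto simp: emeasure_completion)
qed

lemma integrable_mult_of_squares:
  fixes f g :: "'a \<Rightarrow> real"
  assumes "f \<in> borel_measurable M" "g \<in> borel_measurable M"
    and "integrable M (\<lambda>x. (f x)\<^sup>2)" "integrable M (\<lambda>x. (g x)\<^sup>2)"
  shows "integrable M (\<lambda>x. f x * g x)"
proof (rule Bochner_Integration.integrable_bound)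
  show "integrable M (\<lambda>x. (f x)\<^sup>2 + (g x)\<^sup>2)" using assms by simp
  show "AE x in M. norm (f x * g x) \<le> norm ((f x)\<^sup>2 + (g x)\<^sup>2)"
  proof (rule AE_I2)
    fix x
    have "2 * (\<bar>f x\<bar> * \<bar>g x\<bar>) \<le> (f x)\<^sup>2 + (g x)\<^sup>2"
      using sum_squares_bound[of "\<bar>f x\<bar>" "\<bar>g x\<bar>"] by (simp add: mult.assoc)
    moreover have "0 \<le> \<bar>f x\<bar> * \<bar>g x\<bar>" by simp
    ultimately show "norm (f x * g x) \<le> norm ((f x)\<^sup>2 + (g x)\<^sup>2)"
      unfolding real_norm_def abs_mult by linarith
  qed
qed (use assms in simp)

lemma cauchy_schwarz_integral:
  fixes f g :: "'a \<Rightarrow> real"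
  assumes "f \<in> borel_measurable M" "g \<in> borel_measurable M"
    and "integrable M (\<lambda>x. (f x)\<^sup>2)" "integrable M (\<lambda>x. (g x)\<^sup>2)"
  shows "\<bar>LINT x|M. f x * g x\<bar> \<le> sqrt (LINT x|M. (f x)\<^sup>2) * sqrt (LINT x|M. (g x)\<^sup>2)"
proof -
  define a where "a = (LINT x|M. (f x)\<^sup>2)"
  define b where "b = (LINT x|M. (g x)\<^sup>2)"
  define c where "c = (LINT x|M. f x * g x)"
  have fg: "integrable M (\<lambda>x. f x * g x)" by (rule integrable_mult_of_squares) (fact assms)+
  have q: "0 \<le> a - 2 * t * c + t\<^sup>2 * b" for t
  proof -
    have "0 \<le> (LINT x|M. (f x - t * g x)\<^sup>2)" by simp
    also have "\<dots> = (LINT x|M. (f x)\<^sup>2 - 2 * t * (f x * g x) + t\<^sup>2 * (g x)\<^sup>2)"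
      by (intro Bochner_Integration.integral_cong refl) (simp add: power2_eq_square algebra_simps)
    also have "\<dots> = a - 2 * t * c + t\<^sup>2 * b"
      using assms fg by (simp add: a_def b_def c_def)
    finally show ?thesis .
  qed
  have a: "a \<ge> 0" and b: "b \<ge> 0" by (simp_all add: a_def b_def)
  have "c\<^sup>2 \<le> a * b"
  proof (cases "b = 0")
    case True
    have "c = 0"
    proof (rule ccontr)
      assume "c \<noteq> 0"
      then show False using q[of "(a + 1) / (2 * c)"] True by (simp add: field_simps)
    qed
    then show ?thesis using True by simp
  next
    case False
    then have "b > 0" using b by simp
    then show ?thesis using q[of "c / b"] by (simp add: field_simps power2_eq_square)
  qed
  then have "\<bar>c\<bar> \<le> sqrt (a * b)" by (intro real_le_rsqrt) simp
  then show ?thesis by (simp add: a_def b_def c_def real_sqrt_mult)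
qed

lemma integrable_square_diff:
  fixes f g :: "'a \<Rightarrow> real"
  assumes "f \<in> borel_measurable M" "g \<in> borel_measurable M"
    and "integrable M (\<lambda>x. (f x)\<^sup>2)" "integrable M (\<lambda>x. (g x)\<^sup>2)"
  shows "integrable M (\<lambda>x. (f x - g x)\<^sup>2)"
proof -
  have "integrable M (\<lambda>x. (f x)\<^sup>2 - 2 * (f x * g x) + (g x)\<^sup>2)"
    using assms integrable_mult_of_squares[OF assms] by simp
  then show ?thesis by (simp add: power2_eq_square algebra_simps)
qed

lemma tendsto_integral_mult_of_L2:
  fixes u :: "nat \<Rightarrow> 'a \<Rightarrow> real"
  assumes "\<And>n. u n \<in> borel_measurable M" "\<And>n. integrable M (\<lambda>x. (u n x)\<^sup>2)"
    and f: "f \<in> borel_measurable M" "integrable M (\<lambda>x. (f x)\<^sup>2)"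
    and g: "g \<in> borel_measurable M" "integrable M (\<lambda>x. (g x)\<^sup>2)"
    and lim: "(\<lambda>n. sqrt (LINT x|M. (u n x - f x)\<^sup>2)) \<longlonglongrightarrow> 0"
  shows "(\<lambda>n. LINT x|M. u n x * g x) \<longlonglongrightarrow> (LINT x|M. f x * g x)"
proof (rule LIM_zero_cancel, rule Lim_null_comparison)
  show "(\<lambda>n. sqrt (LINT x|M. (u n x - f x)\<^sup>2) * sqrt (LINT x|M. (g x)\<^sup>2)) \<longlonglongrightarrow> 0"
    using lim by (rule tendsto_mult_left_zero)
  show "\<forall>\<^sub>F n in sequentially. norm ((LINT x|M. u n x * g x) - (LINT x|M. f x * g x))
      \<le> sqrt (LINT x|M. (u n x - f x)\<^sup>2) * sqrt (LINT x|M. (g x)\<^sup>2)"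
  proof (rule always_eventually, rule allI)
    fix n
    have "(LINT x|M. u n x * g x) - (LINT x|M. f x * g x) = (LINT x|M. (u n x - f x) * g x)"
      using integrable_mult_of_squares[of "u n" M g] integrable_mult_of_squares[of f M g] assms
      by (simp add: left_diff_distrib)
    also have "\<bar>\<dots>\<bar> \<le> sqrt (LINT x|M. (u n x - f x)\<^sup>2) * sqrt (LINT x|M. (g x)\<^sup>2)"
      using assms by (intro cauchy_schwarz_integral integrable_square_diff borel_measurable_diff) auto
    finally show "norm ((LINT x|M. u n x * g x) - (LINT x|M. f x * g x))
      \<le> sqrt (LINT x|M. (u n x - f x)\<^sup>2) * sqrt (LINT x|M. (g x)\<^sup>2)" by simp
  qed
qed

text \<open>
  The parameter is normalised such that the transform exchanges \<open>t\<close> and \<open>1 / t\<close>, up to a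
  constant factor.
\<close>

definition gauss :: "real \<Rightarrow> real \<Rightarrow> real" where
  "gauss t x = exp (- (pi * t * x\<^sup>2))"

lemma gauss_square: "(gauss t x)\<^sup>2 = gauss (2 * t) x"
  by (simp add: gauss_def power2_eq_square exp_add[symmetric])

lemma has_integral_Ici_iff_Ioi:
  fixes f :: "real \<Rightarrow> real"
  shows "(f has_integral y) {0..} \<longleftrightarrow> (f has_integral y) {0<..}"
  by (rule has_integral_spike_set_eq) (auto intro: negligible_subset[of "{0}"])

lemma has_integral_power_gauss:
  assumes s: "s > 1/2" and t: "t > 0"
  shows "((\<lambda>x. x powr (2 * s - 1) * gauss t x) has_integral Gamma s / (2 * (pi * t) powr s)) {0..}"
proof -
  define f where "f v = v powr (s - 1) / exp v" for v :: real
  define g where "g x = pi * t * x\<^sup>2" for x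
  have "(f has_integral Gamma s) {0..}" unfolding f_def using s by (intro Gamma_integral_real) simp
  then have fI: "(f has_integral Gamma s) {0<..}"
    by (simp only: has_integral_Ici_iff_Ioi)
  have "f absolutely_integrable_on {0<..}"
    by (rule nonnegative_absolutely_integrable_1) (use fI in \<open>auto simp: f_def\<close>)
  moreover have "g ` {0<..} = {0<..}"
  proof
    show "{0<..} \<subseteq> g ` {0<..}"
    proof
      fix v :: real assume v: "v \<in> {0<..}"
      have "g (sqrt (v / (pi * t))) = v" using v t by (simp add: g_def)
      moreover have "sqrt (v / (pi * t)) > 0" using v t by simp
      ultimately show "v \<in> g ` {0<..}" by (metis greaterThan_iff imageI)
    qed
  qed (use t in \<open>auto simp: g_def\<close>)
  ultimately have "f absolutely_integrable_on g ` {0<..} \<and> integral (g ` {0<..}) f = Gamma s"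
    using fI by (simp add: integral_unique)
  moreover have "(g has_field_derivative 2 * pi * t * x) (at x within {0<..})" for x
    unfolding g_def by (auto intro!: derivative_eq_intros)
  moreover have "inj_on g {0<..}" using t by (auto simp: inj_on_def g_def)
  ultimately have *: "(\<lambda>x. \<bar>2 * pi * t * x\<bar> * f (g x)) absolutely_integrable_on {0<..} \<and>
     integral {0<..} (\<lambda>x. \<bar>2 * pi * t * x\<bar> * f (g x)) = Gamma s"
    using has_absolute_integral_change_of_variables_1'[of "{0<..}" g "\<lambda>x. 2 * pi * t * x" f "Gamma s"] by simp
  then have "((\<lambda>x. \<bar>2 * pi * t * x\<bar> * f (g x)) has_integral Gamma s) {0<..}"
    by (metis absolutely_integrable_on_def has_integral_integral)
  then have "((\<lambda>x. (2 * (pi * t) powr s) * (x powr (2 * s - 1) * gauss t x)) has_integral Gamma s) {0<..}"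
  proof (rule has_integral_eq[rotated])
    fix x :: real assume "x \<in> {0<..}"
    then have x: "x > 0" by simp
    have "(pi * t * x\<^sup>2) powr (s - 1) = (pi * t) powr (s - 1) * x powr (2 * (s - 1))"
      using x t by (simp add: powr_mult powr_powr flip: powr_numeral)
    moreover have "(pi * t) powr s = (pi * t) * (pi * t) powr (s - 1)"
      using t by (simp add: powr_mult_base)
    moreover have "x powr (2 * s - 1) = x * x powr (2 * (s - 1))"
      using x by (simp add: powr_mult_base algebra_simps)
    ultimately show "\<bar>2 * pi * t * x\<bar> * f (g x) = (2 * (pi * t) powr s) * (x powr (2 * s - 1) * gauss t x)"
      using x t by (simp add: f_def g_def gauss_def exp_minus divide_inverse)
  qed
  then have "((\<lambda>x. (2 * (pi * t) powr s) * (x powr (2 * s - 1) * gauss t x)) has_integral Gamma s) {0..}"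
    by (simp only: has_integral_Ici_iff_Ioi)
  from has_integral_mult_right[OF this, of "1 / (2 * (pi * t) powr s)"] show ?thesis
    using t by simp
qed

text \<open>
  The positive and the negative part of a Borel version of \<open>k\<close> are densities of two finite measures
  that agree on all rays \<open>{r<..}\<close>, hence everywhere.
\<close>

lemma AE_zero_of_tail_integrals:
  fixes k :: "real \<Rightarrow> real"
  assumes k: "integrable lebesgue k" and tails: "\<And>r. (LINT x|lebesgue. indicator {r<..} x * k x) = 0"
  shows "AE x in lebesgue. k x = 0"
proof -
  obtain k' where k': "k' \<in> borel_measurable lborel" and eq: "AE x in lborel. k x = k' x"
    using completion_ex_borel_measurable_real[of k lborel] borel_measurable_integrable[OF k] by blast
  have eq': "AE x in lebesgue. k x = k' x" using eq by (rule AE_completion)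
  have k'm: "k' \<in> borel_measurable lebesgue" using k' by (rule measurable_completion)
  have "integrable lebesgue k'"
    using integrable_cong_AE[OF borel_measurable_integrable[OF k] k'm eq'] k by simp
  then have k'int: "integrable lborel k'" using integrable_completion[OF k'] by simp
  have ind_int: "integrable lborel (\<lambda>x. indicator {r<..} x * k' x)" for r :: real
    using integrable_mult_indicator[OF _ k'int, of "{r<..}"] by simp
  have tails': "(LINT x|lborel. indicator {r<..} x * k' x) = 0" for r :: real
  proof -
    have m: "(\<lambda>x. indicator {r<..} x * k' x) \<in> borel_measurable lborel" using ind_int by simp
    have "(LINT x|lborel. indicator {r<..} x * k' x) = (LINT x|lebesgue. indicator {r<..} x * k' x)"
      by (rule integral_completion[OF m, symmetric])
    also have "\<dots> = (LINT x|lebesgue. indicator {r<..} x * k x)"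
    proof (rule integral_cong_AE)
      have i: "indicator {r<..} \<in> borel_measurable lebesgue" by (intro borel_measurable_indicator) simp
      show "(\<lambda>x. indicator {r<..} x * k' x) \<in> borel_measurable lebesgue"
        using i k'm by (rule borel_measurable_times)
      show "(\<lambda>x. indicator {r<..} x * k x) \<in> borel_measurable lebesgue"
        using i borel_measurable_integrable[OF k] by (rule borel_measurable_times)
      show "AE x in lebesgue. indicator {r<..} x * k' x = indicator {r<..} x * k x"
        using eq' by eventually_elim simp
    qed
    finally show ?thesis using tails by simp
  qed
  define p where "p x = max 0 (k' x)" for x
  define q where "q x = max 0 (- k' x)" for x
  have pq: "k' x = p x - q x" for x by (simp add: p_def q_def)
  have pm: "p \<in> borel_measurable lborel" and qm: "q \<in> borel_measurable lborel"
    unfolding p_def q_def using k' by measurable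
  have pint: "integrable lborel p" and qint: "integrable lborel q"
    unfolding p_def q_def using k'int by (auto intro!: integrable_max)
  have pind: "integrable lborel (\<lambda>x. indicator {r<..} x * p x)"
    and qind: "integrable lborel (\<lambda>x. indicator {r<..} x * q x)" for r :: real
    using integrable_mult_indicator[OF _ pint, of "{r<..}"] integrable_mult_indicator[OF _ qint, of "{r<..}"]
    by simp_all
  have em: "emeasure (density lborel (\<lambda>x. ennreal (u x))) {r<..} = ennreal (LINT x|lborel. indicator {r<..} x * u x)"
    if "u \<in> borel_measurable lborel" "\<And>x. u x \<ge> 0" "integrable lborel (\<lambda>x. indicator {r<..} x * u x)"
    for u and r :: real
  proof -
    have "emeasure (density lborel (\<lambda>x. ennreal (u x))) {r<..} = (\<integral>\<^sup>+ x. ennreal (u x) * indicator {r<..} x \<partial>lborel)"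
      using that by (subst emeasure_density) auto
    also have "\<dots> = (\<integral>\<^sup>+ x. ennreal (indicator {r<..} x * u x) \<partial>lborel)"
      by (intro nn_integral_cong) (auto split: split_indicator)
    also have "\<dots> = ennreal (LINT x|lborel. indicator {r<..} x * u x)"
      using that by (intro nn_integral_eq_integral) (auto intro!: AE_I2 mult_nonneg_nonneg)
    finally show ?thesis .
  qed
  have "density lborel (\<lambda>x. ennreal (p x)) = density lborel (\<lambda>x. ennreal (q x))"
  proof (rule measure_eqI_lessThan)
    fix r :: real
    have P: "emeasure (density lborel (\<lambda>x. ennreal (p x))) {r<..} = ennreal (LINT x|lborel. indicator {r<..} x * p x)"
      by (rule em[OF pm _ pind]) (simp add: p_def)
    have Q: "emeasure (density lborel (\<lambda>x. ennreal (q x))) {r<..} = ennreal (LINT x|lborel. indicator {r<..} x * q x)"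
      by (rule em[OF qm _ qind]) (simp add: q_def)
    show "emeasure (density lborel (\<lambda>x. ennreal (p x))) {r<..} < \<infinity>" unfolding P by simp
    have "(LINT x|lborel. indicator {r<..} x * p x) - (LINT x|lborel. indicator {r<..} x * q x) =
       (LINT x|lborel. indicator {r<..} x * k' x)"
      unfolding pq right_diff_distrib using pind qind by simp
    then show "emeasure (density lborel (\<lambda>x. ennreal (p x))) {r<..} = emeasure (density lborel (\<lambda>x. ennreal (q x))) {r<..}"
      unfolding P Q using tails'[of r] by simp
  qed auto
  then have "AE x in lborel. ennreal (p x) = ennreal (q x)"
    using sigma_finite_measure.density_unique_iff[OF sigma_finite_lborel, of "\<lambda>x. ennreal (p x)" "\<lambda>x. ennreal (q x)"]
      pm qm by simp
  then have "AE x in lborel. k' x = 0"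
  proof eventually_elim
    case (elim x)
    then have "p x = q x" by (subst (asm) ennreal_inj) (auto simp: p_def q_def)
    then show ?case by (simp add: pq)
  qed
  then have "AE x in lebesgue. k' x = 0" by (rule AE_completion)
  with eq' show ?thesis by eventually_elim simp
qed

lemma integrable_mult_bounded_real:
  fixes h d :: "'a \<Rightarrow> real"
  assumes h: "integrable M h" and d: "d \<in> borel_measurable M"
    and b: "\<And>y. y \<in> space M \<Longrightarrow> \<bar>d y\<bar> \<le> B"
  shows "integrable M (\<lambda>y. h y * d y)"
proof -
  have "integrable M (\<lambda>y. Re (of_real (h y) * of_real (d y)))"
    by (intro integrable_Re integrable_mult_bounded[OF h, where B = B]) (use d b in auto)
  then show ?thesis by simp
qed

lemma integral_restrict_support:
  fixes u :: "real \<Rightarrow> real"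
  assumes u: "u \<in> borel_measurable (lebesgue_on {0..})" and S: "S \<in> sets lebesgue" "S \<subseteq> {0..}"
    and zero: "AE x in lebesgue_on {0..}. x \<notin> S \<longrightarrow> u x = 0"
  shows "(LINT x|lebesgue_on {0..}. u x) = (LINT x|lebesgue_on S. u x)"
    and "integrable (lebesgue_on {0..}) u \<Longrightarrow> integrable (lebesgue_on S) u"
proof -
  have "(LINT x|lebesgue_on {0..}. u x) = (LINT x|lebesgue_on {0..}. indicator S x * u x)"
  proof (rule integral_cong_AE[OF u])
    show "(\<lambda>x. indicator S x * u x) \<in> borel_measurable (lebesgue_on {0..})"
      by (rule borel_measurable_times[OF measurable_restrict_space1[OF borel_measurable_indicator] u]) (rule S)
    show "AE x in lebesgue_on {0..}. u x = indicator S x * u x"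
      using zero by eventually_elim (auto split: split_indicator)
  qed
  also have "\<dots> = (LINT x|lebesgue. indicator {0..} x *\<^sub>R (indicator S x * u x))"
    by (subst integral_restrict_space) auto
  also have "\<dots> = (LINT x|lebesgue. indicator S x *\<^sub>R u x)"
    using S by (intro Bochner_Integration.integral_cong) (auto split: split_indicator)
  also have "\<dots> = (LINT x|lebesgue_on S. u x)" using S by (subst integral_restrict_space) auto
  finally show "(LINT x|lebesgue_on {0..}. u x) = (LINT x|lebesgue_on S. u x)" .
  assume "integrable (lebesgue_on {0..}) u"
  then have "set_integrable lebesgue {0..} u" by (simp add: set_integrable_def integrable_restrict_space)
  then have "set_integrable lebesgue S u" by (rule set_integrable_subset) (use S in auto)
  then show "integrable (lebesgue_on S) u" using S by (simp add: set_integrable_def integrable_restrict_space)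
qed

lemma square_integral_mult_le:
  fixes h d :: "real \<Rightarrow> real" and R :: real
  defines "N \<equiv> lebesgue_on {R..R+1}"
  assumes h: "h \<in> borel_measurable N" "integrable N (\<lambda>y. (h y)\<^sup>2)"
    and d: "d \<in> borel_measurable N" "\<And>y. y \<in> {R..R+1} \<Longrightarrow> \<bar>d y\<bar> \<le> b"
  shows "(LINT y|N. h y * d y)\<^sup>2 \<le> b\<^sup>2 * (LINT y|N. (h y)\<^sup>2)"
proof -
  interpret finite_measure N unfolding N_def by (rule finite_measure_lebesgue_on_Icc)
  have spN: "space N = {R..R+1}" by (simp add: N_def)
  have d2: "(d y)\<^sup>2 \<le> b\<^sup>2" if "y \<in> space N" for y
    using d(2)[of y] that by (simp add: spN abs_le_square_iff[symmetric])
  have dint: "integrable N (\<lambda>y. (d y)\<^sup>2)"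
    by (rule integrable_const_bound[of _ "b\<^sup>2"]) (use d d2 in \<open>auto intro!: AE_I2 borel_measurable_power\<close>)
  have "(LINT y|N. (d y)\<^sup>2) \<le> (LINT y|N. b\<^sup>2)" by (intro integral_mono dint d2) auto
  also have "\<dots> = b\<^sup>2" by (simp add: N_def measure_restrict_space)
  finally have D: "(LINT y|N. (d y)\<^sup>2) \<le> b\<^sup>2" .
  have "\<bar>LINT y|N. h y * d y\<bar> \<le> sqrt (LINT y|N. (h y)\<^sup>2) * sqrt (LINT y|N. (d y)\<^sup>2)"
    by (rule cauchy_schwarz_integral[OF h(1) d(1) h(2) dint])
  then have "\<bar>LINT y|N. h y * d y\<bar>\<^sup>2 \<le> (sqrt (LINT y|N. (h y)\<^sup>2) * sqrt (LINT y|N. (d y)\<^sup>2))\<^sup>2"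
    by (intro power_mono) auto
  also have "\<dots> = (LINT y|N. (h y)\<^sup>2) * (LINT y|N. (d y)\<^sup>2)" by (simp add: power_mult_distrib)
  also have "\<dots> \<le> (LINT y|N. (h y)\<^sup>2) * b\<^sup>2" using D by (intro mult_left_mono) auto
  finally show ?thesis by (simp add: mult.commute)
qed

section \<open>The weighted measure\<close>

definition bessel_weight :: "real \<Rightarrow> real \<Rightarrow> real" where
  "bessel_weight \<alpha> x = 2 * pi powr (\<alpha> + 1) / Gamma (\<alpha> + 1) * x powr (2 * \<alpha> + 1)"

context
  fixes \<alpha> :: real
  assumes \<alpha>: "-1/2 < \<alpha>"
begin

abbreviation \<mu> :: "real measure" where "\<mu> \<equiv> bessel_measure \<alpha>"
abbreviation w :: "real \<Rightarrow> real" where "w \<equiv> bessel_weight \<alpha>"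
abbreviation \<F> :: "(real \<Rightarrow> real) \<Rightarrow> real \<Rightarrow> real" where "\<F> \<equiv> fourier_bessel_integral \<alpha>"

lemma bessel_measure_eq:
  "\<mu> = density (lebesgue_on {0..}) (\<lambda>x. ennreal (w x))"
  by (simp add: bessel_measure_def bessel_weight_def)

lemma space_bessel_measure [simp]: "space (\<mu>) = {0..}"
  and sets_bessel_measure: "sets (\<mu>) = sets (lebesgue_on {0..})"
  by (simp_all add: bessel_measure_def)

lemma measurable_bessel_measure_iff:
  "f \<in> borel_measurable (\<mu>) \<longleftrightarrow> f \<in> borel_measurable (lebesgue_on {0..})"
  by (simp add: bessel_measure_def)

lemma continuous_imp_measurable_bessel:
  fixes f :: "real \<Rightarrow> real"
  assumes "continuous_on {0..} f"
  shows "f \<in> borel_measurable (\<mu>)"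
  unfolding measurable_bessel_measure_iff
  by (rule continuous_imp_measurable_on_sets_lebesgue[OF assms]) simp

lemma bessel_weight_nonneg: "0 \<le> w x"
  using \<alpha> by (simp add: bessel_weight_def Gamma_real_pos less_imp_le)

lemma bessel_weight_pos: "x > 0 \<Longrightarrow> 0 < w x"
  using \<alpha> by (simp add: bessel_weight_def Gamma_real_pos)

lemma bessel_weight_measurable: "w \<in> borel_measurable (lebesgue_on A)"
proof -
  have "w \<in> borel_measurable borel" unfolding bessel_weight_def by measurable
  then have "w \<in> borel_measurable lebesgue"
    by (intro measurable_completion) simp
  then show ?thesis by (rule measurable_restrict_space1)
qed

lemma integrable_bessel_measure_iff:
  fixes f :: "real \<Rightarrow> real"
  assumes "f \<in> borel_measurable (lebesgue_on {0..})"
  shows "integrable (\<mu>) f \<longleftrightarrow> integrable (lebesgue_on {0..}) (\<lambda>x. w x * f x)"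
  unfolding bessel_measure_eq
  using integrable_density[OF assms bessel_weight_measurable] bessel_weight_nonneg by simp

lemma integral_bessel_measure:
  fixes f :: "real \<Rightarrow> real"
  assumes "f \<in> borel_measurable (lebesgue_on {0..})"
  shows "(LINT x|\<mu>. f x) = (LINT x|lebesgue_on {0..}. w x * f x)"
  unfolding bessel_measure_eq
  using integral_density[OF assms bessel_weight_measurable] bessel_weight_nonneg by simp

lemma AE_bessel_measure_iff: "(AE x in \<mu>. P x) \<longleftrightarrow> (AE x in lebesgue_on {0..}. P x)"
proof -
  have m: "(\<lambda>x. ennreal (w x)) \<in> borel_measurable (lebesgue_on {0..})"
    using bessel_weight_measurable by measurable
  have "AE x in lebesgue. x \<noteq> (0::real)"
    by (intro AE_completion) (use AE_lborel_singleton[of "0::real"] in simp)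
  then have "AE x in lebesgue_on {0..}. x \<noteq> (0::real)"
    by (subst AE_restrict_space_iff) (auto elim!: eventually_mono)
  then have pos: "AE x in lebesgue_on {0..}. 0 < ennreal (w x)"
    using AE_space by eventually_elim (auto intro!: bessel_weight_pos)
  show ?thesis unfolding bessel_measure_eq AE_density[OF m]
  proof
    assume "AE x in lebesgue_on {0..}. 0 < ennreal (w x) \<longrightarrow> P x"
    then show "AE x in lebesgue_on {0..}. P x" using pos by eventually_elim auto
  qed (auto elim: eventually_mono)
qed

lemma sigma_finite_bessel_measure: "sigma_finite_measure (\<mu>)"
proof -
  interpret sigma_finite_measure "lebesgue_on {0::real..}"
    by (rule sigma_finite_measure_restrict_space[OF sigma_finite_lebesgue]) simp
  have "(\<lambda>x. ennreal (w x)) \<in> borel_measurable (lebesgue_on {0..})"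
    using bessel_weight_measurable by measurable
  then show ?thesis
    unfolding bessel_measure_eq by (subst sigma_finite_iff_density_finite) auto
qed

lemma Lp_space_1_iff: "f \<in> Lp_space 1 \<alpha> \<longleftrightarrow> integrable (\<mu>) f"
  unfolding Lp_space_def by (auto simp: integrable_abs_iff)

lemma Lp_space_2_iff:
  "f \<in> Lp_space 2 \<alpha> \<longleftrightarrow>
    f \<in> borel_measurable (\<mu>) \<and> integrable (\<mu>) (\<lambda>x. (f x)\<^sup>2)"
  by (simp add: Lp_space_def)

lemma Lp_norm_on_2:
  "Lp_norm_on 2 \<alpha> E f = sqrt (LINT x|\<mu>. indicator E x * (f x)\<^sup>2)"
  by (simp add: Lp_norm_on_def set_lebesgue_integral_def powr_half_sqrt)

lemma Lp_norm_2: "Lp_norm 2 \<alpha> f = sqrt (LINT x|\<mu>. (f x)\<^sup>2)"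
proof -
  have "(LINT x|\<mu>. indicator {0..} x * (f x)\<^sup>2) = (LINT x|\<mu>. (f x)\<^sup>2)"
    by (intro Bochner_Integration.integral_cong) auto
  then show ?thesis unfolding Lp_norm_on_2 by simp
qed

section \<open>The multiplication formula\<close>

lemma bessel_kernel_bound:
  "x \<ge> 0 \<Longrightarrow> y \<ge> 0 \<Longrightarrow> \<bar>bessel_j \<alpha> (2 * pi * x * y)\<bar> \<le> 1"
  by (rule abs_bessel_j_le_1) (use \<alpha> in auto)

lemma bessel_kernel_pair_measurable:
  "(\<lambda>(x, y). bessel_j \<alpha> (2 * pi * x * y)) \<in> borel_measurable (\<mu> \<Otimes>\<^sub>M \<mu>)"
proof -
  have id: "(\<lambda>x. x) \<in> borel_measurable (\<mu>)"
    by (intro continuous_imp_measurable_bessel continuous_intros)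
  have fs: "fst \<in> borel_measurable (\<mu> \<Otimes>\<^sub>M \<mu>)"
       "snd \<in> borel_measurable (\<mu> \<Otimes>\<^sub>M \<mu>)"
    using measurable_compose[OF measurable_fst id] measurable_compose[OF measurable_snd id] by auto
  then have "(\<lambda>p. 2 * pi * fst p * snd p) \<in> borel_measurable (\<mu> \<Otimes>\<^sub>M \<mu>)"
    by (intro borel_measurable_times) auto
  moreover have "bessel_j \<alpha> \<in> borel_measurable borel"
    by (rule borel_measurable_continuous_onI[OF continuous_on_bessel_j]) (use \<alpha> in simp)
  ultimately show ?thesis by (simp add: case_prod_unfold measurable_compose)
qed

lemma bessel_kernel_measurable:
  "(\<lambda>x. bessel_j \<alpha> (2 * pi * x * y)) \<in> borel_measurable (\<mu>)"
  by (intro continuous_imp_measurable_bessel continuous_on_compose2[OF continuous_on_bessel_j[of \<alpha> UNIV]] continuous_intros)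
     (use \<alpha> in auto)

lemma integrable_mult_bessel_kernel:
  assumes h: "integrable (\<mu>) h" and y: "y \<ge> 0"
  shows "integrable (\<mu>) (\<lambda>x. h x * bessel_j \<alpha> (2 * pi * x * y))"
proof (rule Bochner_Integration.integrable_bound[OF h])
  show "(\<lambda>x. h x * bessel_j \<alpha> (2 * pi * x * y)) \<in> borel_measurable (\<mu>)"
    using h bessel_kernel_measurable by (intro borel_measurable_times) auto
  show "AE x in \<mu>. norm (h x * bessel_j \<alpha> (2 * pi * x * y)) \<le> norm (h x)"
  proof (rule AE_I2)
    fix x assume "x \<in> space (\<mu>)"
    then show "norm (h x * bessel_j \<alpha> (2 * pi * x * y)) \<le> norm (h x)"
      using mult_left_mono[OF bessel_kernel_bound[of x y], of "\<bar>h x\<bar>"] y by (simp add: abs_mult)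
  qed
qed

lemma fourier_bessel_integral_bound:
  assumes h: "integrable (\<mu>) h" and y: "y \<ge> 0"
  shows "\<bar>\<F> h y\<bar> \<le> (LINT x|\<mu>. \<bar>h x\<bar>)"
proof -
  have "\<bar>\<F> h y\<bar> \<le> (LINT x|\<mu>. \<bar>h x * bessel_j \<alpha> (2 * pi * x * y)\<bar>)"
    unfolding fourier_bessel_integral_def by (rule integral_abs_bound)
  also have "\<dots> \<le> (LINT x|\<mu>. \<bar>h x\<bar>)"
  proof (rule integral_mono)
    fix x assume "x \<in> space (\<mu>)"
    then show "\<bar>h x * bessel_j \<alpha> (2 * pi * x * y)\<bar> \<le> \<bar>h x\<bar>"
      using mult_left_mono[OF bessel_kernel_bound[of x y], of "\<bar>h x\<bar>"] y by (simp add: abs_mult)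
  qed (use h integrable_mult_bessel_kernel[OF h y] in auto)
  finally show ?thesis .
qed

lemma fourier_bessel_integral_measurable:
  assumes "integrable (\<mu>) h"
  shows "\<F> h \<in> borel_measurable (\<mu>)"
proof -
  interpret sigma_finite_measure "\<mu>" by (rule sigma_finite_bessel_measure)
  have h: "h \<in> borel_measurable (\<mu>)" using assms by simp
  have "(\<lambda>(y, x). h x * bessel_j \<alpha> (2 * pi * x * y)) \<in> borel_measurable (\<mu> \<Otimes>\<^sub>M \<mu>)"
    using measurable_compose[OF measurable_snd h, of "\<mu>"]
      bessel_kernel_pair_measurable
    by (auto simp: case_prod_unfold mult_ac intro!: borel_measurable_times)
  then show ?thesis
    unfolding fourier_bessel_integral_def by (rule borel_measurable_lebesgue_integral)
qed

lemma multiplication_formula: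
  assumes h: "integrable (\<mu>) h" and \<phi>: "integrable (\<mu>) \<phi>"
  shows "(LINT y|\<mu>. \<F> h y * \<phi> y) =
    (LINT x|\<mu>. h x * \<F> \<phi> x)"
proof -
  interpret B: sigma_finite_measure "\<mu>" by (rule sigma_finite_bessel_measure)
  interpret pair_sigma_finite "\<mu>" "\<mu>" ..
  define k where "k x y = h x * bessel_j \<alpha> (2 * pi * x * y) * \<phi> y" for x y
  have km: "case_prod k \<in> borel_measurable (\<mu> \<Otimes>\<^sub>M \<mu>)"
  proof -
    have "(\<lambda>p. h (fst p)) \<in> borel_measurable (\<mu> \<Otimes>\<^sub>M \<mu>)"
      by (rule measurable_compose[OF measurable_fst]) (use h in simp)
    moreover have "(\<lambda>p. \<phi> (snd p)) \<in> borel_measurable (\<mu> \<Otimes>\<^sub>M \<mu>)"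
      by (rule measurable_compose[OF measurable_snd]) (use \<phi> in simp)
    ultimately show ?thesis using bessel_kernel_pair_measurable
      unfolding k_def case_prod_unfold by (intro borel_measurable_times)
  qed
  have kx: "k x y = h x * (\<phi> y * bessel_j \<alpha> (2 * pi * y * x))" for x y
    by (simp add: k_def mult_ac)
  have int2: "integrable (\<mu>) (k x)" if "x \<ge> 0" for x
    unfolding kx using integrable_mult_bessel_kernel[OF \<phi> that] by simp
  have "integrable (\<mu> \<Otimes>\<^sub>M \<mu>) (case_prod k)"
  proof (rule Fubini_integrable[OF km])
    show "AE x in \<mu>. integrable (\<mu>) (\<lambda>y. case (x, y) of (x, y) \<Rightarrow> k x y)"
      using int2 by (intro AE_I2) simp
    show "integrable (\<mu>) (\<lambda>x. LINT y|\<mu>. norm (case (x, y) of (x, y) \<Rightarrow> k x y))"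
    proof (rule Bochner_Integration.integrable_bound)
      show "integrable (\<mu>) (\<lambda>x. h x * (LINT y|\<mu>. \<bar>\<phi> y\<bar>))" using h by simp
      show "(\<lambda>x. LINT y|\<mu>. norm (case (x, y) of (x, y) \<Rightarrow> k x y)) \<in> borel_measurable (\<mu>)"
        by (rule B.borel_measurable_lebesgue_integral) (use km in \<open>simp add: case_prod_unfold\<close>)
      show "AE x in \<mu>. norm (LINT y|\<mu>. norm (case (x, y) of (x, y) \<Rightarrow> k x y))
          \<le> norm (h x * (LINT y|\<mu>. \<bar>\<phi> y\<bar>))"
      proof (rule AE_I2)
        fix x assume x: "x \<in> space (\<mu>)"
        have "(LINT y|\<mu>. \<bar>k x y\<bar>) \<le> (LINT y|\<mu>. \<bar>h x\<bar> * \<bar>\<phi> y\<bar>)"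
        proof (rule integral_mono)
          fix y assume "y \<in> space (\<mu>)"
          then show "\<bar>k x y\<bar> \<le> \<bar>h x\<bar> * \<bar>\<phi> y\<bar>"
            using mult_left_mono[OF bessel_kernel_bound[of x y], of "\<bar>h x\<bar> * \<bar>\<phi> y\<bar>"] x
            by (simp add: k_def abs_mult mult_ac)
        qed (use int2[of x] x \<phi> in auto)
        also have "\<dots> = \<bar>h x\<bar> * (LINT y|\<mu>. \<bar>\<phi> y\<bar>)" by simp
        finally show "norm (LINT y|\<mu>. norm (case (x, y) of (x, y) \<Rightarrow> k x y))
          \<le> norm (h x * (LINT y|\<mu>. \<bar>\<phi> y\<bar>))"
          by (simp add: abs_mult)
      qed
    qed
  qed
  from Fubini_integral[OF this]
  have "(LINT y|\<mu>. LINT x|\<mu>. k x y) =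
    (LINT x|\<mu>. LINT y|\<mu>. k x y)" .
  moreover have "(LINT x|\<mu>. k x y) = \<F> h y * \<phi> y" for y
    by (simp add: k_def fourier_bessel_integral_def)
  moreover have "(LINT y|\<mu>. k x y) = h x * \<F> \<phi> x" for x
    unfolding kx by (simp add: fourier_bessel_integral_def)
  ultimately show ?thesis by simp
qed

text \<open>
  The multiplication formula for the approximating functions passes to the limit. The existence of the
  approximating sequence is used here only.
\<close>

lemma has_fourier_bessel_duality:
  assumes fg: "has_fourier_bessel \<alpha> f g"
    and \<phi>: "integrable (\<mu>) \<phi>" "integrable (\<mu>) (\<lambda>x. (\<phi> x)\<^sup>2)"
    and F\<phi>: "integrable (\<mu>) (\<lambda>x. (\<F> \<phi> x)\<^sup>2)"
  shows "(LINT y|\<mu>. g y * \<phi> y) = (LINT x|\<mu>. f x * \<F> \<phi> x)"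
proof -
  obtain h where h: "\<And>n. h n \<in> Lp_space 1 \<alpha>" "\<And>n. h n \<in> Lp_space 2 \<alpha>"
      "\<And>n. \<F> (h n) \<in> Lp_space 2 \<alpha>"
    and lim: "(\<lambda>n. Lp_norm 2 \<alpha> (\<lambda>x. h n x - f x)) \<longlonglongrightarrow> 0"
      "(\<lambda>n. Lp_norm 2 \<alpha> (\<lambda>y. \<F> (h n) y - g y)) \<longlonglongrightarrow> 0"
    using fg unfolding has_fourier_bessel_def by blast
  have f: "f \<in> Lp_space 2 \<alpha>" and g: "g \<in> Lp_space 2 \<alpha>"
    using fg unfolding has_fourier_bessel_def by auto
  note [simp] = Lp_space_2_iff Lp_space_1_iff Lp_norm_2
  have "(\<lambda>n. LINT y|\<mu>. \<F> (h n) y * \<phi> y)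
      \<longlonglongrightarrow> (LINT y|\<mu>. g y * \<phi> y)"
    by (rule tendsto_integral_mult_of_L2) (use h g \<phi> lim in auto)
  moreover have "(\<lambda>n. LINT x|\<mu>. h n x * \<F> \<phi> x)
      \<longlonglongrightarrow> (LINT x|\<mu>. f x * \<F> \<phi> x)"
    by (rule tendsto_integral_mult_of_L2)
       (use h f \<phi> F\<phi> lim fourier_bessel_integral_measurable in auto)
  moreover have "(LINT y|\<mu>. \<F> (h n) y * \<phi> y) =
    (LINT x|\<mu>. h n x * \<F> \<phi> x)" for n
    by (rule multiplication_formula) (use h \<phi> in auto)
  ultimately show ?thesis using LIMSEQ_unique by simp
qed

section \<open>Gaussians\<close>

lemma gauss_moment:
  assumes t: "t > 0"
  shows "integrable (\<mu>) (\<lambda>x. x ^ (2 * n) * gauss t x)"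
    and "(LINT x|\<mu>. x ^ (2 * n) * gauss t x) =
      Gamma (real n + \<alpha> + 1) / Gamma (\<alpha> + 1) * t powr - (\<alpha> + 1) / (pi * t) ^ n"
proof -
  define s where "s = real n + \<alpha> + 1"
  define c where "c = 2 * pi powr (\<alpha> + 1) / Gamma (\<alpha> + 1)"
  have s: "s > 1/2" using \<alpha> by (simp add: s_def)
  define u where "u x = x powr (2 * s - 1) * gauss t x" for x
  have uI: "(u has_integral Gamma s / (2 * (pi * t) powr s)) {0..}"
    unfolding u_def by (rule has_integral_power_gauss[OF s t])
  have "u absolutely_integrable_on {0..}"
    by (rule nonnegative_absolutely_integrable_1) (use uI in \<open>auto simp: u_def gauss_def\<close>)
  then have u: "integrable (lebesgue_on {0..}) u" by (rule absolutely_integrable_imp_integrable) simp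
  have meas: "(\<lambda>x. x ^ (2 * n) * gauss t x) \<in> borel_measurable (lebesgue_on {0..})"
    unfolding gauss_def measurable_bessel_measure_iff[symmetric]
    by (intro continuous_imp_measurable_bessel continuous_intros)
  have eq: "w x * (x ^ (2 * n) * gauss t x) = c * u x" if "x \<in> space (lebesgue_on {0..})" for x
  proof (cases "x = 0")
    case True then show ?thesis using \<alpha> s by (simp add: bessel_weight_def u_def)
  next
    case False
    then have x: "x > 0" using that by simp
    have "x powr (2 * s - 1) = x powr (2 * \<alpha> + 1) * x powr (real (2 * n))"
      unfolding powr_add[symmetric] by (simp add: s_def algebra_simps)
    also have "x powr (real (2 * n)) = x ^ (2 * n)" using x by (rule powr_realpow)
    finally show ?thesis by (simp add: bessel_weight_def u_def c_def)
  qed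
  have "integrable (lebesgue_on {0..}) (\<lambda>x. w x * (x ^ (2 * n) * gauss t x))"
    using u by (subst Bochner_Integration.integrable_cong[OF refl eq]) auto
  then show "integrable (\<mu>) (\<lambda>x. x ^ (2 * n) * gauss t x)"
    using meas by (subst integrable_bessel_measure_iff) auto
  have "(LINT x|\<mu>. x ^ (2 * n) * gauss t x) = (LINT x|lebesgue_on {0..}. w x * (x ^ (2 * n) * gauss t x))"
    using meas by (subst integral_bessel_measure) auto
  also have "\<dots> = (LINT x|lebesgue_on {0..}. c * u x)"
    by (rule Bochner_Integration.integral_cong[OF refl eq])
  also have "\<dots> = c * integral {0..} u" using u by (simp add: lebesgue_integral_eq_integral)
  also have "integral {0..} u = Gamma s / (2 * (pi * t) powr s)" using uI by (rule integral_unique)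
  also have "(pi * t) powr s = pi powr (\<alpha> + 1) * t powr (\<alpha> + 1) * (pi * t) ^ n"
  proof -
    have "(pi * t) powr s = (pi * t) powr (\<alpha> + 1) * (pi * t) powr (real n)"
      unfolding powr_add[symmetric] by (simp add: s_def algebra_simps)
    also have "(pi * t) powr (real n) = (pi * t) ^ n" using t by (intro powr_realpow) simp
    finally show ?thesis using t by (simp add: powr_mult)
  qed
  also have "c * (Gamma s / (2 * (pi powr (\<alpha> + 1) * t powr (\<alpha> + 1) * (pi * t) ^ n))) =
     Gamma s / Gamma (\<alpha> + 1) * t powr - (\<alpha> + 1) / (pi * t) ^ n"
    unfolding c_def powr_minus by (simp add: divide_simps)
  finally show "(LINT x|\<mu>. x ^ (2 * n) * gauss t x) =
      Gamma (real n + \<alpha> + 1) / Gamma (\<alpha> + 1) * t powr - (\<alpha> + 1) / (pi * t) ^ n"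
    by (simp only: s_def)
qed

lemma integrable_gauss: "t > 0 \<Longrightarrow> integrable (\<mu>) (gauss t)"
  using gauss_moment(1)[of t 0] by simp

text \<open>
  Integrate the Bessel series term by term: the Gamma factors of the moments cancel those of the
  coefficients, and an exponential series remains.
\<close>

lemma fourier_bessel_gauss:
  assumes t: "t > 0"
  shows "\<F> (gauss t) y = t powr - (\<alpha> + 1) * gauss (1 / t) y"
proof -
  define q where "q = pi * y\<^sup>2 / t"
  define f where "f n x = bessel_coeff \<alpha> n * ((2 * pi * y)\<^sup>2) ^ n * (x ^ (2 * n) * gauss t x)" for n x
  have fint: "integrable (\<mu>) (f n)" for n
    unfolding f_def using gauss_moment(1)[OF t, of n] by (rule integrable_mult_right)
  have coef: "bessel_coeff \<alpha> n * ((2 * pi * y)\<^sup>2) ^ n * (Gamma (real n + \<alpha> + 1) / Gamma (\<alpha> + 1) * t powr - (\<alpha> + 1) / (pi * t) ^ n)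
      = t powr - (\<alpha> + 1) * ((- q) ^ n / fact n)" for n
  proof -
    have G: "Gamma (real n + \<alpha> + 1) > 0" "Gamma (\<alpha> + 1) > 0" using \<alpha> by (auto intro!: Gamma_real_pos)
    have "(2 * pi * y)\<^sup>2 = q * (4 * (pi * t))" using t by (simp add: q_def power2_eq_square)
    then have X: "((2 * pi * y)\<^sup>2) ^ n = q ^ n * (4 ^ n * (pi * t) ^ n)" by (simp only: power_mult_distrib)
    have alg: "G1 * (s / (F * G2)) / P * (Y * (P * Q)) * (G2 / G1 * T / Q) = T * (s * Y / F)"
      if "G1 > 0" "G2 > 0" "F > 0" "P > 0" "Q > 0" for G1 G2 s F P Y Q T :: real
      using that by (simp add: field_simps)
    have "bessel_coeff \<alpha> n * ((2 * pi * y)\<^sup>2) ^ n * (Gamma (real n + \<alpha> + 1) / Gamma (\<alpha> + 1) * t powr - (\<alpha> + 1) / (pi * t) ^ n)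
      = t powr - (\<alpha> + 1) * ((-1) ^ n * q ^ n / fact n)"
      unfolding X bessel_coeff_def by (rule alg) (use G t in auto)
    then show ?thesis by (simp add: power_mult_distrib[symmetric])
  qed
  have fI: "(LINT x|\<mu>. f n x) = t powr - (\<alpha> + 1) * ((- q) ^ n / fact n)" for n
    unfolding f_def coef[symmetric] gauss_moment(2)[OF t, of n, symmetric] by (rule integral_mult_right_zero)
  have nf: "norm (f n x) = (-1) ^ n * f n x" for n x
  proof -
    have G: "Gamma (real n + \<alpha> + 1) > 0" "Gamma (\<alpha> + 1) > 0" using \<alpha> by (auto intro!: Gamma_real_pos)
    have "\<bar>bessel_coeff \<alpha> n\<bar> = (-1) ^ n * bessel_coeff \<alpha> n"
      using G by (simp add: bessel_coeff_def abs_mult power_abs power_mult_distrib[symmetric] flip: mult.assoc)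
    moreover have "0 \<le> ((2 * pi * y)\<^sup>2) ^ n * (x ^ (2 * n) * gauss t x)" by (simp add: gauss_def)
    ultimately show ?thesis
      unfolding f_def real_norm_def mult.assoc abs_mult[of "bessel_coeff \<alpha> n"] by (simp only: abs_of_nonneg mult.assoc)
  qed
  have nfI: "(LINT x|\<mu>. norm (f n x)) = t powr - (\<alpha> + 1) * (q ^ n / fact n)" for n
    unfolding nf using fI by (simp add: power_mult_distrib[symmetric])
  have sx: "summable (\<lambda>n. norm (f n x))" for x
  proof -
    define r where "r = (2 * pi * y)\<^sup>2 * x\<^sup>2"
    have "summable (\<lambda>n. norm (bessel_coeff \<alpha> n * r ^ n))"
      by (rule powser_insidea[OF summable_bessel_coeff[OF \<alpha>, of "r + 1"]]) (simp add: r_def)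
    then have "summable (\<lambda>n. norm (bessel_coeff \<alpha> n * r ^ n) * gauss t x)" by (rule summable_mult2)
    moreover have "f n x = (bessel_coeff \<alpha> n * r ^ n) * gauss t x" for n
      unfolding f_def r_def power_mult power_mult_distrib by (simp only: mult_ac)
    ultimately show ?thesis by (simp add: abs_mult gauss_def)
  qed
  have "\<F> (gauss t) y = (LINT x|\<mu>. (\<Sum>n. f n x))"
    unfolding fourier_bessel_integral_def
  proof (rule Bochner_Integration.integral_cong[OF refl])
    fix x
    have "gauss t x * bessel_j \<alpha> (2 * pi * x * y) = gauss t x * (\<Sum>n. bessel_coeff \<alpha> n * ((2 * pi * x * y)\<^sup>2) ^ n)"
      by (simp add: bessel_j_power_series[OF \<alpha>])
    also have "\<dots> = (\<Sum>n. gauss t x * (bessel_coeff \<alpha> n * ((2 * pi * x * y)\<^sup>2) ^ n))"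
      by (rule suminf_mult[symmetric]) (rule summable_bessel_coeff[OF \<alpha>])
    also have "\<dots> = (\<Sum>n. f n x)"
      unfolding f_def power_mult power_mult_distrib by (simp only: mult_ac)
    finally show "gauss t x * bessel_j \<alpha> (2 * pi * x * y) = (\<Sum>n. f n x)" .
  qed
  also have "\<dots> = (\<Sum>n. LINT x|\<mu>. f n x)"
  proof (rule integral_suminf[OF fint])
    show "summable (\<lambda>n. LINT x|\<mu>. norm (f n x))"
      unfolding nfI using summable_exp_generic[of q]
      by (intro summable_mult) (simp add: field_simps)
  qed (use sx in auto)
  also have "\<dots> = (\<Sum>n. t powr - (\<alpha> + 1) * ((- q) ^ n / fact n))" by (simp add: fI)
  also have "\<dots> = t powr - (\<alpha> + 1) * (\<Sum>n. (- q) ^ n / fact n)"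
    using summable_exp_generic[of "- q"] by (intro suminf_mult) (simp add: field_simps)
  also have "(\<Sum>n. (- q) ^ n / fact n) = gauss (1 / t) y"
    by (simp add: gauss_def q_def exp_def field_simps)
  finally show ?thesis .
qed

section \<open>Inversion and Plancherel's identity\<close>

lemma AE_zero_of_tail_integrals_bessel:
  fixes K :: "real \<Rightarrow> real"
  assumes K: "integrable (\<mu>) K"
    and tails: "\<And>r. r \<ge> 0 \<Longrightarrow> (LINT x|\<mu>. indicator {r<..} x * K x) = 0"
    and total: "(LINT x|\<mu>. K x) = 0"
  shows "AE x in \<mu>. K x = 0"
proof -
  have Km: "K \<in> borel_measurable (lebesgue_on {0..})"
    using K by (simp add: measurable_bessel_measure_iff[symmetric])
  define k where "k x = indicator {0..} x *\<^sub>R (w x * K x)" for x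
  have kint: "integrable lebesgue k"
    using K integrable_bessel_measure_iff[OF Km] unfolding k_def
    by (subst (asm) integrable_restrict_space) (auto simp: integrable_restrict_space)
  have conv: "(LINT x|lebesgue. u x * k x) = (LINT x|\<mu>. u x * K x)"
    if "u \<in> borel_measurable (lebesgue_on {0..})" for u
  proof -
    have "(LINT x|\<mu>. u x * K x) = (LINT x|lebesgue_on {0..}. w x * (u x * K x))"
      using that Km by (intro integral_bessel_measure borel_measurable_times)
    also have "\<dots> = (LINT x|lebesgue. indicator {0..} x *\<^sub>R (w x * (u x * K x)))"
      by (subst integral_restrict_space) auto
    also have "\<dots> = (LINT x|lebesgue. u x * k x)"
      by (intro Bochner_Integration.integral_cong refl) (simp add: k_def mult_ac)
    finally show ?thesis by simp
  qed
  have "AE x in lebesgue. k x = 0"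
  proof (rule AE_zero_of_tail_integrals[OF kint])
    fix r :: real
    have m: "indicator {r<..} \<in> borel_measurable (lebesgue_on {0..})"
      by (intro measurable_restrict_space1 borel_measurable_indicator) simp
    show "(LINT x|lebesgue. indicator {r<..} x * k x) = 0"
    proof (cases "r \<ge> 0")
      case True
      then show ?thesis using conv[OF m] tails by simp
    next
      case False
      have "(LINT x|\<mu>. indicator {r<..} x * K x) = (LINT x|\<mu>. K x)"
        using False by (intro Bochner_Integration.integral_cong) (auto simp: indicator_def)
      then show ?thesis using conv[OF m] total by simp
    qed
  qed
  moreover have "AE x in lebesgue. x \<noteq> (0::real)"
    by (intro AE_completion) (use AE_lborel_singleton[of "0::real"] in simp)
  ultimately have "AE x in lebesgue. x \<in> {0..} \<longrightarrow> K x = 0"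
  proof eventually_elim
    case (elim x)
    show ?case using elim bessel_weight_pos[ of x] by (auto simp: k_def)
  qed
  then show ?thesis unfolding AE_bessel_measure_iff
    by (subst AE_restrict_space_iff) (auto elim!: eventually_mono)
qed

text \<open>
  Put \<open>K = H * gauss 1\<close>. The hypothesis for integral \<open>t\<close> says that \<open>K\<close> is orthogonal to all
  powers of \<open>gauss 1\<close>. By Weierstrass it is orthogonal to all continuous functions of \<open>gauss 1\<close> and, in the
  limit, to the indicators of rays, because \<open>gauss 1\<close> is decreasing.
\<close>

lemma gauss_total:
  assumes H: "integrable (\<mu>) (\<lambda>x. H x * gauss 1 x)"
    and zero: "\<And>t. t > 0 \<Longrightarrow> (LINT x|\<mu>. H x * gauss t x) = 0"
  shows "AE x in \<mu>. H x = 0"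
proof -
  define K where "K x = H x * gauss 1 x" for x
  have K: "integrable (\<mu>) K" unfolding K_def by (rule H)
  have g01: "gauss 1 x \<in> {0..1}" for x by (simp add: gauss_def)
  have gm: "gauss 1 \<in> borel_measurable (\<mu>)"
    unfolding gauss_def by (intro continuous_imp_measurable_bessel continuous_intros)
  have bnd: "integrable (\<mu>) (\<lambda>x. K x * u (gauss 1 x))"
    if "continuous_on {0..1} u" for u :: "real \<Rightarrow> real"
  proof -
    have "compact (u ` {0..1})" using that by (intro compact_continuous_image) auto
    then have "bounded (u ` {0..1})" by (rule compact_imp_bounded)
    then obtain b where "\<forall>v\<in>u ` {0..1}. norm v \<le> b" unfolding bounded_iff ..
    then have b: "\<bar>u s\<bar> \<le> b" if "s \<in> {0..1}" for s using that by auto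
    have "continuous_on UNIV (\<lambda>x. u (gauss 1 x))"
      by (rule continuous_on_compose2[OF that]) (use g01 in \<open>auto simp: gauss_def intro!: continuous_intros\<close>)
    then have um: "(\<lambda>x. u (gauss 1 x)) \<in> borel_measurable (\<mu>)"
      by (intro continuous_imp_measurable_bessel) (rule continuous_on_subset, auto)
    show ?thesis
    proof (rule Bochner_Integration.integrable_bound)
      show "integrable (\<mu>) (\<lambda>x. b * K x)" using K by simp
      show "(\<lambda>x. K x * u (gauss 1 x)) \<in> borel_measurable (\<mu>)"
        using K um by (intro borel_measurable_times) auto
      show "AE x in \<mu>. norm (K x * u (gauss 1 x)) \<le> norm (b * K x)"
      proof (rule AE_I2)
        fix x
        have "\<bar>u (gauss 1 x)\<bar> \<le> \<bar>b\<bar>" using b[OF g01[of x]] by linarith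
        then show "norm (K x * u (gauss 1 x)) \<le> norm (b * K x)"
          using mult_left_mono[of "\<bar>u (gauss 1 x)\<bar>" "\<bar>b\<bar>" "\<bar>K x\<bar>"] by (simp add: abs_mult mult.commute)
      qed
    qed
  qed
  have pow: "(LINT x|\<mu>. K x * gauss 1 x ^ i) = 0" for i
  proof -
    have "K x * gauss 1 x ^ i = H x * gauss (real (Suc i)) x" for x
      unfolding K_def gauss_def exp_of_nat_mult[symmetric] mult.assoc exp_add[symmetric]
      by (simp add: algebra_simps)
    then show ?thesis using zero[of "real (Suc i)"] by simp
  qed
  have cont: "(LINT x|\<mu>. K x * u (gauss 1 x)) = 0" if u: "continuous_on {0..1} u" for u :: "real \<Rightarrow> real"
  proof -
    define I where "I = (LINT x|\<mu>. \<bar>K x\<bar>)"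
    have I0: "I \<ge> 0" by (simp add: I_def)
    have "\<bar>LINT x|\<mu>. K x * u (gauss 1 x)\<bar> \<le> 0 + e" if e: "e > 0" for e
    proof -
      define e' where "e' = e / (I + 1)"
      have e': "e' > 0" using e I0 by (simp add: e'_def)
      obtain p where p: "real_polynomial_function p" "\<And>s. s \<in> {0..1} \<Longrightarrow> \<bar>u s - p s\<bar> < e'"
        using Stone_Weierstrass_real_polynomial_function[OF _ u e'] by auto
      obtain a N where pa: "p = (\<lambda>x. \<Sum>i\<le>N. a i * x ^ i)"
        using p(1) by (auto simp: real_polynomial_function_iff_sum)
      have pc: "continuous_on {0..1} p" unfolding pa by (intro continuous_intros)
      have "(LINT x|\<mu>. K x * p (gauss 1 x)) = (LINT x|\<mu>. (\<Sum>i\<le>N. a i * (K x * gauss 1 x ^ i)))"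
        by (intro Bochner_Integration.integral_cong refl) (simp add: pa sum_distrib_left mult_ac)
      also have "\<dots> = (\<Sum>i\<le>N. a i * (LINT x|\<mu>. K x * gauss 1 x ^ i))"
      proof -
        have "integrable (\<mu>) (\<lambda>x. K x * gauss 1 x ^ i)" for i
          using bnd[of "\<lambda>s. s ^ i"] by (simp add: continuous_on_power)
        then show ?thesis by (subst Bochner_Integration.integral_sum) auto
      qed
      finally have p0: "(LINT x|\<mu>. K x * p (gauss 1 x)) = 0" by (simp add: pow)
      have "(LINT x|\<mu>. K x * u (gauss 1 x)) =
         (LINT x|\<mu>. K x * u (gauss 1 x) - K x * p (gauss 1 x))"
        using bnd[OF u] bnd[OF pc] p0 by simp
      also have "\<bar>\<dots>\<bar> \<le> (LINT x|\<mu>. \<bar>K x * u (gauss 1 x) - K x * p (gauss 1 x)\<bar>)"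
        by (rule integral_abs_bound)
      also have "\<dots> \<le> (LINT x|\<mu>. \<bar>K x\<bar> * e')"
      proof (rule integral_mono)
        fix x
        show "\<bar>K x * u (gauss 1 x) - K x * p (gauss 1 x)\<bar> \<le> \<bar>K x\<bar> * e'"
          unfolding right_diff_distrib[symmetric] abs_mult
          using p(2)[OF g01[of x]] by (intro mult_left_mono) auto
      qed (use bnd[OF u] bnd[OF pc] K in auto)
      also have "\<dots> = I * e'" by (simp add: I_def)
      also have "\<dots> \<le> (I + 1) * e'" using e' by (intro mult_right_mono) auto
      also have "\<dots> = e" using I0 by (simp add: e'_def)
      finally show ?thesis by simp
    qed
    then have "\<bar>LINT x|\<mu>. K x * u (gauss 1 x)\<bar> \<le> 0" by (rule field_le_epsilon)
    then show ?thesis by simp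
  qed
  have "AE x in \<mu>. K x = 0"
  proof (rule AE_zero_of_tail_integrals_bessel[OF K])
    show total: "(LINT x|\<mu>. K x) = 0" using pow[of 0] by simp
    fix r :: real assume r: "r \<ge> 0"
    define c where "c = gauss 1 r"
    \<comment> \<open>Ramps that increase to the indicator of \<open>[0, c)\<close> on the range of the Gaussian.\<close>
    define u where "u m s = min 1 (max 0 (real m * (c - s)))" for m :: nat and s :: real
    have "(\<lambda>m. LINT x|\<mu>. K x * u m (gauss 1 x)) \<longlonglongrightarrow> (LINT x|\<mu>. indicator {r<..} x * K x)"
    proof (rule integral_dominated_convergence[where w = "\<lambda>x. \<bar>K x\<bar>"])
      have "continuous_on {0..1} (u m)" for m unfolding u_def by (intro continuous_intros)
      then show "(\<lambda>x. K x * u m (gauss 1 x)) \<in> borel_measurable (\<mu>)" for m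
        using bnd by blast
      show "(\<lambda>x. indicator {r<..} x * K x) \<in> borel_measurable (\<mu>)"
      proof (rule borel_measurable_times)
        show "indicator {r<..} \<in> borel_measurable (\<mu>)"
          unfolding measurable_bessel_measure_iff
          by (intro measurable_restrict_space1 borel_measurable_indicator) simp
      qed (use K in simp)
      show "integrable (\<mu>) (\<lambda>x. \<bar>K x\<bar>)" using K by simp
      show "AE x in \<mu>. (\<lambda>m. K x * u m (gauss 1 x)) \<longlonglongrightarrow> indicator {r<..} x * K x"
      proof (rule AE_I2)
        fix x assume x: "x \<in> space (\<mu>)"
        have iff: "gauss 1 x < c \<longleftrightarrow> r < x"
        proof -
          have "gauss 1 x < c \<longleftrightarrow> r\<^sup>2 < x\<^sup>2" by (simp add: c_def gauss_def)
          also have "\<dots> \<longleftrightarrow> r < x" using x r by (simp add: power2_strict_mono abs_less_iff flip: abs_square_less_1) (metis abs_of_nonneg abs_le_square_iff not_le)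
          finally show ?thesis .
        qed
        show "(\<lambda>m. K x * u m (gauss 1 x)) \<longlonglongrightarrow> indicator {r<..} x * K x"
        proof (cases "r < x")
          case True
          then have d: "c - gauss 1 x > 0" using iff by simp
          obtain m0 :: nat where m0: "1 / (c - gauss 1 x) < real m0" using reals_Archimedean2 by blast
          have "eventually (\<lambda>m. K x * u m (gauss 1 x) = indicator {r<..} x * K x) sequentially"
            using eventually_ge_at_top[of m0]
          proof eventually_elim
            case (elim m)
            then have "1 / (c - gauss 1 x) \<le> real m" using m0 by linarith
            then have "1 \<le> real m * (c - gauss 1 x)" using d by (simp add: field_simps)
            then show ?case using True by (simp add: u_def)
          qed
          then show ?thesis by (rule tendsto_eventually)
        next
          case False
          then have "real m * (c - gauss 1 x) \<le> 0" for m using iff by (intro mult_nonneg_nonpos) auto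
          then have "u m (gauss 1 x) = 0" for m by (simp add: u_def)
          then show ?thesis using False by simp
        qed
      qed
      show "AE x in \<mu>. norm (K x * u m (gauss 1 x)) \<le> \<bar>K x\<bar>" for m
      proof (rule AE_I2)
        fix x
        have "\<bar>u m (gauss 1 x)\<bar> \<le> 1" by (simp add: u_def)
        then show "norm (K x * u m (gauss 1 x)) \<le> \<bar>K x\<bar>"
          using mult_left_mono[of "\<bar>u m (gauss 1 x)\<bar>" 1 "\<bar>K x\<bar>"] by (simp add: abs_mult)
      qed
    qed
    moreover have "(LINT x|\<mu>. K x * u m (gauss 1 x)) = 0" for m
      by (rule cont) (unfold u_def, intro continuous_intros)
    ultimately have "(\<lambda>m. 0) \<longlonglongrightarrow> (LINT x|\<mu>. indicator {r<..} x * K x)" by simp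
    then show "(LINT x|\<mu>. indicator {r<..} x * K x) = 0"
      using LIMSEQ_unique tendsto_const by blast
  qed
  then show ?thesis by eventually_elim (simp add: K_def gauss_def)
qed

text \<open>
  Both sides have the same pairing with every Gaussian: for \<open>f\<close> by duality, for the transform of \<open>g\<close> by
  the multiplication formula, each time exchanging \<open>gauss t\<close> and \<open>gauss (1 / t)\<close>. Gaussians are total.
\<close>

lemma fourier_bessel_inversion:
  assumes fg: "has_fourier_bessel \<alpha> f g" and g: "integrable (\<mu>) g"
  shows "AE x in \<mu>. f x = \<F> g x"
proof -
  have f: "f \<in> borel_measurable \<mu>" "integrable \<mu> (\<lambda>x. (f x)\<^sup>2)"
    using fg unfolding has_fourier_bessel_def Lp_space_2_iff by auto
  have gauss2: "integrable \<mu> (\<lambda>x. (gauss t x)\<^sup>2)" if "t > 0" for t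
    unfolding gauss_square using that by (intro integrable_gauss) simp
  have gaussm: "gauss t \<in> borel_measurable \<mu>" for t
    unfolding gauss_def by (intro continuous_imp_measurable_bessel continuous_intros)
  have fgauss: "integrable \<mu> (\<lambda>x. f x * gauss t x)" if "t > 0" for t
    using f gauss2[OF that] gaussm by (intro integrable_mult_of_squares)
  have Gm: "\<F> g \<in> borel_measurable \<mu>"
    by (rule fourier_bessel_integral_measurable[OF g])
  have Ggauss: "integrable \<mu> (\<lambda>x. \<F> g x * gauss t x)" if t: "t > 0" for t
  proof (rule Bochner_Integration.integrable_bound)
    show "integrable \<mu> (\<lambda>x. (LINT y|\<mu>. \<bar>g y\<bar>) * gauss t x)" using integrable_gauss[OF t] by simp
    show "(\<lambda>x. \<F> g x * gauss t x) \<in> borel_measurable \<mu>"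
      using Gm gaussm by (rule borel_measurable_times)
    show "AE x in \<mu>. norm (\<F> g x * gauss t x) \<le> norm ((LINT y|\<mu>. \<bar>g y\<bar>) * gauss t x)"
    proof (rule AE_I2)
      fix x assume "x \<in> space \<mu>"
      then have "\<bar>\<F> g x\<bar> \<le> (LINT y|\<mu>. \<bar>g y\<bar>)"
        using fourier_bessel_integral_bound[OF g, of x] by simp
      then show "norm (\<F> g x * gauss t x) \<le> norm ((LINT y|\<mu>. \<bar>g y\<bar>) * gauss t x)"
        by (simp add: abs_mult mult_right_mono)
    qed
  qed
  have dual: "(LINT y|\<mu>. g y * gauss t y) = t powr - (\<alpha> + 1) * (LINT x|\<mu>. f x * gauss (1 / t) x)" if t: "t > 0" for t
  proof -
    have "(LINT y|\<mu>. g y * gauss t y) = (LINT x|\<mu>. f x * \<F> (gauss t) x)"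
    proof (rule has_fourier_bessel_duality[OF fg integrable_gauss[OF t] gauss2[OF t]])
      show "integrable \<mu> (\<lambda>x. (\<F> (gauss t) x)\<^sup>2)"
        unfolding fourier_bessel_gauss[OF t] power_mult_distrib
        using gauss2[of "1 / t"] t by simp
    qed
    also have "\<dots> = (LINT x|\<mu>. t powr - (\<alpha> + 1) * (f x * gauss (1 / t) x))"
      unfolding fourier_bessel_gauss[OF t] by (simp only: mult_ac)
    finally show ?thesis by simp
  qed
  have "AE x in \<mu>. f x - \<F> g x = 0"
  proof (rule gauss_total)
    show "integrable \<mu> (\<lambda>x. (f x - \<F> g x) * gauss 1 x)"
      unfolding left_diff_distrib using fgauss[of 1] Ggauss[of 1] by simp
    fix t :: real assume t: "t > 0"
    have "(LINT x|\<mu>. \<F> g x * gauss t x) = (LINT y|\<mu>. g y * \<F> (gauss t) y)"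
      by (rule multiplication_formula[OF g integrable_gauss[OF t]])
    also have "\<dots> = (LINT y|\<mu>. t powr - (\<alpha> + 1) * (g y * gauss (1 / t) y))"
      unfolding fourier_bessel_gauss[OF t] by (simp only: mult_ac)
    also have "\<dots> = t powr - (\<alpha> + 1) * ((1 / t) powr - (\<alpha> + 1) * (LINT x|\<mu>. f x * gauss t x))"
      using dual[of "1 / t"] t by simp
    also have "\<dots> = (LINT x|\<mu>. f x * gauss t x)"
      using t by (simp add: powr_divide powr_minus field_simps)
    finally show "(LINT x|\<mu>. (f x - \<F> g x) * gauss t x) = 0"
      unfolding left_diff_distrib using fgauss[OF t] Ggauss[OF t] by simp
  qed
  then show ?thesis by eventually_elim simp
qed

text \<open>
  Duality with the test function \<open>g\<close> itself, whose transform is \<open>f\<close> by the inversion formula.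
\<close>

lemma fourier_bessel_plancherel:
  assumes fg: "has_fourier_bessel \<alpha> f g" and g: "integrable (\<mu>) g"
  shows "(LINT y|\<mu>. (g y)\<^sup>2) = (LINT x|\<mu>. (f x)\<^sup>2)"
proof -
  have f: "f \<in> borel_measurable \<mu>" "integrable \<mu> (\<lambda>x. (f x)\<^sup>2)"
    and g2: "integrable \<mu> (\<lambda>x. (g x)\<^sup>2)"
    using fg unfolding has_fourier_bessel_def Lp_space_2_iff by auto
  have inv: "AE x in \<mu>. f x = \<F> g x" by (rule fourier_bessel_inversion[OF fg g])
  have Gm: "\<F> g \<in> borel_measurable \<mu>"
    by (rule fourier_bessel_integral_measurable[OF g])
  have "integrable \<mu> (\<lambda>x. (\<F> g x)\<^sup>2)"
    by (rule integrable_cong_AE_imp[OF f(2)]) (use Gm inv in \<open>auto elim!: eventually_mono\<close>)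
  then have "(LINT y|\<mu>. g y * g y) = (LINT x|\<mu>. f x * \<F> g x)"
    by (rule has_fourier_bessel_duality[OF fg g g2])
  also have "\<dots> = (LINT x|\<mu>. f x * f x)"
    by (rule integral_cong_AE) (use f Gm inv in \<open>auto elim!: eventually_mono\<close>)
  finally show ?thesis by (simp add: power2_eq_square)
qed

section \<open>The weighted function is close to a modulated signal\<close>

lemma sqrt_bessel_weight_measurable:
  "(\<lambda>x. sqrt (w x)) \<in> borel_measurable (lebesgue_on A)"
  by (rule measurable_compose[OF bessel_weight_measurable borel_measurable_continuous_onI])
     (intro continuous_intros)

lemma bessel_weight_mono:
  assumes "0 \<le> x" "x \<le> y"
  shows "w x \<le> w y"
proof -
  have "0 \<le> 2 * pi powr (\<alpha> + 1) / Gamma (\<alpha> + 1)"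
    using Gamma_real_pos[of "\<alpha> + 1"] \<alpha> by simp
  then show ?thesis unfolding bessel_weight_def
    using assms \<alpha> by (intro mult_left_mono powr_mono2) auto
qed

lemma measure_bessel_eq:
  assumes A: "A \<in> sets lebesgue" "A \<subseteq> {0..}"
  shows "measure (\<mu>) A = (LINT x|lebesgue_on A. w x)"
proof -
  have Am: "A \<in> sets (\<mu>)"
    using A by (auto simp: sets_bessel_measure sets_restrict_space)
  have i: "indicator A \<in> borel_measurable (lebesgue_on {0..})"
    using A by (intro measurable_restrict_space1 borel_measurable_indicator)
  have "measure (\<mu>) A = (LINT x|\<mu>. indicator A x)"
    using A by (simp add: Int_absorb2)
  also have "\<dots> = (LINT x|lebesgue_on {0..}. w x * indicator A x)"
    using i by (rule integral_bessel_measure)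
  also have "\<dots> = (LINT x|lebesgue. indicator {0..} x *\<^sub>R (w x * indicator A x))"
    by (subst integral_restrict_space) auto
  also have "\<dots> = (LINT x|lebesgue. indicator A x *\<^sub>R w x)"
    using A by (intro Bochner_Integration.integral_cong) (auto split: split_indicator)
  also have "\<dots> = (LINT x|lebesgue_on A. w x)"
    using A by (subst integral_restrict_space) auto
  finally show ?thesis .
qed

lemma measure_bessel_bounds:
  assumes A: "A \<in> sets lebesgue" "A \<subseteq> {a..b}" and a: "0 \<le> a"
  shows "measure (\<mu>) A \<le> w b * measure lebesgue A"
    and "w a * measure lebesgue A \<le> measure (\<mu>) A"
proof -
  have Al: "A \<in> lmeasurable" by (rule fmeasurableI2[of "{a..b}"]) (use A in auto)
  interpret finite_measure "lebesgue_on A"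
    by (rule finite_measureI) (use fmeasurableD2[OF Al] A in \<open>simp add: emeasure_restrict_space\<close>)
  have le: "w x \<le> w b" "w a \<le> w x" if "x \<in> A" for x
  proof -
    have "a \<le> x" "x \<le> b" using A(2) that by auto
    then show "w x \<le> w b" "w a \<le> w x"
      using a by (auto intro!: bessel_weight_mono)
  qed
  have int: "integrable (lebesgue_on A) (w)"
    using le bessel_weight_nonneg
    by (intro integrable_const_bound[of _ "w b"] bessel_weight_measurable AE_I2) auto
  have eq: "measure (\<mu>) A = (LINT x|lebesgue_on A. w x)"
    by (rule measure_bessel_eq[OF A(1)]) (use A a in auto)
  have const: "(LINT x|lebesgue_on A. c) = c * measure lebesgue A" for c :: real
    using A by (simp add: measure_restrict_space)
  show "measure (\<mu>) A \<le> w b * measure lebesgue A"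
    unfolding eq const[symmetric] by (intro integral_mono int) (use le in auto)
  show "w a * measure lebesgue A \<le> measure (\<mu>) A"
    unfolding eq const[symmetric] by (intro integral_mono int) (use le in auto)
qed

text \<open>
  The weight is increasing, so a set of large weighted measure in \<open>[n, n + 1]\<close> has large Lebesgue
  measure provided that the weighted measure of the whole window is comparable to the maximal weight. The
  right half of the window suffices for that, because \<open>n + 1/2 \<ge> (n + 1) / 2\<close>.
\<close>

lemma relatively_dense_imp_lebesgue:
  assumes E: "E \<in> sets (\<mu>)" "relatively_dense \<alpha> \<gamma> E" and \<gamma>: "\<gamma> > 0"
  shows "\<gamma> * 2 powr - (2 * \<alpha> + 2) \<le> measure lebesgue (E \<inter> {real n..real n+1})"
proof -
  let ?m = "real n + 1"
  have El: "E \<in> sets lebesgue" using E(1) by (auto simp: sets_bessel_measure sets_restrict_space)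
  have wpos: "w ?m > 0" by (intro bessel_weight_pos) auto
  have half: "w ?m * 2 powr - (2 * \<alpha> + 1) \<le> w (real n + 1/2)"
  proof -
    have "w ?m * 2 powr - (2 * \<alpha> + 1) = w (?m / 2)"
    proof -
      have "(?m / 2) powr (2 * \<alpha> + 1) = ?m powr (2 * \<alpha> + 1) * 2 powr - (2 * \<alpha> + 1)"
        unfolding powr_minus_divide by (subst powr_divide) simp_all
      then show ?thesis unfolding bessel_weight_def by (simp only: mult.assoc)
    qed
    also have "\<dots> \<le> w (real n + 1/2)" by (intro bessel_weight_mono) auto
    finally show ?thesis .
  qed
  have "w ?m * (\<gamma> * 2 powr - (2 * \<alpha> + 2)) = \<gamma> * (w ?m * 2 powr - (2 * \<alpha> + 1) * (1/2))"
  proof -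
    have "2 powr - (2 * \<alpha> + 2) = 2 powr - (2 * \<alpha> + 1) * 2 powr (-1 :: real)"
      unfolding powr_add[symmetric] by (simp add: algebra_simps)
    then show ?thesis by (simp add: powr_minus)
  qed
  also have "\<dots> \<le> \<gamma> * (w (real n + 1/2) * (1/2))"
    using half \<gamma> by (intro mult_left_mono mult_right_mono) auto
  also have "w (real n + 1/2) * (1/2) = w (real n + 1/2) * measure lebesgue {real n + 1/2..?m}" by simp
  also have "\<dots> \<le> measure (\<mu>) {real n + 1/2..?m}"
    by (rule measure_bessel_bounds(2)) auto
  also have "\<dots> \<le> measure (\<mu>) {real n..?m}"
  proof -
    have fin: "{real n..?m} \<in> fmeasurable (\<mu>)"
    proof (rule fmeasurableI)
      show "{real n..?m} \<in> sets (\<mu>)" by (auto simp: sets_bessel_measure sets_restrict_space)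
      have "emeasure (\<mu>) {real n..?m} \<le> (\<integral>\<^sup>+ x. ennreal (w ?m) * indicator {real n..?m} x \<partial>lebesgue_on {0..})"
        unfolding bessel_measure_eq
        using bessel_weight_measurable[of "{0..}"]
        by (subst emeasure_density)
           (auto simp: sets_restrict_space intro!: nn_integral_mono ennreal_leI bessel_weight_mono split: split_indicator)
      also have "\<dots> < \<infinity>"
        by (subst nn_integral_cmult_indicator)
           (auto simp: sets_restrict_space emeasure_restrict_space ennreal_mult_less_top emeasure_lborel_Icc_eq)
      finally show "emeasure (\<mu>) {real n..?m} < \<infinity>" .
    qed
    show ?thesis by (rule measure_mono_fmeasurable[OF _ _ fin]) (auto simp: sets_bessel_measure sets_restrict_space)
  qed
  also have "\<gamma> * measure (\<mu>) {real n..?m} \<le> measure (\<mu>) (E \<inter> {real n..?m})"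
    using E(2) by (simp add: relatively_dense_def)
  also have "\<dots> \<le> w ?m * measure lebesgue (E \<inter> {real n..?m})"
    by (rule measure_bessel_bounds(1)[of _ "real n"]) (use El in auto)
  finally have "w ?m * (\<gamma> * 2 powr - (2 * \<alpha> + 2)) \<le> w ?m * measure lebesgue (E \<inter> {real n..?m})"
    using \<gamma> by (simp add: mult_left_mono)
  then show ?thesis using wpos by simp
qed

text \<open>
  Countably many of the open sets on which \<open>g\<close> vanishes almost everywhere cover their union (Lindelof).
\<close>

lemma ess_support_AE_zero:
  assumes "ess_support \<alpha> g \<subseteq> S"
  shows "AE x in \<mu>. x \<notin> S \<longrightarrow> g x = 0"
proof -
  define \<U> where "\<U> = {U. open U \<and> (AE x in \<mu>. x \<in> U \<longrightarrow> g x = 0)}"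
  obtain \<V> where \<V>: "\<V> \<subseteq> \<U>" "countable \<V>" "\<Union>\<V> = \<Union>\<U>"
    using Lindelof[of \<U>] by (auto simp: \<U>_def)
  have "AE x in \<mu>. \<forall>U\<in>\<V>. x \<in> U \<longrightarrow> g x = 0"
    using \<V> by (subst AE_ball_countable) (auto simp: \<U>_def)
  then show ?thesis using AE_space
  proof eventually_elim
    case (elim x)
    show ?case
    proof
      assume "x \<notin> S"
      then have "x \<in> \<Union>\<U>" using assms elim(2) by (auto simp: ess_support_def \<U>_def)
      then show "g x = 0" using elim(1) \<V>(3) by auto
    qed
  qed
qed

lemma sqrt_bessel_weight:
  "sqrt (w x) = sqrt (2 * pi powr (\<alpha> + 1) / Gamma (\<alpha> + 1)) * x powr (\<alpha> + 1/2)"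
proof -
  have eq: "x powr (2 * \<alpha> + 1) = (x powr (\<alpha> + 1/2))\<^sup>2"
    unfolding power2_eq_square powr_add[symmetric] by (simp add: algebra_simps)
  show ?thesis unfolding bessel_weight_def eq real_sqrt_mult by simp
qed

lemma integrable_of_square_integrable_supported:
  assumes R: "R \<ge> 0" and g: "g \<in> Lp_space 2 \<alpha>"
    and supp: "AE y in \<mu>. y \<notin> {R..R+1} \<longrightarrow> g y = 0"
  shows "integrable (\<mu>) g"
proof -
  have i: "indicator {R..R+1} \<in> borel_measurable (lebesgue_on {0..})"
    by (intro measurable_restrict_space1 borel_measurable_indicator) simp
  have "integrable (lebesgue_on {0..}) (\<lambda>x. w x * indicator {R..R+1} x)"
  proof (rule Bochner_Integration.integrable_bound)
    have int: "integrable lebesgue (\<lambda>x. indicator {R..R+1} x * w (R + 1))"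
      by (intro integrable_mult_left integrable_real_indicator) (auto simp: emeasure_lborel_Icc_eq)
    have s: "{0::real..} \<inter> space lebesgue \<in> sets lebesgue" by simp
    show "integrable (lebesgue_on {0..}) (\<lambda>x. indicator {R..R+1} x * w (R + 1))"
      unfolding integrable_restrict_space[OF s] by (rule integrable_mult_indicator[OF _ int]) simp
    show "(\<lambda>x. w x * indicator {R..R+1} x) \<in> borel_measurable (lebesgue_on {0..})"
      using bessel_weight_measurable i by (rule borel_measurable_times)
    show "AE x in lebesgue_on {0..}. norm (w x * indicator {R..R+1} x)
        \<le> norm (indicator {R..R+1} x * w (R + 1))"
      using R bessel_weight_nonneg bessel_weight_mono
      by (intro AE_I2) (auto split: split_indicator)
  qed
  then have "integrable (\<mu>) (indicator {R..R+1} :: real \<Rightarrow> real)"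
    by (simp add: integrable_bessel_measure_iff[OF i])
  then have "integrable (\<mu>) (\<lambda>x. indicator {R..R+1} x + (g x)\<^sup>2)"
    using g by (intro Bochner_Integration.integrable_add) (auto simp: Lp_space_2_iff)
  then show ?thesis
  proof (rule Bochner_Integration.integrable_bound)
    show "AE x in \<mu>. norm (g x) \<le> norm (indicator {R..R+1} x + (g x)\<^sup>2)"
      using supp
    proof eventually_elim
      case (elim x)
      have "\<bar>g x\<bar> \<le> 1 + (g x)\<^sup>2"
        using zero_le_power2[of "\<bar>g x\<bar> - 1/2"] by (simp add: power2_eq_square algebra_simps)
      then show ?case using elim by (cases "x \<in> {R..R+1}") auto
    qed
  qed (use g in \<open>auto simp: Lp_space_2_iff\<close>)
qed

lemma weighted_L2:
  assumes f: "f \<in> Lp_space 2 \<alpha>"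
  defines "F \<equiv> \<lambda>x. sqrt (w x) * f x"
  shows "F \<in> borel_measurable (lebesgue_on {0..})"
    and "integrable (lebesgue_on {0..}) (\<lambda>x. (F x)\<^sup>2)"
    and "(LINT x|lebesgue_on {0..}. (F x)\<^sup>2) = (LINT x|\<mu>. (f x)\<^sup>2)"
    and "E \<in> sets lebesgue \<Longrightarrow>
      (LINT x|lebesgue_on {0..}. indicator E x * (F x)\<^sup>2) = (LINT x|\<mu>. indicator E x * (f x)\<^sup>2)"
proof -
  have fm: "f \<in> borel_measurable (lebesgue_on {0..})" and f2: "integrable \<mu> (\<lambda>x. (f x)\<^sup>2)"
    using f by (simp_all add: Lp_space_2_iff measurable_bessel_measure_iff)
  have Fsq: "(F x)\<^sup>2 = w x * (f x)\<^sup>2" for x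
    using bessel_weight_nonneg[of x] by (simp add: F_def power_mult_distrib)
  have f2m: "(\<lambda>x. (f x)\<^sup>2) \<in> borel_measurable (lebesgue_on {0..})" using fm by (rule borel_measurable_power)
  show "F \<in> borel_measurable (lebesgue_on {0..})"
    unfolding F_def by (rule borel_measurable_times[OF sqrt_bessel_weight_measurable fm])
  show "integrable (lebesgue_on {0..}) (\<lambda>x. (F x)\<^sup>2)"
    unfolding Fsq using f2 integrable_bessel_measure_iff[OF f2m] by simp
  show "(LINT x|lebesgue_on {0..}. (F x)\<^sup>2) = (LINT x|\<mu>. (f x)\<^sup>2)"
    unfolding Fsq by (rule integral_bessel_measure[OF f2m, symmetric])
  assume E: "E \<in> sets lebesgue"
  have "(\<lambda>x. indicator E x * (f x)\<^sup>2) \<in> borel_measurable (lebesgue_on {0..})"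
    by (rule borel_measurable_times[OF measurable_restrict_space1[OF borel_measurable_indicator] f2m]) (rule E)
  from integral_bessel_measure[OF this]
  show "(LINT x|lebesgue_on {0..}. indicator E x * (F x)\<^sup>2) = (LINT x|\<mu>. indicator E x * (f x)\<^sup>2)"
    unfolding Fsq by (simp add: mult.left_commute)
qed

text \<open>
  By inversion \<open>f\<close> is the integral of \<open>g\<close> against the Bessel kernel. After symmetrisation the kernel
  is \<open>\<kappa> * u (2 \<pi> x y)\<close> with \<open>u z = z powr (\<alpha> + 1/2) * j z\<close>, to which the asymptotics apply with
  \<open>2 \<pi> y \<ge> R\<close>; Cauchy-Schwarz over the interval of length one bounds the error by the norm of \<open>h\<close>. The
  norms of \<open>F\<close> and \<open>h\<close> agree by Plancherel's identity.
\<close>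

lemma weighted_fourier_bessel_near_band:
  obtains W :: complex and C0 :: real where
    "\<And>R f g. R \<ge> 0 \<Longrightarrow> has_fourier_bessel \<alpha> f g \<Longrightarrow> ess_support \<alpha> g \<subseteq> {R..R+1} \<Longrightarrow>
       near_band W C0 R (\<lambda>x. sqrt (w x) * f x) (\<lambda>y. sqrt (w y) * g y)"
proof -
  obtain W C where C: "C > 0"
    and asym: "\<And>x. x \<ge> 0 \<Longrightarrow> \<bar>x powr (\<alpha> + 1/2) * bessel_j \<alpha> x - Re (W * cis x)\<bar> \<le> C / (1 + x)"
    using bessel_j_asymptotics[OF \<alpha>] by blast
  define c where "c = 2 * pi powr (\<alpha> + 1) / Gamma (\<alpha> + 1)"
  have c: "c > 0" using \<alpha> Gamma_real_pos[of "\<alpha> + 1"] by (simp add: c_def)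
  define \<kappa> where "\<kappa> = c / (2 * pi) powr (\<alpha> + 1/2)"
  have \<kappa>: "\<kappa> > 0" using c by (simp add: \<kappa>_def)
  show ?thesis
  proof (rule that[of "of_real \<kappa> * W" "\<kappa> * C"])
    fix R :: real and f g :: "real \<Rightarrow> real"
    assume R: "R \<ge> 0" and fg: "has_fourier_bessel \<alpha> f g" and ess: "ess_support \<alpha> g \<subseteq> {R..R+1}"
    define N where "N = lebesgue_on {R..R+1}"
    define F where "F x = sqrt (w x) * f x" for x
    define h where "h y = sqrt (w y) * g y" for y
    interpret finite_measure N unfolding N_def by (rule finite_measure_lebesgue_on_Icc)
    have f: "f \<in> Lp_space 2 \<alpha>" and g: "g \<in> Lp_space 2 \<alpha>"
      using fg by (auto simp: has_fourier_bessel_def)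
    note F = weighted_L2[OF f, folded F_def] and h = weighted_L2[OF g, folded h_def]
    have supp: "AE y in \<mu>. y \<notin> {R..R+1} \<longrightarrow> g y = 0" by (rule ess_support_AE_zero[OF ess])
    have g1: "integrable \<mu> g" by (rule integrable_of_square_integrable_supported[OF R g supp])
    have gm: "g \<in> borel_measurable (lebesgue_on {0..})"
      using g by (simp add: Lp_space_2_iff measurable_bessel_measure_iff)
    have sub: "{R..R+1} \<subseteq> {0..}" using R by auto
    have hz: "AE y in lebesgue_on {0..}. y \<notin> {R..R+1} \<longrightarrow> h y = 0"
      using supp unfolding AE_bessel_measure_iff by eventually_elim (auto simp: h_def)
    have toN: "u \<in> borel_measurable N" if "u \<in> borel_measurable (lebesgue_on {0..})" for u :: "real \<Rightarrow> real"
      unfolding N_def by (rule measurable_restrict_mono[OF that sub])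
    have restrict: "(LINT y|lebesgue_on {0..}. u y) = (LINT y|N. u y)"
        "integrable (lebesgue_on {0..}) u \<Longrightarrow> integrable N u"
      if "u \<in> borel_measurable (lebesgue_on {0..})" "\<And>y. h y = 0 \<Longrightarrow> u y = 0" for u :: "real \<Rightarrow> real"
    proof -
      have "AE y in lebesgue_on {0..}. y \<notin> {R..R+1} \<longrightarrow> u y = 0"
        using hz by eventually_elim (auto simp: that(2))
      from integral_restrict_support[OF that(1) _ sub this]
      show "(LINT y|lebesgue_on {0..}. u y) = (LINT y|N. u y)"
        "integrable (lebesgue_on {0..}) u \<Longrightarrow> integrable N u" by (simp_all add: N_def)
    qed
    have hm: "h \<in> borel_measurable N" by (rule toN[OF h(1)])
    have hsqm: "(\<lambda>y. (h y)\<^sup>2) \<in> borel_measurable (lebesgue_on {0..})" using h(1) by (rule borel_measurable_power)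
    have h2: "integrable N (\<lambda>y. (h y)\<^sup>2)" by (rule restrict(2)[OF hsqm _ h(2)]) simp
    have h1: "integrable N h" by (rule square_integrable_imp_integrable[OF hm h2])
    have "(LINT y|N. (h y)\<^sup>2) = (LINT y|\<mu>. (g y)\<^sup>2)"
      unfolding h(3)[symmetric] by (rule restrict(1)[OF hsqm, symmetric]) simp
    also have "\<dots> = (LINT x|lebesgue_on {0..}. (F x)\<^sup>2)"
      unfolding F(3) by (rule fourier_bessel_plancherel[OF fg g1])
    finally have hF: "(LINT y|N. (h y)\<^sup>2) = (LINT x|lebesgue_on {0..}. (F x)\<^sup>2)" .
    have pointwise: "(sqrt (w x) * \<F> g x - Re (of_real \<kappa> * W * band_synthesis R h x))\<^sup>2
        \<le> (\<kappa> * C / (1 + x * R))\<^sup>2 * (LINT y|N. (h y)\<^sup>2)" if x: "x \<ge> 0" for x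
    proof -
      define k where "k y = \<kappa> * ((2 * pi * x * y) powr (\<alpha> + 1/2) * bessel_j \<alpha> (2 * pi * x * y))" for y
      define l where "l y = \<kappa> * Re (W * cis (2 * pi * x * y))" for y
      have jm: "(\<lambda>y::real. bessel_j \<alpha> (2 * pi * y * x)) \<in> borel_measurable (lebesgue_on {0..})"
        using bessel_kernel_measurable by (simp add: measurable_bessel_measure_iff)
      have km: "k \<in> borel_measurable (lebesgue_on {0..})"
      proof -
        have "(\<lambda>y::real. (2 * pi * x * y) powr (\<alpha> + 1/2)) \<in> borel_measurable lborel" by measurable
        then have "(\<lambda>y. (2 * pi * x * y) powr (\<alpha> + 1/2)) \<in> borel_measurable (lebesgue_on {0..})"
          by (intro measurable_restrict_space1 measurable_completion)
        moreover have "(\<lambda>y. bessel_j \<alpha> (2 * pi * x * y)) \<in> borel_measurable (lebesgue_on {0..})"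
          using jm by (simp add: mult_ac)
        ultimately show ?thesis unfolding k_def by (intro borel_measurable_times) auto
      qed
      have lm: "l \<in> borel_measurable N"
        unfolding l_def N_def by (intro continuous_imp_measurable_lebesgue_on continuous_intros)
      have Fg: "sqrt (w x) * \<F> g x = (LINT y|N. h y * k y)"
      proof -
        have "\<F> g x = (LINT y|lebesgue_on {0..}. w y * (g y * bessel_j \<alpha> (2 * pi * y * x)))"
          unfolding fourier_bessel_integral_def
          by (rule integral_bessel_measure[OF borel_measurable_times[OF gm jm]])
        then have "sqrt (w x) * \<F> g x =
           (LINT y|lebesgue_on {0..}. sqrt (w x) * (w y * (g y * bessel_j \<alpha> (2 * pi * y * x))))" by simp
        also have "\<dots> = (LINT y|lebesgue_on {0..}. h y * k y)"
        proof (rule Bochner_Integration.integral_cong[OF refl])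
          fix y :: real assume "y \<in> space (lebesgue_on {0..})"
          then have y: "y \<ge> 0" by simp
          have "(2 * pi * x * y) powr (\<alpha> + 1/2) = (2 * pi) powr (\<alpha> + 1/2) * (x powr (\<alpha> + 1/2) * y powr (\<alpha> + 1/2))"
            using x y by (simp add: powr_mult mult_ac)
          then have sw: "sqrt (w x) * sqrt (w y) = \<kappa> * (2 * pi * x * y) powr (\<alpha> + 1/2)"
            unfolding sqrt_bessel_weight c_def[symmetric] using c by (simp add: \<kappa>_def mult_ac)
          define s where "s = sqrt (w y)"
          have ws: "w y = s * s" using bessel_weight_nonneg[of y] by (simp add: s_def)
          have "sqrt (w x) * (w y * (g y * bessel_j \<alpha> (2 * pi * y * x))) =
            (s * g y) * ((sqrt (w x) * s) * bessel_j \<alpha> (2 * pi * y * x))"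
            by (simp only: ws mult_ac)
          also have "\<dots> = h y * k y" unfolding s_def sw k_def h_def by (simp add: mult_ac)
          finally show "sqrt (w x) * (w y * (g y * bessel_j \<alpha> (2 * pi * y * x))) = h y * k y" .
        qed
        also have "\<dots> = (LINT y|N. h y * k y)"
          by (rule restrict(1)[OF borel_measurable_times[OF h(1) km]]) simp
        finally show ?thesis .
      qed
      have ReW: "Re (of_real \<kappa> * W * band_synthesis R h x) = (LINT y|N. h y * l y)"
      proof -
        have "integrable N (\<lambda>y. of_real (h y) * cis (2 * pi * x * y))"
          by (rule integrable_mult_bounded[where B = 1, OF h1])
             (auto simp: N_def intro!: continuous_imp_measurable_lebesgue_on continuous_intros)
        then have i: "integrable N (\<lambda>y. of_real \<kappa> * W * (of_real (h y) * cis (2 * pi * x * y)))" by simp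
        have "Re (of_real \<kappa> * W * band_synthesis R h x) =
          Re (LINT y|N. of_real \<kappa> * W * (of_real (h y) * cis (2 * pi * x * y)))"
          by (simp add: band_synthesis_def N_def)
        also have "\<dots> = (LINT y|N. Re (of_real \<kappa> * W * (of_real (h y) * cis (2 * pi * x * y))))"
          using integral_Re[OF i] by simp
        also have "\<dots> = (LINT y|N. h y * l y)"
          by (intro Bochner_Integration.integral_cong refl) (simp add: l_def algebra_simps)
        finally show ?thesis .
      qed
      have lb: "\<bar>k y - l y\<bar> \<le> \<kappa> * C / (1 + x * R)" if "y \<in> {R..R+1}" for y
      proof -
        have y: "y \<ge> 0" "R \<le> y" using that R by auto
        have "R \<le> 2 * pi * y" using y mult_right_mono[of 1 "2 * pi" y] pi_gt3 by simp
        then have ge: "x * R \<le> 2 * pi * x * y"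
          using mult_left_mono[of R "2 * pi * y" x] x by (simp add: mult_ac)
        have "\<bar>k y - l y\<bar> = \<kappa> * \<bar>(2 * pi * x * y) powr (\<alpha> + 1/2) * bessel_j \<alpha> (2 * pi * x * y) - Re (W * cis (2 * pi * x * y))\<bar>"
          unfolding k_def l_def right_diff_distrib[symmetric] abs_mult using \<kappa> by simp
        also have "\<dots> \<le> \<kappa> * (C / (1 + 2 * pi * x * y))"
          using \<kappa> x y by (intro mult_left_mono asym) auto
        also have "\<dots> \<le> \<kappa> * (C / (1 + x * R))"
        proof -
          have "0 < 1 + x * R" "0 < 1 + 2 * pi * x * y" using x R y by (simp_all add: add_pos_nonneg)
          then show ?thesis
            using \<kappa> C ge by (intro mult_left_mono divide_left_mono mult_pos_pos) auto
        qed
        finally show ?thesis by simp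
      qed
      have dm: "(\<lambda>y. k y - l y) \<in> borel_measurable N" using toN[OF km] lm by (rule borel_measurable_diff)
      have "\<bar>l y\<bar> \<le> \<kappa> * norm W" for y
        using abs_Re_le_cmod[of "W * cis (2 * pi * x * y)"] \<kappa>
        unfolding l_def abs_mult by (simp add: norm_mult)
      then have il: "integrable N (\<lambda>y. h y * l y)"
        by (rule integrable_mult_bounded_real[OF h1 lm])
      have "integrable N (\<lambda>y. h y * (k y - l y))"
        by (rule integrable_mult_bounded_real[OF h1 dm lb]) (simp add: N_def)
      then have "(LINT y|N. h y * k y) = (LINT y|N. h y * (k y - l y)) + (LINT y|N. h y * l y)"
        using il by (subst Bochner_Integration.integral_add[symmetric]) (simp_all add: algebra_simps)
      then have "sqrt (w x) * \<F> g x - Re (of_real \<kappa> * W * band_synthesis R h x) = (LINT y|N. h y * (k y - l y))"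
        unfolding Fg ReW by simp
      moreover have "(LINT y|N. h y * (k y - l y))\<^sup>2 \<le> (\<kappa> * C / (1 + x * R))\<^sup>2 * (LINT y|N. (h y)\<^sup>2)"
        unfolding N_def by (rule square_integral_mult_le) (use hm h2 dm lb in \<open>auto simp: N_def\<close>)
      ultimately show ?thesis by simp
    qed
    have "AE x in lebesgue_on {0..}. f x = \<F> g x"
      using fourier_bessel_inversion[OF fg g1] unfolding AE_bessel_measure_iff .
    then have "AE x in lebesgue_on {0..}. (F x - Re (of_real \<kappa> * W * band_synthesis R h x))\<^sup>2
        \<le> (\<kappa> * C / (1 + x * R))\<^sup>2 * (LINT y|N. (h y)\<^sup>2)"
      using AE_space
    proof eventually_elim
      case (elim x)
      then show ?case using pointwise[of x] by (simp add: F_def)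
    qed
    then have "near_band (of_real \<kappa> * W) (\<kappa> * C) R F h"
      using F(2) hm h2 hF unfolding near_band_def N_def by simp
    then show "near_band (of_real \<kappa> * W) (\<kappa> * C) R (\<lambda>x. sqrt (w x) * f x) (\<lambda>y. sqrt (w y) * g y)"
      by (simp only: F_def[abs_def] h_def[abs_def])
  qed
qed

end

section \<open>The uncertainty inequality\<close>

theorem theorem1p3:
  fixes \<alpha> \<gamma> :: real
  assumes "\<alpha> > -1/2" and "\<gamma> > 0"
  shows "\<exists>C>0. \<forall>E \<in> sets (bessel_measure \<alpha>). relatively_dense \<alpha> \<gamma> E \<longrightarrow>
           (\<forall>\<^sub>F R in at_top. \<forall>f \<in> Lp_space 2 \<alpha>. \<forall>g.
              has_fourier_bessel \<alpha> f g \<longrightarrow> ess_support \<alpha> g \<subseteq> {R..R+1} \<longrightarrow>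
              Lp_norm 2 \<alpha> f \<le> C * Lp_norm_on 2 \<alpha> E f)"
proof -
  note \<alpha> = assms(1)
  define \<sigma> where "\<sigma> = min 1 (\<gamma> * 2 powr - (2 * \<alpha> + 2))"
  have \<sigma>: "0 < \<sigma>" "\<sigma> \<le> 1" using assms by (auto simp: \<sigma>_def)
  obtain W C0 where near:
    "\<And>R f g. R \<ge> 0 \<Longrightarrow> has_fourier_bessel \<alpha> f g \<Longrightarrow> ess_support \<alpha> g \<subseteq> {R..R+1} \<Longrightarrow>
       near_band W C0 R (\<lambda>x. sqrt (bessel_weight \<alpha> x) * f x) (\<lambda>y. sqrt (bessel_weight \<alpha> y) * g y)"
    by (rule weighted_fourier_bessel_near_band[OF \<alpha>]) blast
  \<comment> \<open>These constants depend on \<open>\<alpha>\<close> and \<open>\<gamma>\<close> only, since \<open>W\<close> and \<open>C0\<close> come from the asymptotics of the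
    Bessel function.\<close>
  obtain K R0 where K: "K > 0" and R0: "R0 \<ge> 1" and core:
    "\<And>R E F h. R \<ge> R0 \<Longrightarrow> E \<in> sets lebesgue \<Longrightarrow>
       (\<And>n. measure lebesgue (E \<inter> {real n..real n+1}) \<ge> \<sigma>) \<Longrightarrow> near_band W C0 R F h \<Longrightarrow>
       (LINT x|lebesgue_on {0..}. (F x)\<^sup>2) \<le> K * (LINT x|lebesgue_on {0..}. indicator E x * (F x)\<^sup>2)"
    by (rule logvinenko_sereda_modulated[OF \<sigma>, where W = W and ?C0.0 = C0]) blast
  have main: "Lp_norm 2 \<alpha> f \<le> sqrt K * Lp_norm_on 2 \<alpha> E f"
    if E: "E \<in> sets (bessel_measure \<alpha>)" "relatively_dense \<alpha> \<gamma> E" and R: "R \<ge> R0"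
      and fg: "has_fourier_bessel \<alpha> f g" and ess: "ess_support \<alpha> g \<subseteq> {R..R+1}" for E R f g
  proof -
    have El: "E \<in> sets lebesgue" using E(1) by (auto simp: sets_bessel_measure[OF \<alpha>] sets_restrict_space)
    have dens: "measure lebesgue (E \<inter> {real n..real n+1}) \<ge> \<sigma>" for n
      using relatively_dense_imp_lebesgue[OF \<alpha> E assms(2), of n] by (simp add: \<sigma>_def)
    have f: "f \<in> Lp_space 2 \<alpha>" using fg by (simp add: has_fourier_bessel_def)
    have "near_band W C0 R (\<lambda>x. sqrt (bessel_weight \<alpha> x) * f x) (\<lambda>y. sqrt (bessel_weight \<alpha> y) * g y)"
      using near[OF _ fg ess] R R0 by simp
    from core[OF R El dens this]
    have "(LINT x|bessel_measure \<alpha>. (f x)\<^sup>2) \<le> K * (LINT x|bessel_measure \<alpha>. indicator E x * (f x)\<^sup>2)"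
      unfolding weighted_L2(3)[OF \<alpha> f] weighted_L2(4)[OF \<alpha> f El] .
    then show ?thesis
      unfolding Lp_norm_2[OF \<alpha>] Lp_norm_on_2[OF \<alpha>, of E] real_sqrt_mult[symmetric] by (rule real_sqrt_le_mono)
  qed
  show ?thesis
  proof (intro exI[of _ "sqrt K"] conjI ballI impI)
    show "sqrt K > 0" using K by simp
    fix E assume E: "E \<in> sets (bessel_measure \<alpha>)" "relatively_dense \<alpha> \<gamma> E"
    show "\<forall>\<^sub>F R in at_top. \<forall>f \<in> Lp_space 2 \<alpha>. \<forall>g.
              has_fourier_bessel \<alpha> f g \<longrightarrow> ess_support \<alpha> g \<subseteq> {R..R+1} \<longrightarrow>
              Lp_norm 2 \<alpha> f \<le> sqrt K * Lp_norm_on 2 \<alpha> E f"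
      using eventually_ge_at_top[of R0]
    proof eventually_elim
      case (elim R)
      then show ?case using main[OF E] by blast
    qed
  qed
qed

end
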